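(* Let $E\subset\mathbb{R}$ be a compact non-polar set. Then boundedness of the Widom factors is independent of the normalization point: for any $x_1,x_2\in\overline{\mathbb{R}}\setminus E$, \[ \sup_{n\ge1}\mathcal{W}_n(E,x_1)<\infty\quad\Longleftrightarrow\quad \sup_{n\ge1}\mathcal{W}_n(E,x_2)<\infty . \]
   Context: $\overline{\mathbb{R}}=\mathbb{R}\cup\{\infty\}$. Non-polar means of positive logarithmic capacity $\mathrm{Cap}(E)>0$. $G_E(z)=G_E(z,\infty)$ is the Green function of $\overline{\mathbb{C}}\setminus E$ with pole at $\infty$. $\|\cdot\|_E$ is the supremum norm on $E$. Chebyshev case ($x_*=\infty$): $T_{n,\infty}$ is the unique monic polynomial of degree $n$ minimizing $\|\cdot\|_E$, and the Widom factor is $\mathcal{W}_n(E,\infty)=\|T_{n,\infty}\|_E/\mathrm{Cap}(E)^n$. Residual case ($x_*\in\mathbb{R}\setminus E$): $T_{n,x_*}$ is the unique polynomial minimizing $\|P\|_E$ among all polynomials $P$ of degree at most $n$ with $P(x_* )=1$; with $\mathrm{Cap}(E,x_* )=\exp[-G_E(x_* )]$, the Widom factor is $\mathcal{W}_n(E,x_* )=\|T_{n,x_*}\|_E\,[\mathrm{Cap}(E,x_* )^n+\mathrm{Cap}(E,x_* )^{-n}]$. *)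

theory Defs
  imports "HOL-Analysis.Analysis" "HOL-Computational_Algebra.Polynomial"
    "HOL-Library.Landau_Symbols"
begin

section \<open>Logarithmic capacity\<close>

definition prob_measure_on :: "complex set \<Rightarrow> complex measure \<Rightarrow> bool" where
  "prob_measure_on E \<mu> \<longleftrightarrow>
     sets \<mu> = sets borel \<and> emeasure \<mu> (space \<mu>) = 1 \<and>
     (\<exists>K. compact K \<and> K \<subseteq> E \<and> emeasure \<mu> K = 1)"

text \<open>
  The energy is the double integral of \<open>log (1 / |z - w|)\<close>, with values in \<open>(-\<infinity>, \<infinity>]\<close>, written
  as the integral of the positive part minus that of the negative part (coercion to \<open>ennreal\<close>
  truncates negative values to 0). The latter is finite for compactly supported \<open>\<mu>\<close>. On the
  diagonal the kernel is \<open>\<infinity>\<close>, which has to be said explicitly because \<open>ln 0 = 0\<close>.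
\<close>

definition log_energy :: "complex measure \<Rightarrow> ereal" where
  "log_energy \<mu> =
     enn2ereal (\<integral>\<^sup>+ z. (\<integral>\<^sup>+ w. (if z = w then \<infinity> else ennreal (- ln (dist z w))) \<partial>\<mu>) \<partial>\<mu>)
   - enn2ereal (\<integral>\<^sup>+ z. (\<integral>\<^sup>+ w. (if z = w then 0 else ennreal (ln (dist z w))) \<partial>\<mu>) \<partial>\<mu>)"

definition robin_constant :: "complex set \<Rightarrow> ereal" where
  "robin_constant E = (INF \<mu>\<in>{\<mu>. prob_measure_on E \<mu>}. log_energy \<mu>)"

text \<open>
  \<open>exp (- V)\<close> with \<open>exp (-\<infinity>) = 0\<close>; intended for bounded sets, where \<open>V > -\<infinity>\<close>.
  Sets that carry no compactly supported probability measure of finite energy, in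
  particular the empty set, have capacity 0.
\<close>

definition capacity :: "complex set \<Rightarrow> real" where
  "capacity E =
     (if robin_constant E = \<infinity> then 0 else exp (- real_of_ereal (robin_constant E)))"

section \<open>The Green function with pole at infinity\<close>

text \<open>Twice continuously differentiable with vanishing Laplacian.\<close>

definition harmonic_on :: "(complex \<Rightarrow> real) \<Rightarrow> complex set \<Rightarrow> bool" where
  "harmonic_on u S \<longleftrightarrow>
     (\<exists>ux uy uxx uxy uyx uyy.
        (\<forall>z\<in>S. (u has_derivative (\<lambda>h. ux z * Re h + uy z * Im h)) (at z)) \<and>
        (\<forall>z\<in>S. (ux has_derivative (\<lambda>h. uxx z * Re h + uxy z * Im h)) (at z)) \<and>
        (\<forall>z\<in>S. (uy has_derivative (\<lambda>h. uyx z * Re h + uyy z * Im h)) (at z)) \<and>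
        continuous_on S uxx \<and> continuous_on S uxy \<and>
        continuous_on S uyx \<and> continuous_on S uyy \<and>
        (\<forall>z\<in>S. uxx z + uyy z = 0))"

text \<open>
  The Green function of \<open>(\<complex> \<union> {\<infinity>}) - E\<close> with pole at \<open>\<infinity>\<close>, for compact non-polar \<open>E\<close> whose
  complement is connected: it is harmonic off \<open>E\<close>, bounded away from the pole, equal to
  \<open>log |z| + O(1)\<close> at the pole, and tends to 0 at all boundary points outside a Borel polar set.
  These conditions say nothing about values on \<open>E\<close> itself, which are put to 0 so that the
  function is unique as a total function on \<open>\<complex>\<close>.
\<close>

definition is_green_function :: "complex set \<Rightarrow> (complex \<Rightarrow> real) \<Rightarrow> bool" where
  "is_green_function E g \<longleftrightarrow>
     harmonic_on g (- E) \<and>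
     (\<forall>r. bounded (g ` (cball 0 r - E))) \<and>
     (\<lambda>z. g z - ln (cmod z)) \<in> O[at_infinity](\<lambda>_. 1) \<and>
     (\<exists>N. N \<in> sets borel \<and> capacity N = 0 \<and>
        (\<forall>\<zeta>\<in>frontier E - N. (g \<longlongrightarrow> 0) (at \<zeta> within - E))) \<and>
     (\<forall>z\<in>E. g z = 0)"

definition green_function :: "complex set \<Rightarrow> complex \<Rightarrow> real" where
  "green_function E = (THE g. is_green_function E g)"

section \<open>Extremal polynomials and Widom factors\<close>

definition sup_norm :: "complex set \<Rightarrow> complex poly \<Rightarrow> real" where
  "sup_norm E p = (SUP z\<in>E. cmod (poly p z))"

definition chebyshev_poly :: "complex set \<Rightarrow> nat \<Rightarrow> complex poly" where
  "chebyshev_poly E n =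
     (THE p. degree p = n \<and> lead_coeff p = 1 \<and>
        (\<forall>q. degree q = n \<and> lead_coeff q = 1 \<longrightarrow> sup_norm E p \<le> sup_norm E q))"

definition residual_poly :: "complex set \<Rightarrow> nat \<Rightarrow> complex \<Rightarrow> complex poly" where
  "residual_poly E n a =
     (THE p. degree p \<le> n \<and> poly p a = 1 \<and>
        (\<forall>q. degree q \<le> n \<and> poly q a = 1 \<longrightarrow> sup_norm E p \<le> sup_norm E q))"

definition capacity_at :: "complex set \<Rightarrow> complex \<Rightarrow> real" where
  "capacity_at E a = exp (- green_function E a)"

text \<open>
  Points of \<open>\<complex> \<union> {\<infinity>}\<close> are elements of \<open>complex option\<close>, with \<open>None\<close> for \<open>\<infinity>\<close>, as in
  the library's \<open>Alexandroff_compactification\<close>.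
\<close>

definition widom_factor :: "complex set \<Rightarrow> nat \<Rightarrow> complex option \<Rightarrow> real" where
  "widom_factor E n x =
     (case x of
        None \<Rightarrow> sup_norm E (chebyshev_poly E n) / capacity E ^ n
      | Some a \<Rightarrow> sup_norm E (residual_poly E n a) *
                  (capacity_at E a ^ n + inverse (capacity_at E a) ^ n))"

definition extended_reals :: "complex option set" where
  "extended_reals = insert None (Some ` \<real>)"

end

theory Submission
  imports Defs "HOL-Probability.Probability" "HOL-Complex_Analysis.Complex_Analysis"
    "HOL-Computational_Algebra.Computational_Algebra"
begin

text \<open>
  Let \<open>G\<close> be the Green function. By Bernstein-Walsh, \<open>h = n G - ln |p|\<close> is nonnegative for every
  polynomial \<open>p\<close> of degree at most \<open>n\<close> with \<open>|p| \<le> 1\<close> on \<open>E\<close>, and up to a factor 2 the Widom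
  factor at \<open>a\<close> is the infimum of \<open>exp (h a)\<close> over all such \<open>p\<close>. So the claim
  would be Harnack's inequality for \<open>h\<close>, were it not for the zeros of \<open>p\<close>. But the zeros close to
  \<open>a\<close> and far from \<open>E\<close> can be removed: replacing \<open>z - \<zeta>\<close> by the constant \<open>s\<close> with
  \<open>|a - \<zeta>| \<le> s \<le> dist \<zeta> E\<close> neither increases \<open>|p|\<close> on \<open>E\<close> nor decreases \<open>|p a|\<close>.
  Hence boundedness is a locally constant property of \<open>a\<close> on the connected complement of \<open>E\<close>.
  At infinity one replaces \<open>z - \<zeta>\<close> by a multiple of \<open>z\<close> instead, which keeps the degree.

  The Green function is \<open>V - ln D + \<integral> ln |z - t| dM(t)\<close> for the equilibrium measure \<open>M\<close>.
  Its uniqueness is an extended maximum principle, for which a compact polar set \<open>F\<close>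
  needs potentials of probability measures on \<open>F\<close> that are arbitrarily large on all of \<open>F\<close>.
  These are the equilibrium potentials of the truncated kernels \<open>min n K\<close>: for a bounded kernel point
  masses have finite energy, so the variational inequality holds at every point of \<open>F\<close>.
\<close>

text \<open>\<open>green_function\<close> is a definite description over all twice continuously
  differentiable competitors, which may misbehave on Borel polar sets; no Widom factor at a finite
  point can be evaluated before uniqueness is known. Functions built here from logarithms satisfy
  the stronger \<open>hol_grad\<close>, so Harnack reduces to the Schwarz lemma, while
  \<open>harmonic_on\<close> is kept for the competitors. What matters in the Harnack steps is that
  no constant depends on \<open>n\<close>: once zeros are removed, \<open>h\<close> is nonnegative
  and harmonic in a disc fixed in advance, and a bound \<open>C\<close> on \<open>exp (h a)\<close>
  turns into a fixed power of \<open>C\<close>. The factor 2 comes from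
  \<open>Cap(E,a)^n + Cap(E,a)^(-n)\<close>, which lies between \<open>exp (n G)\<close> and twice
  that because \<open>G\<close> is nonnegative. At infinity the role of \<open>h a\<close> is played
  by \<open>n * (V - ln D) - ln |lead_coeff p|\<close>, where \<open>V - ln D\<close> is minus the
  logarithm of the capacity.\<close>

section \<open>Logarithmic energy of measures on the line\<close>

text \<open>With \<open>D\<close> at least the diameter of the set the kernel is nonnegative, so that energies and
  potentials are integrals in \<open>ennreal\<close> and differ from the usual ones by \<open>ln D\<close>.
  At distances beyond \<open>D\<close> the coercion truncates the kernel to 0.\<close>

definition log_kernel :: "real \<Rightarrow> real \<Rightarrow> real \<Rightarrow> ennreal" where
  "log_kernel D s t = (if s = t then \<infinity> else ennreal (ln (D / \<bar>s - t\<bar>)))"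

text \<open>The level is an \<open>ennreal\<close>, so that \<open>T = \<infinity>\<close> is the
  full kernel and finite \<open>T\<close> a bounded one; minimizers and the variational inequality
  are then treated once for both.\<close>

definition trunc_kernel :: "real \<Rightarrow> ennreal \<Rightarrow> real \<Rightarrow> real \<Rightarrow> ennreal" where
  "trunc_kernel D T s t = min T (log_kernel D s t)"

definition mutual_energy :: "(real \<Rightarrow> real \<Rightarrow> ennreal) \<Rightarrow> real measure \<Rightarrow> real measure \<Rightarrow> ennreal" where
  "mutual_energy k M N = (\<integral>\<^sup>+s. (\<integral>\<^sup>+t. k s t \<partial>N) \<partial>M)"

abbreviation energy :: "real \<Rightarrow> real measure \<Rightarrow> ennreal" where
  "energy D N \<equiv> mutual_energy (log_kernel D) N N"

abbreviation trunc_energy :: "real \<Rightarrow> ennreal \<Rightarrow> real measure \<Rightarrow> ennreal" where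
  "trunc_energy D T N \<equiv> mutual_energy (trunc_kernel D T) N N"

abbreviation potential :: "real \<Rightarrow> real measure \<Rightarrow> real \<Rightarrow> ennreal" where
  "potential D N x \<equiv> (\<integral>\<^sup>+t. log_kernel D x t \<partial>N)"

definition prob_on :: "real set \<Rightarrow> real measure set" where
  "prob_on A = {M. prob_space M \<and> sets M = sets borel \<and> emeasure M A = 1}"

lemma prob_onD:
  assumes "M \<in> prob_on A"
  shows "prob_space M" "sets M = sets borel" "space M = UNIV" "emeasure M A = 1"
    "real_distribution M" "sigma_finite_measure M"
proof -
  show *: "prob_space M" "sets M = sets borel" and "emeasure M A = 1"
    using assms by (auto simp: prob_on_def)
  show "space M = UNIV" using sets_eq_imp_space_eq[OF *(2)] by simp
  interpret prob_space M by fact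
  show "real_distribution M" by unfold_locales (use * in auto)
  show "sigma_finite_measure M" by unfold_locales
qed

lemma prob_on_AE:
  assumes "M \<in> prob_on A" "A \<in> sets borel" shows "AE x in M. x \<in> A"
proof -
  interpret prob_space M using assms prob_onD by blast
  show ?thesis using prob_onD(2,4)[OF assms(1)] assms(2)
    by (intro AE_prob_1) (simp add: measure_def)
qed

lemma log_kernel_measurable [measurable (raw)]:
  assumes [measurable]: "f \<in> borel_measurable M" "g \<in> borel_measurable M"
  shows "(\<lambda>x. log_kernel D (f x) (g x)) \<in> borel_measurable M"
  unfolding log_kernel_def by measurable

lemma trunc_kernel_measurable [measurable (raw)]:
  assumes [measurable]: "f \<in> borel_measurable M" "g \<in> borel_measurable M"
  shows "(\<lambda>x. trunc_kernel D T (f x) (g x)) \<in> borel_measurable M"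
  unfolding trunc_kernel_def by measurable

lemma trunc_kernel_sym: "trunc_kernel D T s t = trunc_kernel D T t s"
  by (auto simp: trunc_kernel_def log_kernel_def abs_minus_commute)

lemma trunc_kernel_top: "trunc_kernel D \<infinity> = log_kernel D"
  by (intro ext) (simp add: trunc_kernel_def)

text \<open>Off the diagonal this is continuity; on it the kernel exceeds every finite bound once
  the two sequences are close. This is the input for Fatou's lemma below.\<close>

lemma log_kernel_lsc:
  assumes D: "D > 0" and u: "u \<longlonglongrightarrow> s" and v: "v \<longlonglongrightarrow> t" and c: "c < log_kernel D s t"
  shows "eventually (\<lambda>n. c < log_kernel D (u n) (v n)) sequentially"
proof (cases "s = t")
  case False
  have lim: "(\<lambda>n. u n - v n) \<longlonglongrightarrow> s - t" by (intro tendsto_diff u v)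
  have "eventually (\<lambda>n. u n - v n \<noteq> 0) sequentially"
    using False by (intro tendsto_imp_eventually_ne[OF lim]) simp
  moreover have "(\<lambda>n. ennreal (ln (D / \<bar>u n - v n\<bar>))) \<longlonglongrightarrow> ennreal (ln (D / \<bar>s - t\<bar>))"
    using False D by (intro tendsto_intros tendsto_ennrealI lim) auto
  then have "eventually (\<lambda>n. c < ennreal (ln (D / \<bar>u n - v n\<bar>))) sequentially"
    using c False by (intro order_tendstoD(1)) (auto simp: log_kernel_def)
  ultimately show ?thesis
    by eventually_elim (auto simp: log_kernel_def)
next
  case True
  have lim: "(\<lambda>n. \<bar>u n - v n\<bar>) \<longlonglongrightarrow> \<bar>s - t\<bar>" by (intro tendsto_intros u v)
  obtain c' where c': "c = ennreal c'" "c' \<ge> 0"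
    using c by (cases c) (auto simp: log_kernel_def True)
  \<comment> \<open>Below this distance \<open>ln (D / |u n - v n|)\<close> exceeds
    \<open>c' + 1\<close>.\<close>
  have "eventually (\<lambda>n. \<bar>u n - v n\<bar> < D * exp (- c' - 1)) sequentially"
    using D True by (intro order_tendstoD(2)[OF lim]) auto
  then show ?thesis
  proof eventually_elim
    case (elim n)
    show ?case
    proof (cases "u n = v n")
      case False
      then have "exp (c' + 1) < D / \<bar>u n - v n\<bar>"
        using elim D by (simp add: field_simps exp_minus exp_diff exp_add)
      then have "c' + 1 < ln (D / \<bar>u n - v n\<bar>)"
        using False D by (metis exp_less_cancel_iff exp_ln exp_gt_zero less_trans)
      then show ?thesis using False c' by (auto simp: log_kernel_def ennreal_less_iff)
    qed (use c' in \<open>auto simp: log_kernel_def\<close>)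
  qed
qed

section \<open>Weak limits and energy minimizers\<close>

lemma mutual_energy_distr:
  assumes "prob_space W" and X [measurable]: "X \<in> borel_measurable W"
    and k [measurable]: "(\<lambda>(s,t). k s t) \<in> borel_measurable (borel \<Otimes>\<^sub>M borel)"
  shows "mutual_energy k (distr W borel X) (distr W borel X) =
    (\<integral>\<^sup>+x. (\<integral>\<^sup>+y. k (X x) (X y) \<partial>W) \<partial>W)"
proof -
  interpret W: prob_space W by fact
  interpret d: prob_space "distr W borel X" by (rule W.prob_space_distr) simp
  have "(\<lambda>x. \<integral>\<^sup>+s. k x s \<partial>distr W borel X) \<in> borel_measurable borel"
    by (rule d.borel_measurable_nn_integral) simp
  then show ?thesis
    unfolding mutual_energy_def
    by (subst nn_integral_distr) (auto simp: nn_integral_distr intro!: nn_integral_cong)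
qed

text \<open>Boundedness of \<open>A\<close> gives tightness. Skorohod's representation turns weak
  convergence into pointwise convergence on one space, where semicontinuity of the kernel and two
  uses of Fatou's lemma give semicontinuity of the energy. Varying levels are allowed so that
  constant \<open>T\<close> yields minimizers and growing \<open>T\<close> the passage to the full
  kernel.\<close>

lemma prob_on_weak_limit:
  assumes A: "compact A" and M: "\<And>n. M n \<in> prob_on A" and D: "D > 0" and T: "incseq T"
  obtains r M' where "strict_mono (r :: nat \<Rightarrow> nat)" "M' \<in> prob_on A"
    "trunc_energy D (SUP n. T n) M' \<le>
       liminf (\<lambda>n. trunc_energy D (T (r n)) (M (r n)))"
proof -
  have Ab [measurable]: "A \<in> sets borel" using A by (simp add: borel_compact)
  have rd: "real_distribution (M n)" for n using M prob_onD by blast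
  from A obtain B where B: "\<And>x. x \<in> A \<Longrightarrow> \<bar>x\<bar> \<le> B"
    using compact_imp_bounded bounded_iff by (metis real_norm_def)
  \<comment> \<open>\<open>tight\<close> asks for half-open intervals, which omit their left end;
    hence the extra 1.\<close>
  have meas: "1 - e < measure (M n) {- \<bar>B\<bar> - 1<..\<bar>B\<bar>}" if e: "e > 0" for e :: real and n
  proof -
    interpret real_distribution "M n" by (rule rd)
    have "measure (M n) A = 1" using M[of n] by (auto simp: prob_on_def measure_def)
    moreover have "measure (M n) A \<le> measure (M n) {- \<bar>B\<bar> - 1<..\<bar>B\<bar>}"
      using B by (intro finite_measure_mono) fastforce+
    ultimately show ?thesis using e by linarith
  qed
  have B': "- \<bar>B\<bar> - 1 < \<bar>B\<bar>" by linarith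
  have tight: "tight M" unfolding tight_def using rd meas B' by metis
  have smid: "strict_mono (\<lambda>n::nat. n)" by (simp add: strict_mono_def)
  obtain r M' where r: "strict_mono (r :: nat \<Rightarrow> nat)" and M': "real_distribution M'"
    and w: "weak_conv_m (\<lambda>n. M (r n)) M'"
    using tight_imp_convergent_subsubsequence[OF tight smid] unfolding comp_def by metis
  interpret M': real_distribution M' by fact
  obtain W Yn Y where W: "prob_space (W :: real measure)"
    and Yn [measurable]: "\<And>n. Yn n \<in> borel_measurable W"
    and dYn: "\<And>n. distr W borel (Yn n) = M (r n)"
    and Y: "Y \<in> measurable W lborel" and dY: "distr W borel Y = M'"
    and lim: "\<And>x. x \<in> space W \<Longrightarrow> (\<lambda>n. Yn n x) \<longlonglongrightarrow> Y x"
    using Skorohod[of "\<lambda>n. M (r n)" M'] rd M' w by metis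
  have Y [measurable]: "Y \<in> borel_measurable W" using Y by simp
  interpret W: prob_space W by fact
  have "AE x in W. Yn n x \<in> A" for n
  proof -
    have "AE x in distr W borel (Yn n). x \<in> A" using prob_on_AE[OF M[of "r n"] Ab] unfolding dYn .
    then show ?thesis by (subst (asm) AE_distr_iff) auto
  qed
  then have "AE x in W. \<forall>n. Yn n x \<in> A" by (simp add: AE_all_countable)
  then have "AE x in W. Y x \<in> A"
  proof (rule AE_mp, intro AE_I2 impI)
    fix x assume "x \<in> space W" "\<forall>n. Yn n x \<in> A"
    then show "Y x \<in> A"
      using closed_sequentially[OF compact_imp_closed[OF A], of "\<lambda>n. Yn n x"] lim[of x] by simp
  qed
  then have "emeasure W (Y -` A \<inter> space W) = 1"
    by (intro W.emeasure_eq_1_AE) auto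
  then have "emeasure M' A = 1" by (subst dY[symmetric], subst emeasure_distr) auto
  then have M'A: "M' \<in> prob_on A" using M' by (auto simp: prob_on_def M'.prob_space_axioms)
  have E: "trunc_energy D t (distr W borel X) =
      (\<integral>\<^sup>+x. (\<integral>\<^sup>+y. trunc_kernel D t (X x) (X y) \<partial>W) \<partial>W)"
    if "X \<in> borel_measurable W" for t X
    by (rule mutual_energy_distr[OF W that]) simp
  \<comment> \<open>A bound \<open>c\<close> below the limit lies below \<open>log_kernel\<close>
    and below some \<open>T m\<close>; since \<open>r n >= n\<close>, it lies below all later levels
    as well.\<close>
  have lsc: "trunc_kernel D (SUP n. T n) s t \<le> liminf (\<lambda>n. trunc_kernel D (T (r n)) (u n) (v n))"
    if uv: "u \<longlonglongrightarrow> s" "v \<longlonglongrightarrow> t" for s t u v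
    unfolding le_Liminf_iff
  proof (intro allI impI)
    fix c assume "c < trunc_kernel D (SUP n. T n) s t"
    then have c: "c < log_kernel D s t" "c < (SUP n. T n)" by (auto simp: trunc_kernel_def)
    from c(2) obtain m where m: "c < T m" by (auto simp: less_SUP_iff)
    have "eventually (\<lambda>n. c < log_kernel D (u n) (v n)) sequentially"
      by (intro log_kernel_lsc[OF D uv] c)
    then show "eventually (\<lambda>n. c < trunc_kernel D (T (r n)) (u n) (v n)) sequentially"
      using eventually_ge_at_top[of m]
    proof eventually_elim
      case (elim n)
      have "m \<le> r n" using elim seq_suble[OF r, of n] by simp
      then have "c < T (r n)" using m incseqD[OF T, of m "r n"] by simp
      then show ?case using elim by (simp add: trunc_kernel_def)
    qed
  qed
  have "trunc_energy D (SUP n. T n) M' =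
      (\<integral>\<^sup>+x. (\<integral>\<^sup>+y. trunc_kernel D (SUP n. T n) (Y x) (Y y) \<partial>W) \<partial>W)"
    using E[OF Y] by (simp add: dY)
  also have "\<dots> \<le> (\<integral>\<^sup>+x. (\<integral>\<^sup>+y. liminf (\<lambda>n. trunc_kernel D (T (r n)) (Yn n x) (Yn n y)) \<partial>W) \<partial>W)"
    by (intro nn_integral_mono lsc lim)
  also have "\<dots> \<le> (\<integral>\<^sup>+x. liminf (\<lambda>n. \<integral>\<^sup>+y. trunc_kernel D (T (r n)) (Yn n x) (Yn n y) \<partial>W) \<partial>W)"
    by (intro nn_integral_mono nn_integral_liminf) measurable
  also have "\<dots> \<le> liminf (\<lambda>n. \<integral>\<^sup>+x. \<integral>\<^sup>+y. trunc_kernel D (T (r n)) (Yn n x) (Yn n y) \<partial>W \<partial>W)"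
    by (intro nn_integral_liminf) measurable
  also have "\<dots> = liminf (\<lambda>n. trunc_energy D (T (r n)) (M (r n)))"
    using E[OF Yn] by (simp add: dYn)
  finally show ?thesis using that[OF r M'A] by simp
qed

lemma prob_on_nonempty:
  assumes "x \<in> A" "A \<in> sets borel" shows "return borel x \<in> prob_on A"
  using assms by (auto simp: prob_on_def prob_space_return)

text \<open>Direct method: a minimizing sequence has a weak limit in the class, and the energy does
  not increase in the limit. Point masses make the class nonempty.\<close>

lemma exists_minimizer:
  assumes A: "compact A" "A \<noteq> {}" and D: "D > 0"
  obtains M where "M \<in> prob_on A"
    "\<And>N. N \<in> prob_on A \<Longrightarrow>
       trunc_energy D T M \<le> trunc_energy D T N"
proof -
  let ?I = "\<lambda>M. trunc_energy D T M"
  have "?I ` prob_on A \<noteq> {}" using A prob_on_nonempty borel_compact by blast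
  from Inf_as_limit[OF this] obtain v where v: "\<And>n. v n \<in> ?I ` prob_on A"
    and vlim: "v \<longlonglongrightarrow> Inf (?I ` prob_on A)" by blast
  have "\<exists>M. M \<in> prob_on A \<and> v n = ?I M" for n using v[of n] by blast
  then obtain M where M: "\<And>n. M n \<in> prob_on A" and vM: "\<And>n. v n = ?I (M n)" by metis
  obtain r M' where r: "strict_mono (r :: nat \<Rightarrow> nat)" and M': "M' \<in> prob_on A" and
    le: "trunc_energy D (SUP n::nat. T) M' \<le> liminf (\<lambda>n. ?I (M (r n)))"
    by (rule prob_on_weak_limit[of A M D "\<lambda>_. T"]) (use A M D in \<open>auto simp: incseq_def\<close>)
  have "?I M' \<le> liminf (\<lambda>n. ?I (M (r n)))" using le by simp
  also have "\<dots> = Inf (?I ` prob_on A)"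
    using LIMSEQ_subseq_LIMSEQ[OF vlim r] by (intro lim_imp_Liminf) (auto simp: comp_def vM)
  finally have "?I M' \<le> Inf (?I ` prob_on A)" .
  then have "?I M' \<le> ?I N" if "N \<in> prob_on A" for N
    by (rule order_trans) (rule INF_lower[OF that])
  then show ?thesis by (rule that[OF M'])
qed

text \<open>The levels tend to infinity while the energies stay bounded; this is how
  \<open>polar_barrier\<close> reaches a measure of finite full energy.\<close>

lemma trunc_kernel_energy_limit:
  assumes A: "compact A" and D: "D > 0"
    and M: "\<And>n::nat. M n \<in> prob_on A"
    and C: "\<And>n. trunc_energy D (of_nat n) (M n) \<le> C"
  obtains M' where "M' \<in> prob_on A" "energy D M' \<le> C"
proof -
  obtain r M' where r: "strict_mono (r :: nat \<Rightarrow> nat)" and M': "M' \<in> prob_on A" and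
    le: "trunc_energy D (SUP n. of_nat n) M' \<le>
       liminf (\<lambda>n. trunc_energy D (of_nat (r n)) (M (r n)))"
    by (rule prob_on_weak_limit[of A M D "\<lambda>n. of_nat n"]) (use A M D in \<open>auto simp: incseq_def\<close>)
  have SUP: "(SUP n. of_nat n :: ennreal) = \<infinity>" by (simp add: ennreal_SUP_of_nat_eq_top)
  have "energy D M' \<le>
     liminf (\<lambda>n. trunc_energy D (of_nat (r n)) (M (r n)))"
    using le unfolding SUP trunc_kernel_top .
  also have "\<dots> \<le> C" 
    using C by (intro Liminf_le) auto
  finally show ?thesis using that M' by blast
qed

text \<open>The convex combination \<open>p N + (1 - p) M\<close>, realized by tossing a biased coin
  and drawing from the chosen measure, so that its integrals come from
  \<open>nn_integral_bind\<close>.\<close>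

definition mixture :: "real \<Rightarrow> real measure \<Rightarrow> real measure \<Rightarrow> real measure" where
  "mixture p M N = measure_pmf (bernoulli_pmf p) \<bind> (\<lambda>b. if b then N else M)"

lemma mixture_kernel:
  assumes "M \<in> prob_on A" "N \<in> prob_on A"
  shows "(\<lambda>b. if b then N else M) \<in> measure_pmf (bernoulli_pmf p) \<rightarrow>\<^sub>M subprob_algebra borel"
proof -
  interpret M: prob_space M using assms prob_onD by blast
  interpret N: prob_space N using assms prob_onD by blast
  show ?thesis
    using prob_onD(2)[OF assms(1)] prob_onD(2)[OF assms(2)]
    by (auto simp: measurable_def space_subprob_algebra M.subprob_space_axioms N.subprob_space_axioms)
qed

lemma nn_integral_mixture:
  assumes M: "M \<in> prob_on A" "N \<in> prob_on A" and p: "0 \<le> p" "p \<le> 1" and f: "f \<in> borel_measurable borel"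
  shows "(\<integral>\<^sup>+x. f x \<partial>mixture p M N) = ennreal p * (\<integral>\<^sup>+x. f x \<partial>N) + ennreal (1 - p) * (\<integral>\<^sup>+x. f x \<partial>M)"
  unfolding mixture_def using p
  by (subst nn_integral_bind[OF f mixture_kernel[OF M]]) (simp add: mult.commute)

lemma mixture_prob_on:
  assumes M: "M \<in> prob_on A" "N \<in> prob_on A" and A: "A \<in> sets borel" and p: "0 \<le> p" "p \<le> 1"
  shows "mixture p M N \<in> prob_on A"
proof -
  have s: "sets (mixture p M N) = sets borel"
    unfolding mixture_def by (rule sets_bind) (use prob_onD(2) M in \<open>auto\<close>)
  then have sp: "space (mixture p M N) = UNIV" by (metis sets_eq_imp_space_eq space_borel)
  have E: "emeasure (mixture p M N) B = ennreal p * emeasure N B + ennreal (1 - p) * emeasure M B"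
    if "B \<in> sets borel" for B
    using nn_integral_mixture[OF M p, of "indicator B"] that s prob_onD(2) M by simp
  have 1: "ennreal p + ennreal (1 - p) = 1" using p by (simp flip: ennreal_plus)
  have "emeasure M UNIV = 1" "emeasure N UNIV = 1"
    using prob_onD(1,3) M prob_space.emeasure_space_1 by metis+
  then have "emeasure (mixture p M N) UNIV = 1" using E[of UNIV] 1 by simp
  then show ?thesis
    using s sp E[OF A] 1 prob_onD(4)[OF M(1)] prob_onD(4)[OF M(2)]
    by (auto simp: prob_on_def intro!: prob_spaceI)
qed

lemma mutual_energy_sym:
  assumes M: "M \<in> prob_on A" "N \<in> prob_on A"
  shows "mutual_energy (trunc_kernel D T) M N = mutual_energy (trunc_kernel D T) N M"
proof -
  interpret M: sigma_finite_measure M using prob_onD M by blast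
  interpret N: sigma_finite_measure N using prob_onD M by blast
  interpret pair_sigma_finite M N ..
  have [measurable_cong]: "sets M = sets borel" "sets N = sets borel" using prob_onD M by auto
  have "mutual_energy (trunc_kernel D T) M N = (\<integral>\<^sup>+t. (\<integral>\<^sup>+s. trunc_kernel D T s t \<partial>M) \<partial>N)"
    unfolding mutual_energy_def by (rule Fubini'[symmetric]) measurable
  then show ?thesis by (subst (asm) trunc_kernel_sym) (simp add: mutual_energy_def)
qed

lemma mutual_energy_mixture:
  fixes D :: real and T :: ennreal
  assumes M: "M \<in> prob_on A" "N \<in> prob_on A" and A: "A \<in> sets borel" and p: "0 \<le> p" "p \<le> 1"
  defines "I \<equiv> mutual_energy (trunc_kernel D T)"
  shows "I (mixture p M N) (mixture p M N) =
    ennreal (p * p) * I N N + 2 * ennreal (p * (1 - p)) * I N M + ennreal ((1 - p) * (1 - p)) * I M M"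
proof -
  let ?L = "mixture p M N"
  note L = mixture_prob_on[OF M A p]
  have sets: "sets M = sets borel" "sets N = sets borel" "sets ?L = sets borel"
    using prob_onD(2) M L by auto
  note [measurable_cong] = sets
  have sf: "sigma_finite_measure M" "sigma_finite_measure N" "sigma_finite_measure ?L"
    using prob_onD(6) M L by auto
  have meas: "(\<lambda>s. \<integral>\<^sup>+t. trunc_kernel D T s t \<partial>K) \<in> borel_measurable borel"
    if "K = M \<or> K = N \<or> K = ?L" for K
  proof -
    interpret sigma_finite_measure K using that sf by auto
    have [measurable_cong]: "sets K = sets borel" using that sets by auto
    show ?thesis by measurable
  qed
  have inner: "I K ?L = ennreal p * I K N + ennreal (1 - p) * I K M" if "K = M \<or> K = N" for K
  proof -
    have [measurable_cong]: "sets K = sets borel" using that sets by auto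
    have "I K ?L = (\<integral>\<^sup>+s. ennreal p * (\<integral>\<^sup>+t. trunc_kernel D T s t \<partial>N) + ennreal (1-p) * (\<integral>\<^sup>+t. trunc_kernel D T s t \<partial>M) \<partial>K)"
      unfolding I_def mutual_energy_def
      by (intro nn_integral_cong nn_integral_mixture[OF M p]) measurable
    also have "\<dots> = ennreal p * I K N + ennreal (1-p) * I K M"
      unfolding I_def mutual_energy_def using meas[of M] meas[of N] that sets
      by (subst nn_integral_add) (auto intro!: nn_integral_cmult simp: nn_integral_cmult cong: measurable_cong_sets)
    finally show ?thesis .
  qed
  have "I ?L ?L = ennreal p * I N ?L + ennreal (1 - p) * I M ?L"
    unfolding I_def mutual_energy_def by (intro nn_integral_mixture[OF M p] meas) simp
  also have "\<dots> = ennreal p * (ennreal p * I N N + ennreal (1 - p) * I N M)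
     + ennreal (1 - p) * (ennreal p * I N M + ennreal (1 - p) * I M M)"
    using inner[of M] inner[of N] mutual_energy_sym[OF M, of D T] by (simp add: I_def)
  also have "\<dots> = ennreal (p * p) * I N N + 2 * ennreal (p * (1 - p)) * I N M + ennreal ((1 - p) * (1 - p)) * I M M"
    using p by (simp add: ennreal_mult distrib_left mult_ac flip: mult_2)
  finally show ?thesis .
qed

text \<open>Along the segment from \<open>M\<close> to \<open>N\<close> the energy is quadratic in
  \<open>p\<close> with slope \<open>2 (I N M - I M M)\<close> at 0, and a minimum at 0 forbids a
  negative slope. Finiteness of \<open>I N N\<close> controls the second-order term.\<close>

lemma minimizer_variation:
  fixes D :: real and T :: ennreal
  assumes M: "M \<in> prob_on A" "N \<in> prob_on A" and A: "A \<in> sets borel"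
  defines "I \<equiv> mutual_energy (trunc_kernel D T)"
  assumes min: "\<And>N. N \<in> prob_on A \<Longrightarrow> I M M \<le> I N N" and fin: "I N N < \<infinity>"
  shows "I M M \<le> I N M"
proof (rule ccontr)
  assume "\<not> I M M \<le> I N M"
  then have less: "I N M < I M M" by simp
  moreover have "I M M < \<infinity>" using min[OF M(2)] fin by (rule le_less_trans)
  ultimately obtain V X where V: "I M M = ennreal V" "V \<ge> 0" and X: "I N M = ennreal X" "X \<ge> 0"
    by (cases "I M M"; cases "I N M") auto
  obtain B where B: "I N N = ennreal B" "B \<ge> 0" using fin by (cases "I N N") auto
  have XV: "X < V" using less V X by (simp add: ennreal_less_iff)
  \<comment> \<open>Small enough that \<open>p < 1\<close> and \<open>p * (B + V) <= V - X\<close>,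
    so the first-order gain \<open>2 (V - X)\<close> beats the quadratic term.\<close>
  define p where "p = (V - X) / (B + V + 1)"
  have p: "0 < p" "p < 1" using XV V X B by (auto simp: p_def field_simps)
  have "ennreal V \<le> ennreal (p * p) * I N N + 2 * ennreal (p * (1 - p)) * I N M + ennreal ((1 - p) * (1 - p)) * I M M"
    using min[OF mixture_prob_on[OF M A, of p]] p mutual_energy_mixture[OF M A, of p D T] V by (simp add: I_def)
  also have "\<dots> = ennreal (p * p * B + 2 * (p * (1 - p)) * X + (1 - p) * (1 - p) * V)"
    using p V X B by (simp add: ennreal_mult ennreal_plus flip: ennreal_numeral)
  finally have "V \<le> p * p * B + 2 * (p * (1 - p)) * X + (1 - p) * (1 - p) * V"
    using p V X B by (subst (asm) ennreal_le_iff) auto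
  then have "p * (2 * V - 2 * X) \<le> p * (p * (B + V - 2 * X))" by (simp add: algebra_simps)
  then have "2 * V - 2 * X \<le> p * (B + V - 2 * X)" using p by simp
  also have "\<dots> \<le> p * (B + V)" using p X by (intro mult_left_mono) auto
  also have "\<dots> \<le> V - X" using XV V X B by (simp add: p_def field_simps)
  finally show False using XV by simp
qed

section \<open>Equilibrium measures\<close>

lemma mutual_energy_cong:
  assumes "AE x in M. x \<in> K" "\<And>x y. x \<in> K \<Longrightarrow> y \<in> K \<Longrightarrow> f x y = g x y"
  shows "(\<integral>\<^sup>+x. (\<integral>\<^sup>+y. f x y \<partial>M) \<partial>M) = (\<integral>\<^sup>+x. (\<integral>\<^sup>+y. g x y \<partial>M) \<partial>M)"
proof (rule nn_integral_cong_AE)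
  show "AE x in M. (\<integral>\<^sup>+y. f x y \<partial>M) = (\<integral>\<^sup>+y. g x y \<partial>M)"
    using assms(1)
  proof eventually_elim
    case (elim x)
    then show ?case using assms by (intro nn_integral_cong_AE) (auto elim: eventually_mono)
  qed
qed

text \<open>On \<open>A\<close> the identity
  \<open>log_kernel D s t + ln^+ |s - t| = ln^- |s - t| + ln D\<close> has only nonnegative terms
  and can be integrated in \<open>ennreal\<close>. The \<open>ln^+\<close> energy is at most
  \<open>ln D\<close>, hence finite, and may be moved to the other side.\<close>

lemma split_log_energy:
  assumes N: "N \<in> prob_on A" and A: "A \<in> sets borel" and D: "D \<ge> 1"
    and AD: "\<And>x. x \<in> A \<Longrightarrow> \<bar>x\<bar> \<le> D / 2"
  shows "enn2ereal (mutual_energy (\<lambda>s t. if s = t then \<infinity> else ennreal (- ln \<bar>s - t\<bar>)) N N) -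
     enn2ereal (mutual_energy (\<lambda>s t. if s = t then 0 else ennreal (ln \<bar>s - t\<bar>)) N N) =
     enn2ereal (energy D N) - ereal (ln D)"
proof -
  interpret N: prob_space N using N prob_onD by blast
  have [measurable_cong]: "sets N = sets borel" using N prob_onD by blast
  have AE: "AE x in N. x \<in> A" by (rule prob_on_AE[OF N A])
  have add: "mutual_energy (\<lambda>s t. f s t + g s t) N N = mutual_energy f N N + mutual_energy g N N"
    if [measurable]: "(\<lambda>(s,t). f s t) \<in> borel_measurable (borel \<Otimes>\<^sub>M borel)"
      "(\<lambda>(s,t). g s t) \<in> borel_measurable (borel \<Otimes>\<^sub>M borel)" for f g :: "real \<Rightarrow> real \<Rightarrow> ennreal"
    unfolding mutual_energy_def by (simp add: nn_integral_add)
  let ?p = "\<lambda>s t::real. if s = t then \<infinity> else ennreal (- ln \<bar>s - t\<bar>)"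
  let ?m = "\<lambda>s t::real. if s = t then 0 else ennreal (ln \<bar>s - t\<bar>)"
  have eq: "log_kernel D s t + ?m s t = ?p s t + ennreal (ln D)" if "s \<in> A" "t \<in> A" for s t
  proof (cases "s = t")
    case False
    have le: "\<bar>s - t\<bar> \<le> D" using AD[OF that(1)] AD[OF that(2)] by linarith
    then have lnle: "ln \<bar>s - t\<bar> \<le> ln D" using False by simp
    have ln: "ln (D / \<bar>s - t\<bar>) = ln D - ln \<bar>s - t\<bar>" using False D by (simp add: ln_div)
    show ?thesis
    proof (cases "ln \<bar>s - t\<bar> \<ge> 0")
      case True
      then show ?thesis using False lnle ln D
        by (simp add: log_kernel_def ennreal_neg flip: ennreal_plus)
    next
      case F: False
      then show ?thesis using False lnle ln D
        by (simp add: log_kernel_def ennreal_neg flip: ennreal_plus)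
    qed
  qed (simp add: log_kernel_def)
  have "energy D N + mutual_energy ?m N N = mutual_energy (\<lambda>s t. log_kernel D s t + ?m s t) N N"
    by (rule add[symmetric]) measurable
  also have "\<dots> = mutual_energy (\<lambda>s t. ?p s t + ennreal (ln D)) N N"
    unfolding mutual_energy_def by (rule mutual_energy_cong[OF AE eq])
  also have "\<dots> = mutual_energy ?p N N + mutual_energy (\<lambda>s t. ennreal (ln D)) N N"
    by (rule add) measurable
  also have "mutual_energy (\<lambda>s t. ennreal (ln D)) N N = ennreal (ln D)"
    by (simp add: mutual_energy_def N.emeasure_space_1)
  finally have sum: "energy D N + mutual_energy ?m N N = mutual_energy ?p N N + ennreal (ln D)" .
  have "mutual_energy ?m N N = mutual_energy (\<lambda>s t. min (?m s t) (ennreal (ln D))) N N"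
    unfolding mutual_energy_def
  proof (rule mutual_energy_cong[OF AE])
    fix s t assume "s \<in> A" "t \<in> A"
    then have "\<bar>s - t\<bar> \<le> D" using AD[of s] AD[of t] by linarith
    then show "?m s t = min (?m s t) (ennreal (ln D))"
      by (auto simp: min_def intro!: ennreal_leI)
  qed
  also have "\<dots> \<le> mutual_energy (\<lambda>s t. ennreal (ln D)) N N"
    unfolding mutual_energy_def by (intro nn_integral_mono) auto
  also have "\<dots> = ennreal (ln D)"
    by (simp add: mutual_energy_def N.emeasure_space_1)
  finally have "mutual_energy ?m N N \<le> ennreal (ln D)" .
  then have fin: "mutual_energy ?m N N < \<infinity>" by (rule le_less_trans) simp
  obtain m where m: "mutual_energy ?m N N = ennreal m" "m \<ge> 0" using fin by (cases "mutual_energy ?m N N") auto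
  have lnD: "ln D \<ge> 0" using D by simp
  show ?thesis
  proof (cases "mutual_energy ?p N N")
    case (real q)
    then have "energy D N + ennreal m = ennreal (q + ln D)"
      using sum m lnD by (simp add: ennreal_plus)
    then obtain i where i: "energy D N = ennreal i" "i \<ge> 0"
      by (cases "energy D N") auto
    have "ennreal (i + m) = ennreal (q + ln D)"
      using sum m lnD i real by (simp add: ennreal_plus)
    then have "i + m = q + ln D" using i m lnD real by (subst (asm) ennreal_inj) auto
    then show ?thesis unfolding real i m using i m real by (simp add: enn2ereal_ennreal)
  next
    case top
    then have "energy D N = top" using sum m by (cases "energy D N") (auto simp flip: ennreal_plus)
    then show ?thesis unfolding top m using m by (simp add: enn2ereal_ennreal infinity_ennreal_def)
  qed
qed

text \<open>Real points have the distance of their real parts, so the push-forward along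
  \<open>Re\<close> carries both double integrals to the line.\<close>

lemma log_energy_real:
  assumes \<mu>: "prob_space \<mu>" "sets \<mu> = sets borel" and K: "compact K" "K \<subseteq> \<real>" "emeasure \<mu> K = 1"
    and D: "D \<ge> 1" and KD: "\<And>z. z \<in> K \<Longrightarrow> \<bar>Re z\<bar> \<le> D / 2"
  shows "distr \<mu> borel Re \<in> prob_on (Re ` K)"
    "log_energy \<mu> = enn2ereal (energy D (distr \<mu> borel Re)) - ereal (ln D)"
proof -
  interpret prob_space \<mu> by fact
  note [measurable_cong] = \<mu>(2)
  have "compact (Re ` K)" using K by (intro compact_continuous_image continuous_intros)
  then have [measurable]: "Re ` K \<in> sets borel" "K \<in> sets borel" using K by (auto simp: borel_compact)
  have AE: "AE z in \<mu>. z \<in> K"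
    using K(3) \<mu>(2) by (intro AE_prob_1) (simp add: measure_def)
  interpret d: prob_space "distr \<mu> borel Re" by (rule prob_space_distr) measurable
  have "emeasure (distr \<mu> borel Re) (Re ` K) = emeasure \<mu> (Re -` (Re ` K) \<inter> space \<mu>)"
    by (rule emeasure_distr) measurable
  also have "\<dots> = 1"
    using AE by (intro emeasure_eq_1_AE) (auto elim: eventually_mono)
  finally show N: "distr \<mu> borel Re \<in> prob_on (Re ` K)"
    by (simp add: prob_on_def d.prob_space_axioms)
  have dist: "dist z w = \<bar>Re z - Re w\<bar>" "z = w \<longleftrightarrow> Re z = Re w" if "z \<in> K" "w \<in> K" for z w
    using that K(2) by (auto simp: dist_norm cmod_def complex_eq_iff complex_is_Real_iff subset_eq)
  have "log_energy \<mu> = enn2ereal (mutual_energy (\<lambda>s t. if s = t then \<infinity> else ennreal (- ln \<bar>s - t\<bar>)) (distr \<mu> borel Re) (distr \<mu> borel Re)) -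
     enn2ereal (mutual_energy (\<lambda>s t. if s = t then 0 else ennreal (ln \<bar>s - t\<bar>)) (distr \<mu> borel Re) (distr \<mu> borel Re))"
    unfolding log_energy_def
    by (subst (1 2) mutual_energy_distr)
       (auto intro!: prob_space_axioms arg_cong2[where f="(-)"] arg_cong[where f=enn2ereal] mutual_energy_cong[OF AE] simp: dist)
  then show "log_energy \<mu> = enn2ereal (energy D (distr \<mu> borel Re)) - ereal (ln D)"
    using split_log_energy[OF N _ D] KD by auto
qed

text \<open>Converse of \<open>prob_measure_on_realI\<close>. The compact carrier is passed along
  because \<open>prob_measure_on\<close> asks for one inside \<open>S\<close>, which may fail to be
  closed.\<close>

lemma prob_measure_on_realD:
  assumes "prob_measure_on S \<mu>" "S \<subseteq> complex_of_real ` A" and D: "D \<ge> 1"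
    and AD: "\<And>x. x \<in> A \<Longrightarrow> \<bar>x\<bar> \<le> D / 2"
  obtains K N where "compact K" "complex_of_real ` K \<subseteq> S" "N \<in> prob_on K"
    "log_energy \<mu> = enn2ereal (energy D N) - ereal (ln D)"
proof -
  from assms obtain K where K: "compact K" "K \<subseteq> S" "emeasure \<mu> K = 1"
    and \<mu>: "sets \<mu> = sets borel" "emeasure \<mu> (space \<mu>) = 1" by (auto simp: prob_measure_on_def)
  have p: "prob_space \<mu>" using \<mu> by (intro prob_spaceI) auto
  have KR: "K \<subseteq> \<real>" using K assms(2) Reals_of_real by blast
  have KD: "\<bar>Re z\<bar> \<le> D / 2" if "z \<in> K" for z using that K assms(2) AD by fastforce
  have "compact (Re ` K)" using K by (intro compact_continuous_image continuous_intros)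
  moreover have "complex_of_real ` Re ` K \<subseteq> S" using K KR by (auto simp: image_iff) (metis of_real_Re subset_eq)
  ultimately show ?thesis
    using that log_energy_real[OF p \<mu>(1) K(1) KR K(3) D KD] by blast
qed

lemma prob_measure_on_realI:
  assumes N: "N \<in> prob_on K" and K: "compact K" "complex_of_real ` K \<subseteq> S" and D: "D \<ge> 1"
    and AD: "\<And>x. x \<in> K \<Longrightarrow> \<bar>x\<bar> \<le> D / 2"
  obtains \<mu> where "prob_measure_on S \<mu>"
    "log_energy \<mu> = enn2ereal (energy D N) - ereal (ln D)"
proof -
  interpret prob_space N using N prob_onD by blast
  have s: "sets N = sets borel" "space N = UNIV" using N prob_onD by auto
  note [measurable_cong] = s(1)
  define \<mu> where "\<mu> = distr N borel complex_of_real"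
  interpret d: prob_space \<mu> unfolding \<mu>_def by (rule prob_space_distr) measurable
  have CK: "compact (complex_of_real ` K)" using K by (intro compact_continuous_image continuous_intros)
  then have [measurable]: "complex_of_real ` K \<in> sets borel" by (simp add: borel_compact)
  have "emeasure \<mu> (complex_of_real ` K) = emeasure N (complex_of_real -` (complex_of_real ` K) \<inter> space N)"
    unfolding \<mu>_def by (rule emeasure_distr) measurable
  also have "complex_of_real -` (complex_of_real ` K) \<inter> space N = K" using s by auto
  finally have e1: "emeasure \<mu> (complex_of_real ` K) = 1" using prob_onD(4)[OF N] by simp
  have "distr \<mu> borel Re = distr N borel (Re \<circ> complex_of_real)" unfolding \<mu>_def by (rule distr_distr) measurable
  also have "\<dots> = N" using distr_id2[of borel N] s by (simp add: comp_def)
  finally have dN: "distr \<mu> borel Re = N" .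
  have KR: "complex_of_real ` K \<subseteq> \<real>" by auto
  have sm: "sets \<mu> = sets borel" by (simp add: \<mu>_def)
  have "prob_measure_on S \<mu>"
    unfolding prob_measure_on_def using e1 CK K(2) d.emeasure_space_1 sm by auto
  moreover have "\<bar>Re z\<bar> \<le> D / 2" if "z \<in> complex_of_real ` K" for z using that AD by auto
  ultimately show ?thesis using that log_energy_real(2)[OF d.prob_space_axioms sm CK KR e1 D] dN by metis
qed

section \<open>Polar sets and measures of finite energy\<close>

lemma capacity_zero_energy:
  assumes cap: "capacity S = 0" and N: "N \<in> prob_on K" and K: "compact K" "complex_of_real ` K \<subseteq> S"
    and D: "D \<ge> 1" "\<And>x. x \<in> K \<Longrightarrow> \<bar>x\<bar> \<le> D / 2"
  shows "energy D N = \<infinity>"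
proof (rule ccontr)
  assume inf: "energy D N \<noteq> \<infinity>"
  obtain \<mu> where \<mu>: "prob_measure_on S \<mu>"
    "log_energy \<mu> = enn2ereal (energy D N) - ereal (ln D)"
    using prob_measure_on_realI[OF N K D] by metis
  have "log_energy \<mu> < \<infinity>" using inf \<mu>(2)
    by (cases "energy D N") (auto simp: enn2ereal_ennreal)
  moreover have "robin_constant S \<le> log_energy \<mu>"
    unfolding robin_constant_def using \<mu>(1) by (intro INF_lower) auto
  ultimately have "robin_constant S < \<infinity>" by (rule order.strict_trans1[rotated])
  then show False using cap by (auto simp: capacity_def split: if_splits)
qed

text \<open>Conditioning on \<open>K\<close> divides each of the two integrations by the mass of
  \<open>K\<close>, so the energy grows at most by the inverse square of that mass.\<close>

lemma uniform_measure_energy: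
  assumes N: "N \<in> prob_on A" and K: "K \<in> sets borel" "emeasure N K > 0"
    and fin: "energy D N < \<infinity>"
  shows "uniform_measure N K \<in> prob_on K"
    "energy D (uniform_measure N K) < \<infinity>"
proof -
  interpret N: prob_space N using N prob_onD by blast
  have s: "sets N = sets borel" using N prob_onD by auto
  note [measurable_cong] = s(1)
  note [measurable] = K(1)
  have fK: "emeasure N K \<noteq> \<infinity>" "emeasure N K \<noteq> 0" "emeasure N K < top" using K N.emeasure_finite[of K] by (auto simp: less_top[symmetric])
  have "prob_space (uniform_measure N K)"
    using fK by (intro prob_space_uniform_measure) auto
  moreover have "emeasure (uniform_measure N K) K = 1"
    using fK K s by (subst emeasure_uniform_measure) (auto simp: ennreal_divide_self)
  ultimately show "uniform_measure N K \<in> prob_on K" using s by (simp add: prob_on_def)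
  have le: "(\<integral>\<^sup>+x. f x \<partial>uniform_measure N K) \<le> (\<integral>\<^sup>+x. f x \<partial>N) / emeasure N K"
    if "f \<in> borel_measurable borel" for f
    using that K s by (subst nn_integral_uniform_measure)
      (auto intro!: divide_right_mono_ennreal nn_integral_mono simp: indicator_def cong: measurable_cong_sets)
  interpret U: prob_space "uniform_measure N K" by fact
  have [measurable_cong]: "sets (uniform_measure N K) = sets borel" using s by simp
  have "energy D (uniform_measure N K) \<le>
      (\<integral>\<^sup>+x. (\<integral>\<^sup>+y. log_kernel D x y \<partial>N) / emeasure N K \<partial>uniform_measure N K)"
    unfolding mutual_energy_def by (intro nn_integral_mono le) measurable
  also have "\<dots> \<le> (\<integral>\<^sup>+x. (\<integral>\<^sup>+y. log_kernel D x y \<partial>N) / emeasure N K \<partial>N) / emeasure N K"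
    by (intro le) measurable
  also have "\<dots> = energy D N / emeasure N K / emeasure N K"
    unfolding mutual_energy_def by (subst nn_integral_divide) measurable
  also have "\<dots> < \<infinity>"
    using fin K(2) fK(1) by (cases "energy D N"; cases "emeasure N K")
      (auto simp: divide_ennreal)
  finally show "energy D (uniform_measure N K) < \<infinity>" .
qed

text \<open>Otherwise inner regularity yields a compact \<open>K\<close> of positive mass inside the
  set, and \<open>N\<close> conditioned on \<open>K\<close> is a finite energy measure admissible
  for the capacity of \<open>S\<close>.\<close>

lemma finite_energy_null:
  assumes N: "N \<in> prob_on A" and A: "A \<in> sets borel" and S: "S \<in> sets borel" "capacity S = 0"
    and fin: "energy D N < \<infinity>"
    and D: "D \<ge> 1" "\<And>x. x \<in> A \<Longrightarrow> \<bar>x\<bar> \<le> D / 2"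
  shows "emeasure N (A \<inter> complex_of_real -` S) = 0"
proof (rule ccontr)
  interpret N: prob_space N using N prob_onD by blast
  have s: "sets N = sets borel" using N prob_onD by auto
  have meas: "A \<inter> complex_of_real -` S \<in> sets borel"
    using A measurable_sets[of complex_of_real borel borel S] S by auto
  assume "emeasure N (A \<inter> complex_of_real -` S) \<noteq> 0"
  then have "0 < (SUP K \<in> {K. K \<subseteq> A \<inter> complex_of_real -` S \<and> compact K}. emeasure N K)"
    using inner_regular[OF s, of "A \<inter> complex_of_real -` S"] meas by (simp add: zero_less_iff_neq_zero)
  then obtain K where K: "K \<subseteq> A \<inter> complex_of_real -` S" "compact K" "emeasure N K > 0"
    by (auto simp: less_SUP_iff)
  have "K \<in> sets borel" using K by (simp add: borel_compact)
  from uniform_measure_energy[OF N this K(3) fin]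
  have "uniform_measure N K \<in> prob_on K"
    "energy D (uniform_measure N K) < \<infinity>" .
  moreover have "energy D (uniform_measure N K) = \<infinity>"
    using K D by (intro capacity_zero_energy[OF S(2) calculation(1)]) auto
  ultimately show False by simp
qed

text \<open>Were every potential below \<open>T\<close> somewhere on \<open>F\<close>, testing the
  level \<open>n\<close> minimizer against the point mass there would bound its truncated energy by
  \<open>T\<close> for all \<open>n\<close>, and a weak limit would have finite energy. The measure
  depends on \<open>T\<close>; this suffices because the barrier is divided by \<open>T\<close>
  later.\<close>

lemma polar_barrier:
  assumes F: "compact F" "F \<noteq> {}" and D: "D > 0"
    and polar: "\<And>N. N \<in> prob_on F \<Longrightarrow> energy D N = \<infinity>"
  shows "\<exists>\<sigma>\<in>prob_on F. \<forall>x\<in>F. ennreal T \<le> potential D \<sigma> x"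
proof (rule ccontr)
  assume "\<not> ?thesis"
  then have neg: "\<exists>x\<in>F. (potential D \<sigma> x) < ennreal T" if "\<sigma> \<in> prob_on F" for \<sigma>
    using that by (meson not_less)
  have Fb: "F \<in> sets borel" using F by (simp add: borel_compact)
  have "\<exists>M\<in>prob_on F. trunc_energy D (of_nat n) M \<le> ennreal T" for n :: nat
  proof -
    obtain M where M: "M \<in> prob_on F" and min: "\<And>N. N \<in> prob_on F \<Longrightarrow>
       trunc_energy D (of_nat n) M \<le> trunc_energy D (of_nat n) N"
      using exists_minimizer[OF F D, of "of_nat n"] by metis
    obtain x where x: "x \<in> F" "(potential D M x) < ennreal T" using neg[OF M] by blast
    have r: "return borel x \<in> prob_on F" using x Fb by (intro prob_on_nonempty)
    interpret M: prob_space M using M prob_onD by blast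
    have [measurable_cong]: "sets M = sets borel" using M prob_onD by blast
    have m1: "mutual_energy (trunc_kernel D (of_nat n)) (return borel x) N = (\<integral>\<^sup>+t. trunc_kernel D (of_nat n) x t \<partial>N)"
      if "N \<in> prob_on F" for N
    proof -
      interpret N: prob_space N using that prob_onD by blast
      have [measurable_cong]: "sets N = sets borel" using that prob_onD by blast
      show ?thesis
        unfolding mutual_energy_def by (intro nn_integral_return) measurable
    qed
    have "trunc_energy D (of_nat n) (return borel x) = trunc_kernel D (of_nat n) x x"
      by (subst m1[OF r]) (intro nn_integral_return; measurable)
    \<comment> \<open>On the diagonal the truncated kernel equals \<open>n\<close>; for the full
      kernel a point mass has infinite energy and is no admissible competitor.\<close>
    also have "\<dots> < \<infinity>" by (simp add: trunc_kernel_def log_kernel_def of_nat_less_top)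
    finally have "trunc_energy D (of_nat n) M \<le> mutual_energy (trunc_kernel D (of_nat n)) (return borel x) M"
      by (intro minimizer_variation[OF M r Fb min]) auto
    also have "\<dots> = (\<integral>\<^sup>+t. trunc_kernel D (of_nat n) x t \<partial>M)" by (rule m1[OF M])
    also have "\<dots> \<le> potential D M x" by (intro nn_integral_mono) (simp add: trunc_kernel_def)
    finally show ?thesis using x M by (intro bexI[of _ M]) auto
  qed
  then obtain M where "\<And>n. M n \<in> prob_on F" "\<And>n::nat. trunc_energy D (of_nat n) (M n) \<le> ennreal T"
    by metis
  then obtain M' where "M' \<in> prob_on F" "energy D M' \<le> ennreal T"
    using trunc_kernel_energy_limit[OF F(1) D] by metis
  then show False using polar[of M'] by (simp add: top_unique)
qed

section \<open>Potentials on the line and the equilibrium measure\<close>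

lemma log_kernel_antimono:
  assumes "D > 0" "\<bar>s - t\<bar> \<le> \<bar>s' - t'\<bar>" shows "log_kernel D s' t' \<le> log_kernel D s t"
  using assms by (auto simp: log_kernel_def intro!: ennreal_leI divide_left_mono)

text \<open>As \<open>t\<close> is not strictly between \<open>a\<close> and \<open>b\<close>, the
  distance to \<open>t\<close> is affine on the segment and concavity of \<open>ln\<close> applies.
  The truncation at 0 does no harm, the positive part being monotone and convex.\<close>

lemma log_kernel_convex:
  assumes D: "D > 0" and l: "0 < l" "l < 1" and t: "t \<le> a \<or> b \<le> t" and ab: "a < b"
  shows "log_kernel D ((1 - l) * a + l * b) t \<le> ennreal (1 - l) * log_kernel D a t + ennreal l * log_kernel D b t"
proof (cases "t = a \<or> t = b")
  case True
  then show ?thesis using l by (auto simp: log_kernel_def ennreal_mult_top)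
next
  case False
  have eq: "\<bar>(1 - l) * a + l * b - t\<bar> = (1 - l) * \<bar>a - t\<bar> + l * \<bar>b - t\<bar>"
  proof (cases "t \<le> a")
    case True
    have "(1 - l) * a + l * b - t = (1 - l) * (a - t) + l * (b - t)" by (simp add: algebra_simps)
    moreover have "(1 - l) * (a - t) \<ge> 0" "l * (b - t) \<ge> 0" using True l ab by auto
    ultimately show ?thesis using True ab by simp
  next
    case False
    have "(1 - l) * a + l * b - t = - ((1 - l) * (t - a) + l * (t - b))" by (simp add: algebra_simps)
    moreover have "(1 - l) * (t - a) \<ge> 0" "l * (t - b) \<ge> 0" using False t l ab by auto
    ultimately show ?thesis using False t ab by simp
  qed
  have pos: "\<bar>a - t\<bar> > 0" "\<bar>b - t\<bar> > 0" using False by auto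
  then have pos': "(1 - l) * \<bar>a - t\<bar> + l * \<bar>b - t\<bar> > 0" using l by (simp add: add_pos_pos)
  have "(1 - l) * ln \<bar>a - t\<bar> + l * ln \<bar>b - t\<bar> \<le> ln ((1 - l) * \<bar>a - t\<bar> + l * \<bar>b - t\<bar>)"
    using concave_onD[OF ln_concave, of l "\<bar>a - t\<bar>" "\<bar>b - t\<bar>"] pos l by simp
  then have le: "ln (D / \<bar>(1 - l) * a + l * b - t\<bar>) \<le> (1 - l) * ln (D / \<bar>a - t\<bar>) + l * ln (D / \<bar>b - t\<bar>)"
    unfolding eq using D pos pos' by (simp add: ln_div algebra_simps)
  have m: "ennreal (max 0 x) = ennreal x" for x :: real by (auto simp: max_def ennreal_neg)
  have "ennreal (ln (D / \<bar>(1 - l) * a + l * b - t\<bar>)) \<le> ennreal ((1 - l) * max 0 (ln (D / \<bar>a - t\<bar>)) + l * max 0 (ln (D / \<bar>b - t\<bar>)))"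
    using l by (intro ennreal_leI order_trans[OF le] add_mono mult_left_mono) auto
  also have "\<dots> = ennreal (1 - l) * ennreal (ln (D / \<bar>a - t\<bar>)) + ennreal l * ennreal (ln (D / \<bar>b - t\<bar>))"
    using l by (subst ennreal_plus) (auto simp: ennreal_mult m)
  finally show ?thesis using False pos' eq by (auto simp: log_kernel_def)
qed

lemma potential_lsc:
  assumes N: "N \<in> prob_on A" and D: "D > 0" and u: "u \<longlonglongrightarrow> x"
  shows "potential D N x \<le> liminf (\<lambda>n. \<integral>\<^sup>+t. log_kernel D (u n) t \<partial>N)"
proof -
  have [measurable_cong]: "sets N = sets borel" using N prob_onD by blast
  have "log_kernel D x t \<le> liminf (\<lambda>n. log_kernel D (u n) t)" for t
    unfolding le_Liminf_iff using log_kernel_lsc[OF D u tendsto_const] by auto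
  then have "potential D N x \<le> (\<integral>\<^sup>+t. liminf (\<lambda>n. log_kernel D (u n) t) \<partial>N)"
    by (intro nn_integral_mono)
  also have "\<dots> \<le> liminf (\<lambda>n. \<integral>\<^sup>+t. log_kernel D (u n) t \<partial>N)"
    by (intro nn_integral_liminf) measurable
  finally show ?thesis .
qed

text \<open>Beyond all of \<open>B\<close>, the end point of \<open>B\<close> nearest to
  \<open>x\<close> is closer to the whole mass. Otherwise \<open>x\<close> lies in a gap with end
  points in \<open>B\<close>, across which the kernel is convex for every \<open>t\<close> in
  \<open>B\<close>.\<close>

lemma potential_bound_from_full_set:
  assumes N: "N \<in> prob_on B" and B: "closed B" "B \<noteq> {}" and D: "D > 0"
    and le: "\<And>x. x \<in> B \<Longrightarrow> potential D N x \<le> V"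
  shows "potential D N x \<le> V"
proof (cases "x \<in> B")
  case False
  have [measurable_cong]: "sets N = sets borel" using N prob_onD by blast
  have AE: "AE t in N. t \<in> B" using B N by (intro prob_on_AE) auto
  define L where "L = B \<inter> {..x}"
  define R where "R = B \<inter> {x..}"
  have L: "Sup L \<in> L" "\<And>y. y \<in> L \<Longrightarrow> y \<le> Sup L" if "L \<noteq> {}"
  proof -
    have bdd: "bdd_above L" by (auto simp: L_def intro!: bdd_aboveI[of _ x])
    then show "Sup L \<in> L" using that B by (intro closed_contains_Sup) (auto simp: L_def)
    show "\<And>y. y \<in> L \<Longrightarrow> y \<le> Sup L" using bdd by (rule cSup_upper[rotated])
  qed
  have R: "Inf R \<in> R" "\<And>y. y \<in> R \<Longrightarrow> Inf R \<le> y" if "R \<noteq> {}"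
  proof -
    have bdd: "bdd_below R" by (auto simp: R_def intro!: bdd_belowI[of _ x])
    then show "Inf R \<in> R" using that B by (intro closed_contains_Inf) (auto simp: R_def)
    show "\<And>y. y \<in> R \<Longrightarrow> Inf R \<le> y" using bdd by (rule cInf_lower[rotated])
  qed
  have nearer: ?thesis if b: "b \<in> B" "\<And>t. t \<in> B \<Longrightarrow> \<bar>b - t\<bar> \<le> \<bar>x - t\<bar>" for b
  proof -
    have "potential D N x \<le> potential D N b"
      using AE by (intro nn_integral_mono_AE) (auto elim!: eventually_mono intro!: log_kernel_antimono[OF D] b)
    then show ?thesis using le[OF b(1)] by simp
  qed
  consider "L = {}" | "R = {}" | "L \<noteq> {}" "R \<noteq> {}" by blast
  then show ?thesis
  proof cases
    case 1
    have r: "R \<noteq> {}" using 1 B(2) linear[of _ x] unfolding L_def R_def by blast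
    have "t \<in> R" if "t \<in> B" for t using that 1 by (auto simp: L_def R_def)
    then show ?thesis using R[OF r] by (intro nearer[of "Inf R"]) (fastforce simp: R_def)+
  next
    case 2
    have l: "L \<noteq> {}" using 2 B(2) linear[of _ x] unfolding L_def R_def by blast
    have "t \<in> L" if "t \<in> B" for t using that 2 by (auto simp: L_def R_def)
    then show ?thesis using L[OF l] by (intro nearer[of "Sup L"]) (fastforce simp: L_def)+
  next
    case 3
    define a where "a = Sup L"
    define b where "b = Inf R"
    have a: "a \<in> B" "a < x" and b: "b \<in> B" "x < b"
      using L(1)[OF 3(1)] R(1)[OF 3(2)] False by (auto simp: L_def R_def a_def b_def order_less_le)
    have t: "t \<le> a \<or> b \<le> t" if "t \<in> B" for t
      using that L(2)[OF 3(1), of t] R(2)[OF 3(2), of t] linear[of t x]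
      unfolding L_def R_def a_def b_def by blast
    define l where "l = (x - a) / (b - a)"
    have l: "0 < l" "l < 1" using a b by (auto simp: l_def)
    have x: "(1 - l) * a + l * b = x"
    proof -
      have "l * (b - a) = x - a" using a b by (simp add: l_def)
      then show ?thesis by (simp add: algebra_simps)
    qed
    have "potential D N x \<le> (\<integral>\<^sup>+t. ennreal (1 - l) * log_kernel D a t + ennreal l * log_kernel D b t \<partial>N)"
      using AE
    proof (intro nn_integral_mono_AE, eventually_elim)
      case (elim s)
      show ?case using log_kernel_convex[OF D l t[OF elim(2)]] a b by (simp add: x)
    qed
    also have "\<dots> = ennreal (1 - l) * (potential D N a) + ennreal l * (potential D N b)"
      by (simp add: nn_integral_add nn_integral_cmult)
    also have "\<dots> \<le> ennreal (1 - l) * V + ennreal l * V"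
      by (intro add_mono mult_left_mono le a b) auto
    also have "\<dots> = V" using l by (simp flip: distrib_right ennreal_plus)
    finally show ?thesis .
  qed
qed (rule le)

text \<open>On the real line the maximum principle for the potential is elementary:
  the kernel is convex on either side of its pole, so a bound at the end points of a gap of
  the set where it is known extends to the gap.\<close>

lemma equilibrium_measure:
  assumes A: "compact A" "A \<noteq> {}" and D: "D \<ge> 1" "\<And>x. x \<in> A \<Longrightarrow> \<bar>x\<bar> \<le> D / 2"
    and fin: "\<exists>N\<in>prob_on A. energy D N < \<infinity>"
  obtains M V where "M \<in> prob_on A" "V \<ge> 0"
    "\<And>N. N \<in> prob_on A \<Longrightarrow> ennreal V \<le> energy D N"
    "energy D M = ennreal V"
    "\<And>x. potential D M x \<le> ennreal V"
    "capacity (complex_of_real ` {x\<in>A. (potential D M x) < ennreal V}) = 0"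
proof -
  have D0: "D > 0" using D by simp
  have Ab [measurable]: "A \<in> sets borel" using A by (simp add: borel_compact)
  obtain M where M: "M \<in> prob_on A" and min: "\<And>N. N \<in> prob_on A \<Longrightarrow>
      energy D M \<le> energy D N"
    using exists_minimizer[OF A D0, of \<infinity>] unfolding trunc_kernel_top by metis
  have "energy D M < \<infinity>" using fin min by (metis le_less_trans)
  then obtain V where V: "energy D M = ennreal V" "V \<ge> 0"
    by (cases "energy D M") auto
  define U where "U x = (potential D M x)" for x
  interpret M: prob_space M using M prob_onD by blast
  have sM [measurable_cong]: "sets M = sets borel" using M prob_onD by blast
  have [measurable]: "U \<in> borel_measurable borel" unfolding U_def by measurable
  have var: "ennreal V \<le> (\<integral>\<^sup>+x. U x \<partial>N)" if "N \<in> prob_on A" "energy D N < \<infinity>" for N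
    using minimizer_variation[OF M that(1) Ab, of D \<infinity>] min that V
    unfolding trunc_kernel_top by (simp add: mutual_energy_def U_def)
  \<comment> \<open>With finite energy, \<open>N\<close> would violate \<open>var\<close>, since its
    mean of \<open>U\<close> is strictly below \<open>V\<close>.\<close>
  have polar: "energy D N = \<infinity>" 
    if N: "N \<in> prob_on K" and K: "K \<in> sets borel" "K \<subseteq> {x\<in>A. U x < ennreal V}" for N K
  proof (rule ccontr)
    assume "energy D N \<noteq> \<infinity>"
    then have fin: "energy D N < \<infinity>" by (simp add: less_top)
    interpret N: prob_space N using N prob_onD by blast
    have [measurable_cong]: "sets N = sets borel" using N prob_onD by blast
    have "emeasure N A \<ge> emeasure N K" using K prob_onD(2)[OF N] by (intro emeasure_mono) auto
    then have "N \<in> prob_on A" using N N.emeasure_le_1[of A] by (auto simp: prob_on_def)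
    from var[OF this fin] have le: "ennreal V \<le> (\<integral>\<^sup>+x. U x \<partial>N)" .
    have AE: "AE x in N. U x < ennreal V"
      using prob_on_AE[OF N K(1)] by eventually_elim (use K in auto)
    have "(\<integral>\<^sup>+x. U x \<partial>N) < (\<integral>\<^sup>+x. ennreal V \<partial>N)"
    proof (rule nn_integral_less)
      have "(\<integral>\<^sup>+x. U x \<partial>N) \<le> (\<integral>\<^sup>+x. ennreal V \<partial>N)"
        using AE by (intro nn_integral_mono_AE) (auto elim: eventually_mono)
      then show "(\<integral>\<^sup>+x. U x \<partial>N) \<noteq> \<infinity>" by (auto simp: N.emeasure_space_1 top_unique)
      show "AE x in N. U x \<le> ennreal V" using AE by eventually_elim simp
      show "\<not> (AE x in N. ennreal V \<le> U x)"
      proof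
        assume "AE x in N. ennreal V \<le> U x"
        with AE have "AE x in N. False" by eventually_elim auto
        then show False by simp
      qed
    qed measurable
    then show False using le by (simp add: N.emeasure_space_1)
  qed
  \<comment> \<open>Otherwise \<open>M\<close> conditioned on the set where \<open>U < V\<close>
    would have finite energy, against \<open>polar\<close>.\<close>
  have "AE x in M. ennreal V \<le> U x"
  proof (rule ccontr)
    let ?K = "{x\<in>A. U x < ennreal V}"
    have K: "?K \<in> sets borel" by measurable
    assume nAE: "\<not> (AE x in M. ennreal V \<le> U x)"
    have "emeasure M ?K \<noteq> 0"
    proof
      assume "emeasure M ?K = 0"
      then have "AE x in M. x \<notin> ?K" using K by (intro AE_not_in) (auto simp: null_sets_def sM)
      with prob_on_AE[OF M Ab] have "AE x in M. ennreal V \<le> U x" by eventually_elim auto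
      then show False using nAE by simp
    qed
    then have "emeasure M ?K > 0" by (simp add: zero_less_iff_neq_zero)
    moreover have "energy D M < \<infinity>" by (simp add: V)
    ultimately have u: "uniform_measure M ?K \<in> prob_on ?K"
      "energy D (uniform_measure M ?K) < \<infinity>"
      by (rule uniform_measure_energy[OF M K])+
    have "energy D (uniform_measure M ?K) = \<infinity>"
      by (rule polar[OF u(1) K order_refl])
    then show False using u(2) by simp
  qed
  \<comment> \<open>The mean of \<open>U\<close> under \<open>M\<close> is exactly \<open>V\<close>,
    so the lower bound forces equality almost everywhere.\<close>
  have "AE x in M. U x \<le> ennreal V"
  proof (rule ccontr)
    assume "\<not> (AE x in M. U x \<le> ennreal V)"
    then have "(\<integral>\<^sup>+x. ennreal V \<partial>M) < (\<integral>\<^sup>+x. U x \<partial>M)"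
      using \<open>AE x in M. ennreal V \<le> U x\<close> by (intro nn_integral_less) (auto simp: M.emeasure_space_1)
    then show False using V by (simp add: mutual_energy_def U_def M.emeasure_space_1)
  qed
  define B where "B = {x\<in>A. U x \<le> ennreal V}"
  have [measurable]: "B \<in> sets borel" unfolding B_def by measurable
  have "AE x in M. x \<in> B"
    using prob_on_AE[OF M Ab] \<open>AE x in M. U x \<le> ennreal V\<close> by eventually_elim (simp add: B_def)
  then have "emeasure M B = 1" by (intro M.emeasure_eq_1_AE) (auto simp: sM)
  then have MB: "M \<in> prob_on B" using M by (simp add: prob_on_def)
  have "B \<noteq> {}" using \<open>emeasure M B = 1\<close> by auto
  \<comment> \<open>Semicontinuity of \<open>U\<close> makes its sublevel set closed, as the
    argument across gaps requires.\<close>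
  have "closed B"
    unfolding closed_sequential_limits
  proof (intro allI impI)
    fix u x assume u: "(\<forall>n. u n \<in> B) \<and> u \<longlonglongrightarrow> x"
    have "U x \<le> liminf (\<lambda>n. U (u n))" unfolding U_def using u by (intro potential_lsc[OF M D0]) auto
    also have "\<dots> \<le> ennreal V" using u by (intro Liminf_le) (auto simp: B_def)
    finally show "x \<in> B"
      using closed_sequentially[OF compact_imp_closed[OF A(1)], of u x] u by (auto simp: B_def)
  qed
  have le: "U x \<le> ennreal V" for x
    unfolding U_def
    by (rule potential_bound_from_full_set[OF MB \<open>closed B\<close> \<open>B \<noteq> {}\<close> D0]) (simp add: B_def U_def)
  have "capacity (complex_of_real ` {x\<in>A. U x < ennreal V}) = 0"
  proof -
    have "log_energy \<mu> = \<infinity>" if \<mu>: "prob_measure_on (complex_of_real ` {x\<in>A. U x < ennreal V}) \<mu>" for \<mu>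
    proof -
      obtain K N where K: "compact K" "complex_of_real ` K \<subseteq> complex_of_real ` {x\<in>A. U x < ennreal V}"
        and N: "N \<in> prob_on K" "log_energy \<mu> = enn2ereal (energy D N) - ereal (ln D)"
        by (rule prob_measure_on_realD[OF \<mu> _ D, of A]) auto
      have "K \<subseteq> {x\<in>A. U x < ennreal V}" using K(2) by (auto simp: image_iff subset_eq)
      then have "energy D N = \<infinity>" using K by (intro polar[OF N(1)]) (auto simp: borel_compact)
      then show ?thesis using N(2) by simp
    qed
    then have "robin_constant (complex_of_real ` {x\<in>A. U x < ennreal V}) = \<infinity>"
      unfolding robin_constant_def by (intro INF_eqI) auto
    then show ?thesis by (simp add: capacity_def)
  qed
  then show ?thesis using that[OF M V(2)] min V le by (simp add: U_def)
qed

lemma capacity_eq_exp: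
  assumes A: "compact A" and D: "D \<ge> 1" "\<And>x. x \<in> A \<Longrightarrow> \<bar>x\<bar> \<le> D / 2"
    and M: "M \<in> prob_on A" "energy D M = ennreal V" "V \<ge> 0"
    and min: "\<And>N. N \<in> prob_on A \<Longrightarrow> ennreal V \<le> energy D N"
  shows "capacity (complex_of_real ` A) = exp (ln D - V)"
proof -
  have Ab: "A \<in> sets borel" using A by (simp add: borel_compact)
  have "robin_constant (complex_of_real ` A) = ereal (V - ln D)"
    unfolding robin_constant_def
  proof (rule antisym)
    obtain \<mu> where \<mu>: "prob_measure_on (complex_of_real ` A) \<mu>"
      "log_energy \<mu> = enn2ereal (energy D M) - ereal (ln D)"
      using prob_measure_on_realI[OF M(1) A order_refl D] by metis
    then have "log_energy \<mu> = ereal (V - ln D)" using M by (simp add: enn2ereal_ennreal)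
    then show "(INF \<mu>\<in>{\<mu>. prob_measure_on (complex_of_real ` A) \<mu>}. log_energy \<mu>) \<le> ereal (V - ln D)"
      using \<mu>(1) by (intro INF_lower2[of \<mu>]) auto
    show "ereal (V - ln D) \<le> (INF \<mu>\<in>{\<mu>. prob_measure_on (complex_of_real ` A) \<mu>}. log_energy \<mu>)"
    proof (rule INF_greatest)
      fix \<mu> assume "\<mu> \<in> {\<mu>. prob_measure_on (complex_of_real ` A) \<mu>}"
      then have \<mu>: "prob_measure_on (complex_of_real ` A) \<mu>" by simp
      obtain K N where K: "compact K" "complex_of_real ` K \<subseteq> complex_of_real ` A"
        and N: "N \<in> prob_on K" "log_energy \<mu> = enn2ereal (energy D N) - ereal (ln D)"
        by (rule prob_measure_on_realD[OF \<mu> _ D, of A]) auto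
      interpret N: prob_space N using N prob_onD by blast
      have "K \<subseteq> A" using K(2) by (auto simp: image_iff subset_eq)
      then have "emeasure N A \<ge> emeasure N K" using Ab prob_onD(2)[OF N(1)] by (intro emeasure_mono) auto
      then have "N \<in> prob_on A" using N(1) N.emeasure_le_1[of A] by (auto simp: prob_on_def)
      from min[OF this] have "enn2ereal (ennreal V) \<le> enn2ereal (energy D N)"
        by (simp add: less_eq_ennreal.rep_eq)
      then show "ereal (V - ln D) \<le> log_energy \<mu>" unfolding N(2) using M
        by (cases "energy D N") (auto simp: enn2ereal_ennreal)
    qed
  qed
  then show ?thesis by (simp add: capacity_def)
qed

lemma capacity_pos_finite_energy:
  assumes cap: "capacity (complex_of_real ` A) > 0" and A: "compact A"
    and D: "D \<ge> 1" "\<And>x. x \<in> A \<Longrightarrow> \<bar>x\<bar> \<le> D / 2"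
  shows "\<exists>N\<in>prob_on A. energy D N < \<infinity>"
proof -
  have Ab: "A \<in> sets borel" using A by (simp add: borel_compact)
  have "robin_constant (complex_of_real ` A) < \<infinity>" using cap by (auto simp: capacity_def split: if_splits)
  then obtain \<mu> where \<mu>: "prob_measure_on (complex_of_real ` A) \<mu>" "log_energy \<mu> < \<infinity>"
    unfolding robin_constant_def INF_less_iff by blast
  obtain K N where K: "compact K" "complex_of_real ` K \<subseteq> complex_of_real ` A"
    and N: "N \<in> prob_on K" "log_energy \<mu> = enn2ereal (energy D N) - ereal (ln D)"
    by (rule prob_measure_on_realD[OF \<mu>(1) _ D, of A]) auto
  interpret N: prob_space N using N prob_onD by blast
  have "K \<subseteq> A" using K(2) by (auto simp: image_iff subset_eq)
  then have "emeasure N A \<ge> emeasure N K" using Ab prob_onD(2)[OF N(1)] by (intro emeasure_mono) auto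
  then have "N \<in> prob_on A" using N(1) N.emeasure_le_1[of A] by (auto simp: prob_on_def)
  moreover have "energy D N < \<infinity>"
    using \<mu>(2) N(2) by (cases "energy D N") auto
  ultimately show ?thesis by blast
qed

section \<open>Harmonic functions\<close>

text \<open>\<open>f\<close> is the complex gradient \<open>u_x - i u_y\<close>, so \<open>u\<close>
  is locally the real part of a holomorphic function. This passes easily through integrals and gives
  access to the Schwarz lemma.\<close>

definition hol_grad :: "(complex \<Rightarrow> real) \<Rightarrow> complex set \<Rightarrow> bool" where
  "hol_grad u S \<longleftrightarrow> (\<exists>f. f holomorphic_on S \<and> (\<forall>z\<in>S. (u has_derivative (\<lambda>h. Re (f z * h))) (at z)))"

lemma hol_grad_harmonic:
  assumes "open S" "hol_grad u S" shows "harmonic_on u S"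
proof -
  obtain f where f: "f holomorphic_on S" and u: "\<And>z. z \<in> S \<Longrightarrow> (u has_derivative (\<lambda>h. Re (f z * h))) (at z)"
    using assms by (auto simp: hol_grad_def)
  have d: "(f has_derivative (\<lambda>h. deriv f z * h)) (at z)" if "z \<in> S" for z
    using holomorphic_derivI[OF f assms(1) that] by (simp add: has_field_derivative_def)
  have "continuous_on S (deriv f)"
    using f assms by (intro holomorphic_on_imp_continuous_on holomorphic_deriv)
  then have c: "continuous_on S (\<lambda>z. Re (deriv f z))" "continuous_on S (\<lambda>z. Im (deriv f z))"
    by (auto intro: continuous_intros)
  show ?thesis
    unfolding harmonic_on_def
  proof (intro exI conjI ballI)
    fix z assume z: "z \<in> S"
    show "(u has_derivative (\<lambda>h. Re (f z) * Re h + (- Im (f z)) * Im h)) (at z)"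
      using u[OF z] by simp
    show "((\<lambda>z. Re (f z)) has_derivative (\<lambda>h. Re (deriv f z) * Re h + (- Im (deriv f z)) * Im h)) (at z)"
      using bounded_linear.has_derivative[OF bounded_linear_Re d[OF z]] by simp
    show "((\<lambda>z. - Im (f z)) has_derivative (\<lambda>h. (- Im (deriv f z)) * Re h + (- Re (deriv f z)) * Im h)) (at z)"
      using has_derivative_minus[OF bounded_linear.has_derivative[OF bounded_linear_Im d[OF z]]]
      by (simp add: algebra_simps)
    show "Re (deriv f z) + - Re (deriv f z) = 0" by simp
  qed (use c in \<open>auto intro: continuous_intros\<close>)
qed

lemma hol_grad_lincomb:
  assumes "hol_grad u S" "hol_grad v S" shows "hol_grad (\<lambda>z. a * u z + b * v z) S"
proof -
  obtain f g where f: "f holomorphic_on S" "\<And>z. z \<in> S \<Longrightarrow> (u has_derivative (\<lambda>h. Re (f z * h))) (at z)"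
    and g: "g holomorphic_on S" "\<And>z. z \<in> S \<Longrightarrow> (v has_derivative (\<lambda>h. Re (g z * h))) (at z)"
    using assms by (auto simp: hol_grad_def)
  have "((\<lambda>z. a * u z + b * v z) has_derivative (\<lambda>h. Re ((of_real a * f z + of_real b * g z) * h))) (at z)"
    if "z \<in> S" for z
    using has_derivative_add[OF has_derivative_mult_right[OF f(2)[OF that], of a] has_derivative_mult_right[OF g(2)[OF that], of b]]
    by (simp add: algebra_simps)
  moreover have "(\<lambda>z. of_real a * f z + of_real b * g z) holomorphic_on S"
    by (intro holomorphic_intros f g)
  ultimately show ?thesis unfolding hol_grad_def by blast
qed

lemma hol_grad_const: "hol_grad (\<lambda>z. c) S"
  unfolding hol_grad_def by (intro exI[of _ "\<lambda>_. 0"]) auto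

lemma hol_grad_subset: "hol_grad u S \<Longrightarrow> T \<subseteq> S \<Longrightarrow> hol_grad u T"
  unfolding hol_grad_def using holomorphic_on_subset by blast

lemma hol_grad_cong:
  assumes "hol_grad u S" "open S" "\<And>z. z \<in> S \<Longrightarrow> u z = v z" shows "hol_grad v S"
proof -
  obtain f where f: "f holomorphic_on S" "\<And>z. z \<in> S \<Longrightarrow> (u has_derivative (\<lambda>h. Re (f z * h))) (at z)"
    using assms(1) by (auto simp: hol_grad_def)
  have "(v has_derivative (\<lambda>h. Re (f z * h))) (at z)" if "z \<in> S" for z
    by (rule has_derivative_transform_within_open[OF f(2)[OF that] assms(2) that assms(3)])
  then show ?thesis using f(1) unfolding hol_grad_def by blast
qed

lemma hol_grad_continuous:
  assumes "hol_grad u S" "z \<in> S" shows "isCont u z"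
  using assms unfolding hol_grad_def by (auto intro: has_derivative_continuous)

text \<open>The body of \<open>harmonic_on\<close> with its six derivatives exposed, so that they
  can be named and combined.\<close>

definition laplace_data where
  "laplace_data S u ux uy uxx uxy uyx uyy \<longleftrightarrow>
        (\<forall>z\<in>S. (u has_derivative (\<lambda>h. ux z * Re h + uy z * Im h)) (at z)) \<and>
        (\<forall>z\<in>S. (ux has_derivative (\<lambda>h. uxx z * Re h + uxy z * Im h)) (at z)) \<and>
        (\<forall>z\<in>S. (uy has_derivative (\<lambda>h. uyx z * Re h + uyy z * Im h)) (at z)) \<and>
        continuous_on S uxx \<and> continuous_on S uxy \<and>
        continuous_on S uyx \<and> continuous_on S uyy \<and>
        (\<forall>z\<in>S. uxx z + uyy z = (0::real))"

lemma harmonic_on_iff: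
  "harmonic_on u S \<longleftrightarrow> (\<exists>ux uy uxx uxy uyx uyy. laplace_data S u ux uy uxx uxy uyx uyy)"
  unfolding harmonic_on_def laplace_data_def by (rule refl)

lemma laplace_dataD:
  assumes "laplace_data S u ux uy uxx uxy uyx uyy"
  shows
    "\<And>z. z \<in> S \<Longrightarrow> (u has_derivative (\<lambda>h. ux z * Re h + uy z * Im h)) (at z)"
    "\<And>z. z \<in> S \<Longrightarrow> (ux has_derivative (\<lambda>h. uxx z * Re h + uxy z * Im h)) (at z)"
    "\<And>z. z \<in> S \<Longrightarrow> (uy has_derivative (\<lambda>h. uyx z * Re h + uyy z * Im h)) (at z)"
    "continuous_on S uxx" "continuous_on S uxy" "continuous_on S uyx" "continuous_on S uyy"
    "\<And>z. z \<in> S \<Longrightarrow> uxx z + uyy z = 0"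
  using assms unfolding laplace_data_def by simp_all

lemma harmonic_on_continuous:
  assumes "harmonic_on u S" "z \<in> S" shows "isCont u z"
proof -
  obtain ux uy uxx uxy uyx uyy where "laplace_data S u ux uy uxx uxy uyx uyy"
    using assms(1) harmonic_on_iff by metis
  from laplace_dataD(1)[OF this assms(2)] show ?thesis by (rule has_derivative_continuous)
qed

lemma harmonic_on_cong:
  assumes "harmonic_on u S" "open S" "\<And>z. z \<in> S \<Longrightarrow> u z = v z" shows "harmonic_on v S"
proof -
  obtain ux uy uxx uxy uyx uyy where d: "laplace_data S u ux uy uxx uxy uyx uyy"
    using assms(1) harmonic_on_iff by metis
  have "laplace_data S v ux uy uxx uxy uyx uyy"
    unfolding laplace_data_def
    by (intro conjI ballI laplace_dataD(2-8)[OF d] has_derivative_transform_within_open[OF laplace_dataD(1)[OF d] assms(2) _ assms(3)])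
  then show ?thesis using harmonic_on_iff by blast
qed

lemma harmonic_on_lincomb:
  assumes "harmonic_on u S" "harmonic_on v S" shows "harmonic_on (\<lambda>z. a * u z + b * v z) S"
proof -
  obtain ux uy uxx uxy uyx uyy where "laplace_data S u ux uy uxx uxy uyx uyy"
    using assms(1) harmonic_on_iff by metis
  note u = laplace_dataD[OF this]
  obtain vx vy vxx vxy vyx vyy where "laplace_data S v vx vy vxx vxy vyx vyy"
    using assms(2) harmonic_on_iff by metis
  note v = laplace_dataD[OF this]
  have comb: "((\<lambda>z. a * f z + b * g z) has_derivative (\<lambda>h. (a * p + b * q) * Re h + (a * p' + b * q') * Im h)) (at z)"
    if "(f has_derivative (\<lambda>h. p * Re h + p' * Im h)) (at z)" "(g has_derivative (\<lambda>h. q * Re h + q' * Im h)) (at z)"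
    for f g :: "complex \<Rightarrow> real" and p p' q q' z
    using has_derivative_add[OF has_derivative_mult_right[OF that(1), of a] has_derivative_mult_right[OF that(2), of b]]
    by (simp add: algebra_simps)
  have "laplace_data S (\<lambda>z. a * u z + b * v z) (\<lambda>z. a * ux z + b * vx z) (\<lambda>z. a * uy z + b * vy z)
     (\<lambda>z. a * uxx z + b * vxx z) (\<lambda>z. a * uxy z + b * vxy z) (\<lambda>z. a * uyx z + b * vyx z) (\<lambda>z. a * uyy z + b * vyy z)"
    unfolding laplace_data_def
  proof (intro conjI ballI)
    fix z assume z: "z \<in> S"
    have "(a * uxx z + b * vxx z) + (a * uyy z + b * vyy z) = a * (uxx z + uyy z) + b * (vxx z + vyy z)"
      by (simp add: algebra_simps)
    then show "(a * uxx z + b * vxx z) + (a * uyy z + b * vyy z) = 0" using u(8)[OF z] v(8)[OF z] by simp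
  qed (intro comb u v continuous_intros; assumption)+
  then show ?thesis using harmonic_on_iff by blast
qed

section \<open>The maximum principle\<close>

lemma second_derivative_local_max:
  fixes f :: "real \<Rightarrow> real"
  assumes d: "d > 0" and f: "\<And>t. \<bar>t\<bar> < d \<Longrightarrow> (f has_real_derivative f' t) (at t)"
    and f': "(f' has_real_derivative D) (at 0)" and max: "\<And>t. \<bar>t\<bar> < d \<Longrightarrow> f t \<le> f 0"
  shows "D \<le> 0"
proof (rule ccontr)
  assume "\<not> D \<le> 0"
  have "f' 0 = 0" using DERIV_local_max[OF f[of 0] d] d max by simp
  then obtain e where e: "e > 0" "\<And>h. 0 < h \<Longrightarrow> h < e \<Longrightarrow> 0 < f' h"
    using DERIV_pos_inc_right[OF f'] \<open>\<not> D \<le> 0\<close> by auto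
  define t where "t = min d e / 2"
  have t: "0 < t" "t < d" "t < e" using d e by (auto simp: t_def min_def)
  obtain x where x: "0 < x" "x < t" "f t - f 0 = (t - 0) * f' x"
    using MVT2[of 0 t f f'] t f by force
  then have "f t - f 0 > 0" using e(2)[of x] t by simp
  then show False using max[of t] t by simp
qed

lemma has_real_derivative_along_line:
  fixes u :: "complex \<Rightarrow> real"
  assumes "(u has_derivative (\<lambda>h. a * Re h + b * Im h)) (at (c + of_real t * d))"
  shows "((\<lambda>t. u (c + of_real t * d)) has_real_derivative (a * Re d + b * Im d)) (at t)"
proof -
  have "((\<lambda>t. c + of_real t * d) has_derivative (\<lambda>s. of_real s * d)) (at t)"
    by (auto intro!: derivative_eq_intros)
  from has_derivative_compose[OF this assms]
  show ?thesis
    unfolding has_field_derivative_def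
    by (rule has_derivative_eq_rhs) (simp add: fun_eq_iff algebra_simps)
qed

text \<open>A positive value would give \<open>u + \<epsilon> |w|^2\<close> an interior local
  maximum, where both pure second derivatives are nonpositive although they add up to
  \<open>4 \<epsilon>\<close>. The conditions at \<open>E\<close> and at infinity are limsup bounds;
  no limits have to exist there.\<close>

lemma harmonic_max_principle:
  assumes E: "closed E" and u: "harmonic_on u (- E)"
    and bd: "\<And>\<zeta> \<eta>. \<zeta> \<in> E \<Longrightarrow> \<eta> > 0 \<Longrightarrow> \<exists>r>0. \<forall>z\<in>ball \<zeta> r - E. u z < \<eta>"
    and inf: "\<And>\<eta>. \<eta> > 0 \<Longrightarrow> \<exists>R. \<forall>z. z \<notin> E \<longrightarrow> cmod z \<ge> R \<longrightarrow> u z < \<eta>"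
    and z: "z \<notin> E"
  shows "u z \<le> 0"
proof (rule ccontr)
  assume "\<not> u z \<le> 0"
  define \<eta> where "\<eta> = u z / 2"
  have \<eta>: "\<eta> > 0" using \<open>\<not> u z \<le> 0\<close> by (simp add: \<eta>_def)
  obtain R0 where R0: "\<And>z. z \<notin> E \<Longrightarrow> cmod z \<ge> R0 \<Longrightarrow> u z < \<eta>" using inf[OF \<eta>] by blast
  define R where "R = max R0 (cmod z)"
  have R: "R \<ge> 0" "cmod z \<le> R" "\<And>z. z \<notin> E \<Longrightarrow> cmod z \<ge> R \<Longrightarrow> u z < \<eta>"
    using R0 norm_ge_zero[of z] unfolding R_def by (linarith, auto)
  have cont: "isCont u w" if "w \<notin> E" for w using harmonic_on_continuous[OF u] that by simp
  \<comment> \<open>The boundary condition keeps \<open>C\<close> away from \<open>E\<close>, which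
    makes it compact.\<close>
  define C where "C = {w. w \<notin> E \<and> u w \<ge> \<eta> \<and> cmod w \<le> R}"
  have "closed C"
    unfolding closed_sequential_limits
  proof (intro allI impI)
    fix v w assume v: "(\<forall>n. v n \<in> C) \<and> v \<longlonglongrightarrow> w"
    have "cmod w \<le> R" using v by (intro Lim_bounded[OF tendsto_norm[of v w]]) (auto simp: C_def)
    moreover have wE: "w \<notin> E"
    proof
      assume "w \<in> E"
      then obtain r where r: "r > 0" "\<And>z. z \<in> ball w r - E \<Longrightarrow> u z < \<eta>" using bd[OF _ \<eta>] by blast
      have "eventually (\<lambda>n. dist (v n) w < r) sequentially" using v r(1) tendstoD by blast
      then obtain n where "dist (v n) w < r" by (auto simp: eventually_sequentially)
      moreover have "v n \<notin> E" "u (v n) \<ge> \<eta>" using v by (auto simp: C_def)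
      ultimately show False using r(2)[of "v n"] by (simp add: dist_commute)
    qed
    moreover have "(\<lambda>n. u (v n)) \<longlonglongrightarrow> u w" using cont[OF wE] v isCont_tendsto_compose by blast
    then have "\<eta> \<le> u w" by (rule Lim_bounded2[of _ _ 0]) (use v in \<open>auto simp: C_def\<close>)
    ultimately show "w \<in> C" by (simp add: C_def)
  qed
  then have "compact C" using bounded_subset[OF bounded_cball[of 0 R], of C]
    by (auto simp: compact_eq_bounded_closed C_def subset_eq)
  \<comment> \<open>Within radius \<open>R + 1\<close> the perturbation is at most
    \<open>\<eta>\<close>. Off \<open>C\<close> this leaves
    \<open>\<Phi> <= 2 \<eta> <= \<Phi> z\<close> there, so the maximum over \<open>C\<close> is one
    over a full ball around \<open>c\<close>.\<close>
  define \<epsilon> where "\<epsilon> = \<eta> / (R + 1)^2"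
  have \<epsilon>: "\<epsilon> > 0" using \<eta> R(1) by (simp add: \<epsilon>_def)
  define \<Phi> where "\<Phi> w = u w + \<epsilon> * ((Re w)\<^sup>2 + (Im w)\<^sup>2)" for w
  have "z \<in> C" using z \<eta> R by (auto simp: C_def \<eta>_def)
  moreover have "continuous_on C \<Phi>"
    unfolding \<Phi>_def using cont by (intro continuous_intros continuous_at_imp_continuous_on) (auto simp: C_def)
  ultimately obtain c where c: "c \<in> C" "\<And>w. w \<in> C \<Longrightarrow> \<Phi> w \<le> \<Phi> c"
    using continuous_attains_sup[OF \<open>compact C\<close>, of \<Phi>] by blast
  have \<Phi>z: "\<Phi> z \<ge> 2 * \<eta>" using \<epsilon> by (simp add: \<Phi>_def \<eta>_def)
  have cE: "c \<notin> E" using c by (simp add: C_def)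
  obtain d0 where d0: "d0 > 0" "ball c d0 \<subseteq> - E"
    using E cE by (metis ComplI open_Compl open_contains_ball)
  define d where "d = min d0 1"
  have d: "d > 0" using d0 by (simp add: d_def)
  have max: "\<Phi> w \<le> \<Phi> c" if "w \<in> ball c d" for w
  proof (cases "w \<in> C")
    case False
    have wE: "w \<notin> E" using that d0 by (auto simp: d_def)
    have "cmod w \<le> cmod c + dist c w" by (metis dist_commute dist_norm norm_triangle_sub)
    then have w: "cmod w \<le> R + 1" using that c by (auto simp: C_def d_def)
    have "u w < \<eta>" using False wE R(3)[OF wE] by (force simp: C_def)
    moreover have "(Re w)\<^sup>2 + (Im w)\<^sup>2 \<le> (R + 1)\<^sup>2"
      using w by (metis cmod_power2 norm_ge_zero power_mono)
    then have "\<epsilon> * ((Re w)\<^sup>2 + (Im w)\<^sup>2) \<le> \<epsilon> * (R + 1)\<^sup>2" using \<epsilon> by (intro mult_left_mono) auto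
    then have "\<epsilon> * ((Re w)\<^sup>2 + (Im w)\<^sup>2) \<le> \<eta>" using R(1) by (simp add: \<epsilon>_def)
    ultimately have "\<Phi> w \<le> 2 * \<eta>" by (simp add: \<Phi>_def)
    then show ?thesis using c(2)[OF \<open>z \<in> C\<close>] \<Phi>z by linarith
  qed (use c in blast)
  obtain ux uy uxx uxy uyx uyy where "laplace_data (- E) u ux uy uxx uxy uyx uyy"
    using u harmonic_on_iff by metis
  note h' = laplace_dataD[OF this]
  note h = h'[unfolded Compl_iff]
  have inb: "c + of_real t * w \<in> ball c d" "c + of_real t * w \<notin> E" if "\<bar>t\<bar> < d" "w = 1 \<or> w = \<i>" for t w
  proof -
    show "c + of_real t * w \<in> ball c d" using that by (auto simp: dist_norm norm_mult)
    then show "c + of_real t * w \<notin> E" using d0 by (auto simp: d_def)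
  qed
  have x: "uxx c + 2 * \<epsilon> \<le> 0"
  proof (rule second_derivative_local_max[OF d])
    fix t :: real assume t: "\<bar>t\<bar> < d"
    show "((\<lambda>t. \<Phi> (c + of_real t * 1)) has_real_derivative ux (c + of_real t * 1) + \<epsilon> * (2 * (Re c + t))) (at t)"
      unfolding \<Phi>_def
      by (rule derivative_eq_intros has_real_derivative_along_line h(1) inb[OF t] refl | simp)+
    show "\<Phi> (c + of_real t * 1) \<le> \<Phi> (c + of_real 0 * 1)" using max[OF inb(1)[OF t, of 1]] by simp
  next
    show "((\<lambda>t. ux (c + of_real t * 1) + \<epsilon> * (2 * (Re c + t))) has_real_derivative uxx c + 2 * \<epsilon>) (at 0)"
      by (rule derivative_eq_intros has_real_derivative_along_line[where d=1] h(2) refl | simp add: cE)+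
  qed
  have y: "uyy c + 2 * \<epsilon> \<le> 0"
  proof (rule second_derivative_local_max[OF d])
    fix t :: real assume t: "\<bar>t\<bar> < d"
    show "((\<lambda>t. \<Phi> (c + of_real t * \<i>)) has_real_derivative uy (c + of_real t * \<i>) + \<epsilon> * (2 * (Im c + t))) (at t)"
      unfolding \<Phi>_def
      by (rule derivative_eq_intros has_real_derivative_along_line h(1) inb[OF t] refl | simp)+
    show "\<Phi> (c + of_real t * \<i>) \<le> \<Phi> (c + of_real 0 * \<i>)" using max[OF inb(1)[OF t, of \<i>]] by simp
  next
    show "((\<lambda>t. uy (c + of_real t * \<i>) + \<epsilon> * (2 * (Im c + t))) has_real_derivative uyy c + 2 * \<epsilon>) (at 0)"
      by (rule derivative_eq_intros has_real_derivative_along_line[where d=\<i>] h(3) refl | simp add: cE)+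
  qed
  show False using x y h(8)[OF cE] \<epsilon> by linarith
qed

section \<open>Harnack's inequality\<close>

lemma hol_grad_primitive:
  assumes u: "hol_grad u (ball c r)"
  obtains F where "F holomorphic_on ball c r" "\<And>z. z \<in> ball c r \<Longrightarrow> u z = Re (F z)" "Im (F c) = 0"
proof -
  obtain f where f: "f holomorphic_on ball c r" and d: "\<And>z. z \<in> ball c r \<Longrightarrow> (u has_derivative (\<lambda>h. Re (f z * h))) (at z)"
    using u by (auto simp: hol_grad_def)
  obtain g where g: "\<And>z. z \<in> ball c r \<Longrightarrow> (g has_field_derivative f z) (at z)"
    using holomorphic_convex_primitive'[OF convex_ball open_ball f] by (metis at_within_open open_ball)
  have "((\<lambda>w. u w - Re (g w)) has_derivative (\<lambda>h. 0)) (at z within ball c r)" if "z \<in> ball c r" for z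
  proof -
    have "(g has_derivative (\<lambda>h. f z * h)) (at z)" using g[OF that] by (simp add: has_field_derivative_def)
    from has_derivative_diff[OF d[OF that] bounded_linear.has_derivative[OF bounded_linear_Re this]]
    show ?thesis by (rule has_derivative_at_withinI[OF has_derivative_eq_rhs]) simp
  qed
  then obtain k where k: "\<And>z. z \<in> ball c r \<Longrightarrow> u z - Re (g z) = k"
    using has_derivative_zero_constant[OF convex_ball, of c r "\<lambda>w. u w - Re (g w)"] by blast
  have "g holomorphic_on ball c r" using g by (metis holomorphic_onI field_differentiable_def field_differentiable_at_within)
  then have "(\<lambda>z. g z + of_real k - \<i> * of_real (Im (g c))) holomorphic_on ball c r" by (intro holomorphic_intros)
  then show ?thesis using k by (intro that[of "\<lambda>z. g z + of_real k - \<i> * of_real (Im (g c))"]) force+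
qed

text \<open>The Cayley transform \<open>(F - A) / (F + A)\<close> maps the right half plane to the
  unit disc and \<open>F c = A\<close> to 0, so by the Schwarz lemma it is at most
  \<open>1 / 2\<close> at half the radius. The points of the half plane allowed by this form a disc
  meeting the real axis in \<open>A / 3\<close> and \<open>3 A\<close>.\<close>

lemma Harnack_positive:
  assumes r: "r > 0" and u: "hol_grad u (ball c r)" and pos: "\<And>z. z \<in> ball c r \<Longrightarrow> u z > 0"
    and z: "dist c z \<le> r / 2"
  shows "u z \<le> 3 * u c" "u c \<le> 3 * u z"
proof -
  obtain F where F: "F holomorphic_on ball c r" "\<And>z. z \<in> ball c r \<Longrightarrow> u z = Re (F z)" "Im (F c) = 0"
    using hol_grad_primitive[OF u] by blast
  define A where "A = u c"
  have Ap: "A > 0" using pos r by (simp add: A_def)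
  have FA: "F c = of_real A" using F(2)[of c] F(3) r by (simp add: A_def complex_eq_iff)
  have inb: "c + of_real r * w \<in> ball c r" if "cmod w < 1" for w using that r by (simp add: dist_norm norm_mult)
  define \<phi> where "\<phi> w = (F (c + of_real r * w) - of_real A) / (F (c + of_real r * w) + of_real A)" for w
  have nz: "F x + of_real A \<noteq> 0" if "x \<in> ball c r" for x
    using pos[OF that] F(2)[OF that] Ap by (auto simp: complex_eq_iff)
  have lt: "cmod (F x - of_real A) < cmod (F x + of_real A)" if "x \<in> ball c r" for x
  proof (rule power2_less_imp_less)
    have "Re (F x) * A > 0" using pos[OF that] F(2)[OF that] Ap by simp
    then show "(cmod (F x - of_real A))\<^sup>2 < (cmod (F x + of_real A))\<^sup>2"
      unfolding cmod_power2 by (simp add: power2_eq_square algebra_simps)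
  qed simp
  have hol: "(\<lambda>w. F (c + of_real r * w)) holomorphic_on ball 0 1"
  proof -
    have "(\<lambda>w. c + of_real r * w) holomorphic_on ball 0 1" by (intro holomorphic_intros)
    moreover have "(\<lambda>w. c + of_real r * w) ` ball 0 1 \<subseteq> ball c r" using inb by auto
    ultimately show ?thesis using holomorphic_on_compose_gen[OF _ F(1)] by (auto simp only: comp_def)
  qed
  define w where "w = (z - c) / of_real r"
  have zw: "z = c + of_real r * w" using r by (simp add: w_def)
  have w: "cmod w \<le> 1 / 2" using z r by (simp add: w_def norm_divide dist_norm norm_minus_commute field_simps)
  have "cmod (\<phi> w) \<le> cmod w"
  proof (rule Schwarz_Lemma(1))
    show "\<phi> holomorphic_on ball 0 1" unfolding \<phi>_def
      by (intro holomorphic_intros hol) (use nz inb in auto)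
    show "\<phi> 0 = 0" by (simp add: \<phi>_def FA)
    show "cmod (\<phi> w) < 1" if "cmod w < 1" for w
      using lt[OF inb[OF that]] nz[OF inb[OF that]] by (simp add: \<phi>_def norm_divide)
  qed (use w in simp)
  then have "cmod (\<phi> w) \<le> 1 / 2" using w by simp
  moreover have zb: "z \<in> ball c r" using z r by simp
  ultimately have "cmod (F z - of_real A) \<le> 1 / 2 * cmod (F z + of_real A)"
    using nz[OF zb] unfolding \<phi>_def zw[symmetric] by (simp add: norm_divide field_simps)
  then have "(cmod (F z - of_real A))\<^sup>2 \<le> (1 / 2 * cmod (F z + of_real A))\<^sup>2"
    by (intro power_mono) auto
  then have "3 * (Re (F z))\<^sup>2 + 3 * (Im (F z))\<^sup>2 + 3 * A\<^sup>2 \<le> 10 * A * Re (F z)"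
    unfolding power_mult_distrib cmod_power2 by (simp add: power2_eq_square algebra_simps)
  moreover have "(Im (F z))\<^sup>2 \<ge> 0" by simp
  ultimately have "3 * (Re (F z))\<^sup>2 + 3 * A\<^sup>2 \<le> 10 * A * Re (F z)" by linarith
  \<comment> \<open>The imaginary part is dropped; the remaining quadratic has the roots
    \<open>A / 3\<close> and \<open>3 A\<close>.\<close>
  then have q: "(3 * u z - A) * (u z - 3 * A) \<le> 0"
    using F(2)[OF zb] by (simp add: power2_eq_square algebra_simps)
  have "u z > 0" using pos[OF zb] .
  show "u z \<le> 3 * u c"
  proof (rule ccontr)
    assume "\<not> u z \<le> 3 * u c"
    then have "3 * u z - A > 0" "u z - 3 * A > 0" using Ap unfolding A_def by linarith+
    then show False using q mult_pos_pos by (metis not_less)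
  qed
  show "u c \<le> 3 * u z"
  proof (rule ccontr)
    assume "\<not> u c \<le> 3 * u z"
    then have "3 * u z - A < 0" "u z - 3 * A < 0" using Ap unfolding A_def by linarith+
    then show False using q mult_neg_neg by (metis not_less)
  qed
qed

lemma Harnack:
  assumes r: "r > 0" and u: "hol_grad u (ball c r)" and pos: "\<And>z. z \<in> ball c r \<Longrightarrow> u z \<ge> 0"
    and z: "dist c z \<le> r / 2"
  shows "u z \<le> 3 * u c" "u c \<le> 3 * u z"
proof -
  have *: "u z + e \<le> 3 * (u c + e)" "u c + e \<le> 3 * (u z + e)" if e: "e > 0" for e
  proof -
    have "hol_grad (\<lambda>z. u z + e) (ball c r)"
      using hol_grad_lincomb[OF u hol_grad_const[of e], of 1 1] by simp
    from Harnack_positive[OF r this _ z]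
    show "u z + e \<le> 3 * (u c + e)" "u c + e \<le> 3 * (u z + e)" using pos e by (smt (verit))+
  qed
  show "u z \<le> 3 * u c" by (rule field_le_epsilon) (use *(1)[of "_ / 2"] in force)
  show "u c \<le> 3 * u z" by (rule field_le_epsilon) (use *(2)[of "_ / 2"] in force)
qed

section \<open>Logarithms of polynomials and logarithmic potentials\<close>

lemma has_derivative_ln_cmod:
  assumes f: "(f has_field_derivative f') (at z)" and nz: "f z \<noteq> 0"
  shows "((\<lambda>z. ln (cmod (f z))) has_derivative (\<lambda>h. Re (f' / f z * h))) (at z)"
proof -
  \<comment> \<open>Division by \<open>f z\<close> moves the value to 1, where the principal branch
    \<open>Ln\<close> is differentiable; \<open>ln |f|\<close> changes only by a constant.\<close>
  have q: "((\<lambda>w. f w / f z) has_field_derivative f' / f z) (at z)"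
    using f by (rule DERIV_cdivide)
  have "((\<lambda>w. Ln (f w / f z)) has_field_derivative f' / f z) (at z)"
    using DERIV_chain2[OF has_field_derivative_Ln q] nz by simp
  then have "((\<lambda>w. Ln (f w / f z)) has_derivative (\<lambda>h. f' / f z * h)) (at z)"
    by (simp only: has_field_derivative_def)
  from has_derivative_add[OF has_derivative_const[of "ln (cmod (f z))"] bounded_linear.has_derivative[OF bounded_linear_Re this]]
  have d: "((\<lambda>w. ln (cmod (f z)) + Re (Ln (f w / f z))) has_derivative (\<lambda>h. Re (f' / f z * h))) (at z)"
    by (simp only: add_0)
  have "isCont f z" using f DERIV_isCont by blast
  then have "eventually (\<lambda>w. f w \<noteq> 0) (nhds z)"
    using nz by (simp add: isCont_def tendsto_imp_eventually_ne eventually_nhds_conv_at)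
  then obtain S where S: "open S" "z \<in> S" "\<And>w. w \<in> S \<Longrightarrow> f w \<noteq> 0" by (auto simp: eventually_nhds)
  show ?thesis
    by (rule has_derivative_transform_within_open[OF d S(1,2)])
       (use S nz in \<open>simp add: norm_divide ln_div\<close>)
qed

lemma hol_grad_ln_poly:
  assumes "\<And>z. z \<in> S \<Longrightarrow> poly p z \<noteq> 0"
  shows "hol_grad (\<lambda>z. ln (cmod (poly p z))) S"
  unfolding hol_grad_def
proof (intro exI conjI ballI)
  show "(\<lambda>z. poly (pderiv p) z / poly p z) holomorphic_on S"
    using assms by (intro holomorphic_intros) auto
  show "((\<lambda>z. ln (cmod (poly p z))) has_derivative (\<lambda>h. Re (poly (pderiv p) z / poly p z * h))) (at z)" if "z \<in> S" for z
    by (rule has_derivative_ln_cmod[OF poly_DERIV assms[OF that]])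
qed

text \<open>A uniform quadratic error bound under the integral sign thus yields the derivative of
  the integral directly.\<close>

lemma has_derivative_quadratic_remainder:
  fixes f :: "'a::real_normed_vector \<Rightarrow> 'b::real_normed_vector"
  assumes L: "bounded_linear L" and r: "r > 0"
    and rem: "\<And>h. norm h < r \<Longrightarrow> norm (f (z + h) - f z - L h) \<le> C * (norm h)\<^sup>2"
  shows "(f has_derivative L) (at z)"
proof (rule has_derivativeI_sandwich[OF r L])
  fix y assume y: "y \<noteq> z" "dist y z < r"
  then have "norm (f (z + (y - z)) - f z - L (y - z)) \<le> C * (norm (y - z))\<^sup>2"
    by (intro rem) (simp add: dist_norm)
  then show "norm (f y - f z - L (y - z)) / norm (y - z) \<le> C * norm (y - z)"
    using y by (simp add: divide_simps power2_eq_square)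
next
  show "((\<lambda>y. C * norm (y - z)) \<longlongrightarrow> 0) (at z)"
    by (auto intro!: tendsto_eq_intros)
qed

text \<open>The coefficients \<open>a = - t\<close>, \<open>b = 1\<close> give the logarithmic potential, while \<open>a = 1\<close>, \<open>b = - t\<close>
  give its expression in the coordinate \<open>1 / z\<close> at infinity.\<close>

lemma hol_grad_integral_ln:
  fixes a b :: "'a \<Rightarrow> complex"
  assumes M: "prob_space M" and ab [measurable]: "a \<in> borel_measurable M" "b \<in> borel_measurable M"
    and B: "AE t in M. cmod (a t) \<le> B" "AE t in M. cmod (b t) \<le> B" and S: "open S"
    and low: "\<And>z. z \<in> S \<Longrightarrow> \<exists>\<delta>>0. AE t in M. \<delta> \<le> cmod (a t + b t * z)"
  shows "hol_grad (\<lambda>z. \<integral>t. ln (cmod (a t + b t * z)) \<partial>M) S"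
    "\<And>z. z \<in> S \<Longrightarrow> integrable M (\<lambda>t. ln (cmod (a t + b t * z)))"
proof -
  interpret prob_space M by fact
  have "AE t in M. B \<ge> 0" using B(1)
  proof eventually_elim
    case (elim t)
    then show ?case using norm_ge_zero[of "a t"] by linarith
  qed
  then have B0: "B \<ge> 0" by simp
  show intL: "integrable M (\<lambda>t. ln (cmod (a t + b t * z)))" if z: "z \<in> S" for z
  proof -
    obtain \<delta> where \<delta>: "\<delta> > 0" "AE t in M. \<delta> \<le> cmod (a t + b t * z)" using low[OF z] by blast
    show ?thesis
    proof (rule integrable_const_bound)
      show "AE t in M. norm (ln (cmod (a t + b t * z))) \<le> max \<bar>ln \<delta>\<bar> \<bar>ln (B + B * cmod z)\<bar>"
        using \<delta>(2) B
      proof eventually_elim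
        case (elim t)
        have "cmod (a t + b t * z) \<le> cmod (a t) + cmod (b t) * cmod z"
          by (metis norm_mult norm_triangle_ineq)
        also have "\<dots> \<le> B + B * cmod z" using elim by (intro add_mono mult_right_mono) auto
        finally have u: "cmod (a t + b t * z) \<le> B + B * cmod z" .
        have "ln \<delta> \<le> ln (cmod (a t + b t * z))" using elim \<delta> by (subst ln_le_cancel_iff) auto
        moreover have "ln (cmod (a t + b t * z)) \<le> ln (B + B * cmod z)" using elim \<delta> u by (subst ln_le_cancel_iff) auto
        ultimately show ?case by auto
      qed
    qed measurable
  qed
  have intR: "integrable M (\<lambda>t. (b t / (a t + b t * z)) ^ k)" if z: "z \<in> S" for z k
  proof -
    obtain \<delta> where \<delta>: "\<delta> > 0" "AE t in M. \<delta> \<le> cmod (a t + b t * z)" using low[OF z] by blast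
    show ?thesis
    proof (rule integrable_const_bound)
      show "AE t in M. norm ((b t / (a t + b t * z)) ^ k) \<le> (B / \<delta>) ^ k"
        using \<delta>(2) B(2)
      proof eventually_elim
        case (elim t)
        then show ?case using \<delta>(1) B0 by (auto simp: norm_power norm_divide intro!: power_mono frac_le)
      qed
    qed measurable
  qed
  have norm_le: "norm (\<integral>t. g t \<partial>M) \<le> C"
    if "integrable M g" "AE t in M. norm (g t) \<le> C" for g :: "'a \<Rightarrow> 'b :: {banach, second_countable_topology}" and C
  proof -
    have "norm (\<integral>t. g t \<partial>M) \<le> (\<integral>t. norm (g t) \<partial>M)" by (rule integral_norm_bound)
    also have "\<dots> \<le> (\<integral>t. C \<partial>M)" using that by (intro integral_mono_AE) auto
    finally show ?thesis by (simp add: prob_space)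
  qed
  define f where "f z = (\<integral>t. b t / (a t + b t * z) \<partial>M)" for z
  define f' where "f' z = (\<integral>t. - ((b t / (a t + b t * z)) ^ 2) \<partial>M)" for z
  \<comment> \<open>In this radius the relative increment
    \<open>W = b t * h / (a t + b t * z)\<close> is at most \<open>1 / 2\<close> for almost all
    \<open>t\<close>; the error terms below are expressed in \<open>W\<close>.\<close>
  have local: "\<exists>r>0. ball z r \<subseteq> S \<and> (\<exists>\<delta>>0. (AE t in M. \<delta> \<le> cmod (a t + b t * z)) \<and>
      (\<forall>h. cmod h < r \<longrightarrow> B * cmod h / \<delta> \<le> 1 / 2))" if z: "z \<in> S" for z
  proof -
    obtain \<delta> where \<delta>: "\<delta> > 0" "AE t in M. \<delta> \<le> cmod (a t + b t * z)" using low[OF z] by blast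
    obtain r where r: "r > 0" "ball z r \<subseteq> S" using S z by (meson open_contains_ball)
    \<comment> \<open>\<open>B + 1\<close> in place of \<open>B\<close> avoids a division by
      0.\<close>
    define r' where "r' = min r (\<delta> / (2 * (B + 1)))"
    have r': "r' > 0" "ball z r' \<subseteq> S" using r \<delta> B0 by (auto simp: r'_def)
    have "B * cmod h / \<delta> \<le> 1 / 2" if "cmod h < r'" for h
    proof -
      have "cmod h \<le> \<delta> / (2 * (B + 1))" using that by (simp add: r'_def)
      then have "(B + 1) * cmod h \<le> \<delta> / 2" using B0 by (simp add: field_simps)
      moreover have "B * cmod h \<le> (B + 1) * cmod h" by (intro mult_right_mono) auto
      ultimately have "B * cmod h \<le> \<delta> / 2" by linarith
      then show ?thesis using \<delta>(1) by (simp add: field_simps)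
    qed
    then show ?thesis using r' \<delta> by blast
  qed
  have w: "cmod (b t * h / (a t + b t * z)) \<le> B * cmod h / \<delta>"
    if "\<delta> \<le> cmod (a t + b t * z)" "cmod (b t) \<le> B" "\<delta> > 0" for t h z \<delta>
    unfolding norm_mult norm_divide using that B0 by (intro frac_le mult_right_mono mult_nonneg_nonneg) auto
  have der_u: "((\<lambda>z. \<integral>t. ln (cmod (a t + b t * z)) \<partial>M) has_derivative (\<lambda>h. Re (f z * h))) (at z)" if z: "z \<in> S" for z
  proof -
    obtain r \<delta> where r: "r > 0" "ball z r \<subseteq> S" and \<delta>: "\<delta> > 0" "AE t in M. \<delta> \<le> cmod (a t + b t * z)"
      and small: "\<And>h. cmod h < r \<Longrightarrow> B * cmod h / \<delta> \<le> 1 / 2" using local[OF z] by blast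
    show ?thesis
    \<comment> \<open>The constant comes from
      \<open>|Ln (1 + W) - W| <= |W|^2 / (1 - |W|) <= 2 |W|^2\<close>.\<close>
    proof (rule has_derivative_quadratic_remainder[OF _ r(1), where C = "2 * (B / \<delta>)\<^sup>2"])
      show "bounded_linear (\<lambda>h. Re (f z * h))"
        by (intro bounded_linear_compose[OF bounded_linear_Re] bounded_linear_mult_right)
      fix h assume h: "cmod h < r"
      have zh: "z + h \<in> S" using h r by (auto simp: subset_eq dist_norm)
      have i3: "integrable M (\<lambda>t. Re (b t / (a t + b t * z) * h))"
        using intR[OF z, of 1] by (intro integrable_Re integrable_mult_left) simp
      have "Re (f z * h) = Re (\<integral>t. b t / (a t + b t * z) * h \<partial>M)"
        unfolding f_def by (simp only: integral_mult_left_zero)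
      also have "\<dots> = (\<integral>t. Re (b t / (a t + b t * z) * h) \<partial>M)"
        using intR[OF z, of 1] by (intro integral_Re[symmetric] integrable_mult_left) simp
      finally have Re_f: "Re (f z * h) = (\<integral>t. Re (b t / (a t + b t * z) * h) \<partial>M)" .
      have "(\<integral>t. ln (cmod (a t + b t * (z + h))) \<partial>M) - (\<integral>t. ln (cmod (a t + b t * z)) \<partial>M) - Re (f z * h) =
        (\<integral>t. ln (cmod (a t + b t * (z + h))) - ln (cmod (a t + b t * z)) - Re (b t / (a t + b t * z) * h) \<partial>M)"
        unfolding Re_f using intL[OF zh] intL[OF z] i3 by simp
      also have "norm \<dots> \<le> 2 * (B / \<delta>)\<^sup>2 * (norm h)\<^sup>2"
      proof (rule norm_le)
        show "AE t in M. norm (ln (cmod (a t + b t * (z + h))) - ln (cmod (a t + b t * z)) - Re (b t / (a t + b t * z) * h)) \<le> 2 * (B / \<delta>)\<^sup>2 * (norm h)\<^sup>2"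
          using \<delta>(2) B(2)
        proof eventually_elim
          case (elim t)
          define W where "W = b t * h / (a t + b t * z)"
          have W: "cmod W \<le> B * cmod h / \<delta>" "cmod W \<le> 1 / 2"
            using w[OF elim \<delta>(1), of h] order_trans[OF w[OF elim \<delta>(1)] small[OF h]] by (simp_all only: W_def)
          have nz: "a t + b t * z \<noteq> 0" using elim \<delta> by auto
          have W1: "1 + W \<noteq> 0" using W(2) norm_triangle_ineq4[of "1 + W" W] by auto
          have "a t + b t * (z + h) = (a t + b t * z) * (1 + W)"
            using nz by (simp add: W_def field_simps)
          then have "ln (cmod (a t + b t * (z + h))) = ln (cmod (a t + b t * z)) + ln (cmod (1 + W))"
            using nz W1 by (simp add: norm_mult ln_mult)
          then have "norm (ln (cmod (a t + b t * (z + h))) - ln (cmod (a t + b t * z)) - Re (b t / (a t + b t * z) * h)) = \<bar>Re (Ln (1 + W) - W)\<bar>"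
            using W1 by (simp add: W_def)
          also have "\<dots> \<le> cmod (Ln (1 + W) - W)" by (rule abs_Re_le_cmod)
          also have "\<dots> \<le> (cmod W)\<^sup>2 / (1 - cmod W)" using W by (intro Ln_approx_linear) auto
          also have "\<dots> \<le> (cmod W)\<^sup>2 / (1 / 2)" using W by (intro divide_left_mono) auto
          also have "\<dots> \<le> (B * cmod h / \<delta>)\<^sup>2 / (1 / 2)" using W by (intro divide_right_mono power_mono) auto
          finally show ?case by (simp add: power_mult_distrib power_divide mult_ac)
        qed
        show "integrable M (\<lambda>t. ln (cmod (a t + b t * (z + h))) - ln (cmod (a t + b t * z)) - Re (b t / (a t + b t * z) * h))"
          by (intro Bochner_Integration.integrable_diff intL zh z i3)
      qed
      finally show "norm ((\<integral>t. ln (cmod (a t + b t * (z + h))) \<partial>M) - (\<integral>t. ln (cmod (a t + b t * z)) \<partial>M) - Re (f z * h)) \<le> 2 * (B / \<delta>)\<^sup>2 * (norm h)\<^sup>2" .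
    qed
  qed
  have der_f: "(f has_field_derivative f' z) (at z)" if z: "z \<in> S" for z
    unfolding has_field_derivative_def
  proof -
    obtain r \<delta> where r: "r > 0" "ball z r \<subseteq> S" and \<delta>: "\<delta> > 0" "AE t in M. \<delta> \<le> cmod (a t + b t * z)"
      and small: "\<And>h. cmod h < r \<Longrightarrow> B * cmod h / \<delta> \<le> 1 / 2" using local[OF z] by blast
    show "(f has_derivative (*) (f' z)) (at z)"
    \<comment> \<open>Here \<open>1 / (1 + W) - 1 + W = W^2 / (1 + W)\<close>, and
      \<open>|1 + W| >= 1 / 2\<close> gives the factor 2.\<close>
    proof (rule has_derivative_quadratic_remainder[OF bounded_linear_mult_right r(1), where C = "B / \<delta> * (2 * (B / \<delta>)\<^sup>2)"])
      fix h assume h: "cmod h < r"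
      have zh: "z + h \<in> S" using h r by (auto simp: subset_eq dist_norm)
      have i1: "integrable M (\<lambda>t. b t / (a t + b t * z))" if "z \<in> S" for z using intR[OF that, of 1] by simp
      have i2: "integrable M (\<lambda>t. - ((b t / (a t + b t * z)) ^ 2) * h)"
        using intR[OF z, of 2] by (intro integrable_mult_left integrable_minus)
      have "f (z + h) - f z - f' z * h = 
        (\<integral>t. b t / (a t + b t * (z + h)) - b t / (a t + b t * z) - (- ((b t / (a t + b t * z)) ^ 2) * h) \<partial>M)"
        using i1[OF zh] i1[OF z] i2 unfolding f_def f'_def by (simp add: integral_mult_left_zero del: power_divide)
      also have "norm \<dots> \<le> B / \<delta> * (2 * (B / \<delta>)\<^sup>2) * (norm h)\<^sup>2"
      proof (rule norm_le)
        show "AE t in M. norm (b t / (a t + b t * (z + h)) - b t / (a t + b t * z) - (- ((b t / (a t + b t * z)) ^ 2) * h)) \<le> B / \<delta> * (2 * (B / \<delta>)\<^sup>2) * (norm h)\<^sup>2"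
          using \<delta>(2) B(2)
        proof eventually_elim
          case (elim t)
          define A where "A = a t + b t * z"
          define W where "W = b t * h / A"
          have W: "cmod W \<le> B * cmod h / \<delta>" "cmod W \<le> 1 / 2"
            using w[OF elim \<delta>(1), of h] order_trans[OF w[OF elim \<delta>(1)] small[OF h]] by (simp_all only: W_def A_def)
          have nz: "A \<noteq> 0" using elim \<delta> by (auto simp: A_def)
          have W2: "cmod (1 + W) \<ge> 1 / 2" using W(2) norm_triangle_ineq4[of "1 + W" W] by simp
          then have W1: "1 + W \<noteq> 0" by auto
          have e: "a t + b t * (z + h) = A * (1 + W)"
            using nz by (simp add: W_def A_def field_simps)
          have "b t / (A * (1 + W)) - b t / A - (- ((b t / A) ^ 2) * h) = b t / A * (1 / (1 + W) - 1 + W)"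
          proof -
            have "b t / (A * (1 + W)) = b t / A * (1 / (1 + W))" by simp
            moreover have "(b t / A) ^ 2 * h = b t / A * W" by (simp add: W_def power2_eq_square)
            ultimately show ?thesis by (simp only: algebra_simps) simp
          qed
          also have "1 / (1 + W) - 1 + W = W\<^sup>2 / (1 + W)"
            using W1 by (simp add: field_simps power2_eq_square)
          finally have "norm (b t / (a t + b t * (z + h)) - b t / (a t + b t * z) - (- ((b t / (a t + b t * z)) ^ 2) * h)) =
             cmod (b t) / cmod A * ((cmod W)\<^sup>2 / cmod (1 + W))" unfolding e A_def[symmetric] by (simp add: norm_mult norm_divide norm_power)
          also have "\<dots> \<le> B / \<delta> * ((B * cmod h / \<delta>)\<^sup>2 / (1 / 2))"
            using elim \<delta>(1) W W2 B0 by (intro mult_mono frac_le power_mono) (auto simp: A_def)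
          finally show ?case by (simp add: power_mult_distrib power_divide mult_ac)
        qed
        show "integrable M (\<lambda>t. b t / (a t + b t * (z + h)) - b t / (a t + b t * z) - (- ((b t / (a t + b t * z)) ^ 2) * h))"
          by (intro Bochner_Integration.integrable_diff i1 zh z i2)
      qed
      finally show "norm (f (z + h) - f z - f' z * h) \<le> B / \<delta> * (2 * (B / \<delta>)\<^sup>2) * (norm h)\<^sup>2" .
    qed
  qed
  have f_hol: "f holomorphic_on S"
    using der_f by (metis holomorphic_onI field_differentiable_def field_differentiable_at_within)
  show "hol_grad (\<lambda>z. \<integral>t. ln (cmod (a t + b t * z)) \<partial>M) S"
    unfolding hol_grad_def
    using der_u f_hol by blast
qed

section \<open>Extremal polynomials\<close>

lemma poly_interpolation:
  fixes X :: "'a::field set"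
  assumes "finite X" "card X \<le> n" "n > 0"
  shows "\<exists>q. degree q < n \<and> (\<forall>x\<in>X. poly q x = v x)"
  using assms
proof (induction X arbitrary: n v rule: finite_induct)
  case empty
  then show ?case by (intro exI[of _ 0]) simp
next
  case (insert x X)
  show ?case
  proof (cases "X = {}")
    case True
    then show ?thesis using insert.prems by (intro exI[of _ "[:v x:]"]) simp
  next
    case False
    then have "card X > 0" using insert.hyps by (simp add: card_gt_0_iff)
    then have "card X \<le> n - 1" "n - 1 > 0" using insert.prems insert.hyps by auto
    then obtain q where q: "degree q < n - 1" "\<And>y. y \<in> X \<Longrightarrow> poly q y = (v y - v x) / (y - x)"
      using insert.IH[of "n - 1" "\<lambda>y. (v y - v x) / (y - x)"] by auto
    have "degree ([:v x:] + [:- x, 1:] * q) < n"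
    proof -
      have "degree ([:- x, 1:] * q) \<le> 1 + degree q" using degree_mult_le[of "[:- x, 1:]" q] by simp
      then show ?thesis using q(1) by (intro degree_add_less) auto
    qed
    moreover have "poly ([:v x:] + [:- x, 1:] * q) y = v y" if "y \<in> insert x X" for y
    proof (cases "y = x")
      case False
      then have "(y - x) * poly q y = v y - v x" using q(2)[of y] that by simp
      then show ?thesis by (simp add: algebra_simps)
    qed simp
    ultimately show ?thesis by blast
  qed
qed

text \<open>Bolzano-Weierstrass for the coefficients, given bounds at \<open>n + 1\<close> points
  only: division by \<open>z - x\<close> lowers the degree and keeps the quotients bounded at the
  remaining points.\<close>

lemma poly_subsequence:
  fixes p :: "nat \<Rightarrow> complex poly"
  assumes "finite X" "card X = Suc n" "\<And>k. degree (p k) \<le> n"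
    "\<And>x. x \<in> X \<Longrightarrow> bounded (range (\<lambda>k. poly (p k) x))"
  shows "\<exists>r l. strict_mono (r :: nat \<Rightarrow> nat) \<and> degree l \<le> n \<and> (\<forall>i. (\<lambda>k. coeff (p (r k)) i) \<longlonglongrightarrow> coeff l i)"
  using assms
proof (induction n arbitrary: p X)
  case 0
  then obtain x where x: "X = {x}" by (metis card_1_singletonE One_nat_def)
  have "\<exists>c. p k = [:c:]" for k using 0(3)[of k] degree_eq_zeroE[of "p k"] by blast
  then obtain d where d: "\<And>k. p k = [:d k:]" by metis
  have px: "poly (p k) x = coeff (p k) 0" for k by (simp add: d)
  have "bounded (range (\<lambda>k. coeff (p k) 0))" using 0(4)[of x] x px by simp
  then obtain c r where r: "strict_mono (r :: nat \<Rightarrow> nat)" and c: "((\<lambda>k. coeff (p k) 0) \<circ> r) \<longlonglongrightarrow> c"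
    using bounded_imp_convergent_subsequence by blast
  have "(\<lambda>k. coeff (p (r k)) i) \<longlonglongrightarrow> coeff [:c:] i" for i
  proof (cases i)
    case 0
    then show ?thesis using c by (simp add: comp_def)
  next
    case (Suc j)
    then have "coeff (p k) i = 0" for k by (simp add: d)
    then show ?thesis using Suc by simp
  qed
  then show ?case using r by (intro exI[of _ r] exI[of _ "[:c:]"]) simp
next
  case (Suc n)
  obtain x Y where x: "X = insert x Y" "x \<notin> Y" "card Y = Suc n"
    using Suc.prems(2) card_Suc_eq[of X "Suc n"] by blast
  have fY: "finite Y" using Suc.prems(1) x by simp
  define q where "q k = synthetic_div (p k) x" for k
  have pq: "p k = [:poly (p k) x:] + [:- x, 1:] * q k" for k
    using synthetic_div_correct'[of x "p k"] by (simp add: q_def add.commute)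
  have "\<exists>r l. strict_mono (r :: nat \<Rightarrow> nat) \<and> degree l \<le> n \<and> (\<forall>i. (\<lambda>k. coeff (q (r k)) i) \<longlonglongrightarrow> coeff l i)"
  proof (rule Suc.IH[OF fY x(3)])
    show "degree (q k) \<le> n" for k using Suc.prems(3)[of k] by (simp add: q_def degree_synthetic_div)
    fix y assume y: "y \<in> Y"
    obtain B1 B2 where B: "\<And>k. cmod (poly (p k) x) \<le> B1" "\<And>k. cmod (poly (p k) y) \<le> B2"
      using Suc.prems(4)[of x] Suc.prems(4)[of y] x y by (auto simp: bounded_iff)
    have yx: "y \<noteq> x" using x y by auto
    have "cmod (poly (q k) y) \<le> (B1 + B2) / cmod (y - x)" for k
    proof -
      have "poly (p k) y = poly (p k) x + (y - x) * poly (q k) y"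
        by (subst pq) (simp add: algebra_simps)
      then have "poly (q k) y = (poly (p k) y - poly (p k) x) / (y - x)" using yx by (simp add: field_simps)
      moreover have "cmod (poly (p k) y - poly (p k) x) \<le> B1 + B2"
        using norm_triangle_ineq4[of "poly (p k) y" "poly (p k) x"] B[of k] by linarith
      ultimately show ?thesis by (simp add: norm_divide divide_right_mono)
    qed
    then show "bounded (range (\<lambda>k. poly (q k) y))" unfolding bounded_iff by blast
  qed
  then obtain r l where r: "strict_mono (r :: nat \<Rightarrow> nat)" "degree l \<le> n" "\<And>i. (\<lambda>k. coeff (q (r k)) i) \<longlonglongrightarrow> coeff l i"
    by blast
  have "bounded (range (\<lambda>k. poly (p (r k)) x))"
    using Suc.prems(4)[of x] x by (auto intro: bounded_subset)
  then obtain c s where s: "strict_mono (s :: nat \<Rightarrow> nat)" and c: "((\<lambda>k. poly (p (r k)) x) \<circ> s) \<longlonglongrightarrow> c"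
    using bounded_imp_convergent_subsequence by blast
  have "(\<lambda>k. coeff (p (r (s k))) i) \<longlonglongrightarrow> coeff ([:c:] + [:- x, 1:] * l) i" for i
  proof -
    have l: "(\<lambda>k. coeff (q (r (s k))) i) \<longlonglongrightarrow> coeff l i" for i
      using LIMSEQ_subseq_LIMSEQ[OF r(3) s] by (simp add: comp_def)
    have "coeff (p k) i = coeff [:poly (p k) x:] i + (- x * coeff (q k) i + (case i of 0 \<Rightarrow> 0 | Suc j \<Rightarrow> coeff (q k) j))" for k
      by (subst pq) (simp add: coeff_pCons split: nat.split)
    moreover have "(\<lambda>k. coeff [:poly (p (r (s k))) x:] i) \<longlonglongrightarrow> coeff [:c:] i"
      using c by (cases i) (auto simp: comp_def)
    moreover have "(\<lambda>k. case i of 0 \<Rightarrow> 0 | Suc j \<Rightarrow> coeff (q (r (s k))) j) \<longlonglongrightarrow> (case i of 0 \<Rightarrow> 0 | Suc j \<Rightarrow> coeff l j)"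
      using l by (cases i) auto
    ultimately have "(\<lambda>k. coeff (p (r (s k))) i) \<longlonglongrightarrow> coeff [:c:] i + (- x * coeff l i + (case i of 0 \<Rightarrow> 0 | Suc j \<Rightarrow> coeff l j))"
      using l[of i] by (auto intro!: tendsto_intros)
    then show ?thesis by (simp add: coeff_pCons split: nat.split_asm)
  qed
  moreover have "degree ([:c:] + [:- x, 1:] * l) \<le> Suc n"
    using degree_mult_le[of "[:- x, 1:]" l] r(2) by (intro degree_add_le) auto
  moreover have "strict_mono (\<lambda>k. r (s k))" using strict_mono_o[OF r(1) s] by (simp add: comp_def)
  ultimately show ?case by blast
qed

lemma poly_coeff_tendsto:
  fixes p :: "nat \<Rightarrow> complex poly"
  assumes "\<And>k. degree (p k) \<le> n" "degree l \<le> n" "\<And>i. (\<lambda>k. coeff (p k) i) \<longlonglongrightarrow> coeff l i"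
  shows "(\<lambda>k. poly (p k) x) \<longlonglongrightarrow> poly l x"
proof -
  have "poly q x = (\<Sum>i\<le>n. coeff q i * x ^ i)" if "degree q \<le> n" for q
    unfolding poly_altdef using that by (intro sum.mono_neutral_left) (auto simp: coeff_eq_0)
  then show ?thesis using assms by (auto intro!: tendsto_intros)
qed

section \<open>Existence and uniqueness of minimal polynomials\<close>

lemma sup_norm_upper:
  assumes "compact E" "z \<in> E" shows "cmod (poly p z) \<le> sup_norm E p"
proof -
  have "compact ((\<lambda>z. cmod (poly p z)) ` E)" by (intro compact_continuous_image continuous_intros assms)
  then have "bdd_above ((\<lambda>z. cmod (poly p z)) ` E)" by (intro bounded_imp_bdd_above compact_imp_bounded)
  then show ?thesis unfolding sup_norm_def using assms(2) by (intro cSUP_upper)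
qed

lemma sup_norm_least: "E \<noteq> {} \<Longrightarrow> (\<And>z. z \<in> E \<Longrightarrow> cmod (poly p z) \<le> m) \<Longrightarrow> sup_norm E p \<le> m"
  unfolding sup_norm_def by (intro cSUP_least)

lemma sup_norm_nonneg: "compact E \<Longrightarrow> E \<noteq> {} \<Longrightarrow> sup_norm E p \<ge> 0"
  using sup_norm_upper norm_ge_zero order_trans by (metis ex_in_conv)

lemma sup_norm_pos:
  assumes "compact E" "infinite E" "p \<noteq> 0" shows "sup_norm E p > 0"
proof -
  have "\<not> E \<subseteq> {z. poly p z = 0}" using assms poly_roots_finite finite_subset by blast
  then obtain z where "z \<in> E" "poly p z \<noteq> 0" by blast
  then show ?thesis using sup_norm_upper[OF assms(1), of z p] by (smt (verit) zero_less_norm_iff)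
qed

text \<open>Strict convexity of the disc, from the parallelogram law.\<close>

lemma midpoint_norm_eq:
  fixes a b :: complex
  assumes "cmod a \<le> m" "cmod b \<le> m" "cmod ((a + b) / 2) = m" shows "a = b"
proof -
  have "(cmod (a + b))\<^sup>2 + (cmod (a - b))\<^sup>2 = 2 * (cmod a)\<^sup>2 + 2 * (cmod b)\<^sup>2"
    unfolding cmod_power2 by (simp add: power2_eq_square algebra_simps)
  moreover have "(cmod a)\<^sup>2 \<le> m\<^sup>2" "(cmod b)\<^sup>2 \<le> m\<^sup>2" using assms by (auto intro: power_mono)
  moreover have "(cmod (a + b))\<^sup>2 = 4 * m\<^sup>2" using assms(3) by (simp add: norm_divide power2_eq_square)
  ultimately have "(cmod (a - b))\<^sup>2 \<le> 0" by linarith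
  then show ?thesis by simp
qed

text \<open>The competitors \<open>p + w q\<close> with \<open>degree q < n\<close> cover both extremal problems:
  \<open>w = 1\<close> for monic polynomials of degree \<open>n\<close> and \<open>w = z - a\<close> for the normalization at \<open>a\<close>.\<close>

lemma sup_norm_decrease:
  fixes p w :: "complex poly"
  assumes E: "compact E" "E \<noteq> {}" and w: "\<And>z. z \<in> E \<Longrightarrow> poly w z \<noteq> 0"
    and m: "sup_norm E p = m" "m > 0"
    and X: "finite {z\<in>E. cmod (poly p z) = m}" "card {z\<in>E. cmod (poly p z) = m} \<le> n" "n > 0"
  obtains q where "degree q < n" "sup_norm E (p + w * q) < m"
proof -
  let ?X = "{z\<in>E. cmod (poly p z) = m}"
  \<comment> \<open>At the extremal points \<open>w q\<close> equals \<open>p\<close>, so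
    subtracting a small multiple of \<open>w q\<close> lowers the modulus there.\<close>
  obtain q where q: "degree q < n" "\<And>z. z \<in> ?X \<Longrightarrow> poly q z = poly p z / poly w z"
    using poly_interpolation[OF X, of "\<lambda>z. poly p z / poly w z"] by blast
  define g where "g z = poly w z * poly q z" for z
  have gX: "g z = poly p z" if "z \<in> ?X" for z using q(2)[OF that] w that by (simp add: g_def)
  have le: "cmod (poly p z) \<le> m" if "z \<in> E" for z using sup_norm_upper[OF E(1) that, of p] m by simp
  define h where "h z = Re (cnj (poly p z) * g z)" for z
  have cont: "continuous_on E h" "continuous_on E (\<lambda>z. cmod (g z))"
    unfolding h_def g_def by (intro continuous_intros)+
  obtain K0 where K0: "\<And>z. z \<in> E \<Longrightarrow> cmod (g z) \<le> K0"
    using compact_imp_bounded[OF compact_continuous_image[OF cont(2) E(1)]] by (auto simp: bounded_iff)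
  define K where "K = max K0 1"
  have K: "K > 0" "\<And>z. z \<in> E \<Longrightarrow> cmod (g z) \<le> K" using K0 by (auto simp: K_def max_def) (meson order_trans less_imp_le not_less)
  \<comment> \<open>The part of \<open>E\<close> where the correction may not help. It is compact
    without extremal points, so \<open>|p|\<close> stays below some \<open>m' < m\<close> on
    it.\<close>
  define A where "A = E \<inter> {z\<in>E. h z \<le> m\<^sup>2 / 2}"
  have "compact A"
  proof -
    have "closed {z\<in>E. h z \<le> m\<^sup>2 / 2}"
      using continuous_closed_preimage[OF cont(1) compact_imp_closed[OF E(1)], of "{..m\<^sup>2 / 2}"]
      by (simp add: vimage_def Int_def conj_commute)
    then show ?thesis unfolding A_def using E(1) by (intro compact_Int_closed)
  qed
  have Alt: "cmod (poly p z) < m" if "z \<in> A" for z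
  proof (rule ccontr)
    assume "\<not> cmod (poly p z) < m"
    then have zX: "z \<in> ?X" using le[of z] that by (auto simp: A_def)
    then have "h z = (cmod (poly p z))\<^sup>2" unfolding h_def gX[OF zX] cmod_power2 by (simp add: power2_eq_square)
    then show False using that zX m(2) by (auto simp: A_def power2_eq_square)
  qed
  obtain m' where m': "m' < m" "\<And>z. z \<in> A \<Longrightarrow> cmod (poly p z) \<le> m'" "m' \<ge> 0"
  proof (cases "A = {}")
    case True
    then show ?thesis using that[of 0] m by auto
  next
    case False
    obtain a where a: "a \<in> A" "\<And>z. z \<in> A \<Longrightarrow> cmod (poly p z) \<le> cmod (poly p a)"
    proof -
      have "continuous_on A (\<lambda>z. cmod (poly p z))" by (intro continuous_intros)
      then show ?thesis using continuous_attains_sup[OF \<open>compact A\<close> False, of "\<lambda>z. cmod (poly p z)"] that by blast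
    qed
    then show ?thesis using that[of "cmod (poly p a)"] Alt by auto
  qed
  \<comment> \<open>The first bound keeps the modulus below \<open>(m + m') / 2\<close> on
    \<open>A\<close>; the second makes the quadratic term off \<open>A\<close> at most half of the
    linear gain.\<close>
  define \<epsilon> where "\<epsilon> = min ((m - m') / (2 * K)) (m\<^sup>2 / (2 * K\<^sup>2))"
  have \<epsilon>: "\<epsilon> > 0" "\<epsilon> * K \<le> (m - m') / 2" "\<epsilon> * K\<^sup>2 \<le> m\<^sup>2 / 2"
  proof -
    show "\<epsilon> > 0" using m' m K by (simp add: \<epsilon>_def)
    have "\<epsilon> * K \<le> (m - m') / (2 * K) * K" using K by (intro mult_right_mono) (auto simp: \<epsilon>_def)
    then show "\<epsilon> * K \<le> (m - m') / 2" using K by simp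
    have "\<epsilon> * K\<^sup>2 \<le> m\<^sup>2 / (2 * K\<^sup>2) * K\<^sup>2" using K by (intro mult_right_mono) (auto simp: \<epsilon>_def)
    then show "\<epsilon> * K\<^sup>2 \<le> m\<^sup>2 / 2" using K by simp
  qed
  define b where "b = max ((m + m') / 2) (sqrt (m\<^sup>2 - \<epsilon> * (m\<^sup>2 / 2)))"
  have "m\<^sup>2 - \<epsilon> * (m\<^sup>2 / 2) < m\<^sup>2" using \<epsilon> m by simp
  then have "sqrt (m\<^sup>2 - \<epsilon> * (m\<^sup>2 / 2)) < sqrt (m\<^sup>2)" by (rule real_sqrt_less_mono)
  then have "sqrt (m\<^sup>2 - \<epsilon> * (m\<^sup>2 / 2)) < m" using m by simp
  then have bm: "b < m" using m' by (simp add: b_def)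
  have bound: "cmod (poly p z - of_real \<epsilon> * g z) \<le> b" if z: "z \<in> E" for z
  proof (cases "z \<in> A")
    case True
    have "cmod (poly p z - of_real \<epsilon> * g z) \<le> cmod (poly p z) + \<epsilon> * cmod (g z)"
      using norm_triangle_ineq4[of "poly p z" "of_real \<epsilon> * g z"] \<epsilon>(1) by (simp add: norm_mult)
    also have "\<dots> \<le> m' + \<epsilon> * K" using m'(2)[OF True] K(2)[OF z] \<epsilon>(1) by (intro add_mono mult_left_mono) auto
    also have "\<dots> \<le> (m + m') / 2" using \<epsilon>(2) by (simp add: field_simps)
    also have "\<dots> \<le> b" by (simp add: b_def)
    finally show ?thesis .
  next
    case False
    then have hz: "h z > m\<^sup>2 / 2" using z by (auto simp: A_def)
    have "(cmod (poly p z - of_real \<epsilon> * g z))\<^sup>2 = (cmod (poly p z))\<^sup>2 - 2 * \<epsilon> * h z + \<epsilon>\<^sup>2 * (cmod (g z))\<^sup>2"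
      unfolding cmod_power2 h_def by (simp add: power2_eq_square algebra_simps)
    also have "\<dots> \<le> m\<^sup>2 - 2 * \<epsilon> * (m\<^sup>2 / 2) + \<epsilon>\<^sup>2 * K\<^sup>2"
      using le[OF z] K(2)[OF z] \<epsilon>(1) hz by (intro add_mono diff_mono mult_left_mono power_mono) auto
    also have "\<dots> = m\<^sup>2 - \<epsilon> * m\<^sup>2 + \<epsilon> * (\<epsilon> * K\<^sup>2)" by (simp add: power2_eq_square algebra_simps)
    also have "\<dots> \<le> m\<^sup>2 - \<epsilon> * m\<^sup>2 + \<epsilon> * (m\<^sup>2 / 2)" using \<epsilon> by (intro add_left_mono mult_left_mono) auto
    also have "\<dots> = m\<^sup>2 - \<epsilon> * (m\<^sup>2 / 2)" by (simp add: algebra_simps)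
    finally have "cmod (poly p z - of_real \<epsilon> * g z) \<le> sqrt (m\<^sup>2 - \<epsilon> * (m\<^sup>2 / 2))"
      by (rule real_le_rsqrt)
    then show ?thesis by (simp add: b_def)
  qed
  show ?thesis
  proof (rule that)
    show "degree (smult (- of_real \<epsilon>) q) < n" using q(1) by (simp add: degree_smult_le order.strict_trans1)
    have "sup_norm E (p + w * smult (- of_real \<epsilon>) q) \<le> b"
      using bound by (intro sup_norm_least[OF E(2)]) (simp add: g_def)
    then show "sup_norm E (p + w * smult (- of_real \<epsilon>) q) < m" using bm by simp
  qed
qed

text \<open>Existence is compactness. For uniqueness, the mean of two minimizers is a minimizer, and
  by strict convexity both agree at its extremal points. If they differed, these points would be
  zeros of \<open>s\<close>, fewer than \<open>n\<close>, and \<open>sup_norm_decrease\<close> would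
  improve the mean. By \<open>affine\<close>, means and corrections stay admissible.\<close>

lemma ex1_minimal_poly:
  fixes w :: "complex poly" and P :: "complex poly \<Rightarrow> bool"
  assumes E: "compact E" "infinite E" and w: "w \<noteq> 0" "\<And>z. z \<in> E \<Longrightarrow> poly w z \<noteq> 0" and n: "n > 0"
    and P: "P p0" "\<And>p. P p \<Longrightarrow> p \<noteq> 0" "\<And>p. P p \<Longrightarrow> degree p \<le> n"
    and affine: "\<And>p q. P p \<Longrightarrow> P q \<longleftrightarrow> (\<exists>r. degree r < n \<and> q = p + w * r)"
    and closed: "\<And>p l. (\<And>k::nat. P (p k)) \<Longrightarrow> degree l \<le> n \<Longrightarrow> (\<And>i. (\<lambda>k. coeff (p k) i) \<longlonglongrightarrow> coeff l i) \<Longrightarrow> P l"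
  shows "\<exists>!p. P p \<and> (\<forall>q. P q \<longrightarrow> sup_norm E p \<le> sup_norm E q)"
proof -
  have E0: "E \<noteq> {}" using E by auto
  have ex: "\<exists>p. P p \<and> (\<forall>q. P q \<longrightarrow> sup_norm E p \<le> sup_norm E q)"
  proof -
    define m where "m = Inf (sup_norm E ` Collect P)"
    have bdd: "bdd_below (sup_norm E ` Collect P)"
      using sup_norm_nonneg[OF E(1) E0] by (intro bdd_belowI[of _ 0]) auto
    have ne: "sup_norm E ` Collect P \<noteq> {}" using P(1) by auto
    have "\<exists>p. P p \<and> sup_norm E p < m + 1 / Suc k" for k :: nat
    proof -
      have "Inf (sup_norm E ` Collect P) < m + 1 / Suc k" by (simp add: m_def)
      then show ?thesis using cInf_less_iff[OF ne bdd] by auto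
    qed
    then obtain p where p: "\<And>k. P (p k)" "\<And>k. sup_norm E (p k) < m + 1 / Suc k" by metis
    \<comment> \<open>Bounds at \<open>n + 1\<close> points control all coefficients of degree at
      most \<open>n\<close>.\<close>
    obtain X where X: "X \<subseteq> E" "finite X" "card X = Suc n" using infinite_arbitrarily_large[OF E(2)] by metis
    have bd: "cmod (poly (p k) x) < m + 1 / Suc k" if "x \<in> E" for k x
      using sup_norm_upper[OF E(1) that, of "p k"] p(2)[of k] by simp
    have bnd: "bounded (range (\<lambda>k. poly (p k) x))" if "x \<in> X" for x
    proof -
      have "cmod (poly (p k) x) \<le> m + 1" for k
      proof -
        have "1 / real (Suc k) \<le> 1" by simp
        moreover have "x \<in> E" using that X by blast
        ultimately show ?thesis using bd[of x k] by linarith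
      qed
      then show ?thesis by (auto simp: bounded_iff)
    qed
    obtain r l where r: "strict_mono (r :: nat \<Rightarrow> nat)" "degree l \<le> n" "\<And>i. (\<lambda>k. coeff (p (r k)) i) \<longlonglongrightarrow> coeff l i"
      using poly_subsequence[OF X(2,3), of p, OF P(3)[OF p(1)] bnd] by blast
    have Pl: "P l" using closed[of "\<lambda>k. p (r k)" l] p(1) r by blast
    have "sup_norm E l \<le> m"
    proof (rule sup_norm_least[OF E0])
      fix z assume z: "z \<in> E"
      have 1: "(\<lambda>k. cmod (poly (p (r k)) z)) \<longlonglongrightarrow> cmod (poly l z)"
        by (intro tendsto_norm poly_coeff_tendsto[OF P(3)[OF p(1)] r(2,3)])
      have 2: "(\<lambda>k. m + 1 / Suc k) \<longlonglongrightarrow> m + 0" using LIMSEQ_inverse_real_of_nat by (intro tendsto_intros) (simp add: inverse_eq_divide)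
      have "cmod (poly (p (r k)) z) \<le> m + 1 / Suc k" for k
      proof -
        have "1 / Suc (r k) \<le> 1 / real (Suc k)" using seq_suble[OF r(1), of k] by (simp add: frac_le)
        then show ?thesis using bd[OF z, of "r k"] by linarith
      qed
      then show "cmod (poly l z) \<le> m" using LIMSEQ_le[OF 1 2] by auto
    qed
    then show ?thesis using Pl bdd by (intro exI[of _ l]) (auto simp: m_def intro: order_trans cInf_lower)
  qed
  moreover have "p = q" if p: "P p" "\<forall>q. P q \<longrightarrow> sup_norm E p \<le> sup_norm E q"
    and q: "P q" "\<forall>p. P p \<longrightarrow> sup_norm E q \<le> sup_norm E p" for p q
  proof -
    define m where "m = sup_norm E p"
    have mq: "sup_norm E q = m" using p q by (simp add: m_def antisym)
    have m: "m > 0" unfolding m_def by (rule sup_norm_pos[OF E P(2)[OF p(1)]])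
    obtain s where s: "degree s < n" "q = p + w * s" using affine[OF p(1)] q(1) by blast
    define a where "a = p + w * smult (1 / 2) s"
    have a2: "poly a z = (poly p z + poly q z) / 2" for z by (simp add: a_def s(2) field_simps)
    have Pa: "P a" unfolding a_def using affine[OF p(1)] s(1) by (metis degree_smult_le order.strict_trans1)
    have lep: "cmod (poly p z) \<le> m" and leq: "cmod (poly q z) \<le> m" if "z \<in> E" for z
      using sup_norm_upper[OF E(1) that, of p] sup_norm_upper[OF E(1) that, of q] mq by (auto simp: m_def)
    have "cmod (poly a z) \<le> m" if "z \<in> E" for z
      using norm_triangle_ineq[of "poly p z" "poly q z"] lep[OF that] leq[OF that]
      by (simp add: a2 norm_divide)
    then have "sup_norm E a \<le> m" by (rule sup_norm_least[OF E0])
    then have am: "sup_norm E a = m" using p(2) Pa by (simp add: m_def antisym)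
    let ?X = "{z\<in>E. cmod (poly a z) = m}"
    have sX: "poly s z = 0" if "z \<in> ?X" for z
    proof -
      have "poly p z = poly q z" using that lep[of z] leq[of z] by (intro midpoint_norm_eq[of _ m]) (auto simp: a2)
      then show ?thesis using w(2)[of z] that by (simp add: s(2))
    qed
    have "s = 0"
    proof (rule ccontr)
      assume "s \<noteq> 0"
      have sub: "?X \<subseteq> {z. poly s z = 0}" using sX by blast
      then have fX: "finite ?X" using poly_roots_finite[OF \<open>s \<noteq> 0\<close>] finite_subset by blast
      have "card ?X \<le> degree s"
        using card_mono[OF poly_roots_finite[OF \<open>s \<noteq> 0\<close>] sub] card_poly_roots_bound[OF \<open>s \<noteq> 0\<close>] by linarith
      then have "card ?X \<le> n" using s(1) by simp
      from sup_norm_decrease[OF E(1) E0 w(2) am m fX this n]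
      obtain r where r: "degree r < n" "sup_norm E (a + w * r) < m" by blast
      have "P (a + w * r)" using affine[OF Pa] r(1) by blast
      then show False using p(2) r(2) by (auto simp: m_def)
    qed
    then show ?thesis by (simp add: s(2))
  qed
  ultimately show ?thesis by blast
qed

lemma chebyshev_poly_minimal:
  assumes E: "compact E" "infinite E" and n: "n > 0"
  shows "degree (chebyshev_poly E n) = n" "lead_coeff (chebyshev_poly E n) = 1"
    "\<And>q. degree q = n \<Longrightarrow> lead_coeff q = 1 \<Longrightarrow> sup_norm E (chebyshev_poly E n) \<le> sup_norm E q"
proof -
  define P where "P p \<longleftrightarrow> degree p = n \<and> lead_coeff p = 1" for p :: "complex poly"
  have ex1: "\<exists>!p. P p \<and> (\<forall>q. P q \<longrightarrow> sup_norm E p \<le> sup_norm E q)"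
  proof (rule ex1_minimal_poly[OF E, of 1 n P])
    show "P (monom 1 n)" by (simp add: P_def degree_monom_eq)
    show "P q \<longleftrightarrow> (\<exists>r. degree r < n \<and> q = p + 1 * r)" if p: "P p" for p q
    proof
      assume q: "P q"
      have "coeff (q - p) n = 0" using p q by (auto simp: P_def)
      moreover have "degree (q - p) \<le> n" using p q by (intro degree_diff_le) (auto simp: P_def)
      ultimately have "degree (q - p) < n"
        using n by (metis degree_0 le_neq_implies_less leading_coeff_0_iff)
      then show "\<exists>r. degree r < n \<and> q = p + 1 * r" by (intro exI[of _ "q - p"]) simp
    next
      assume "\<exists>r. degree r < n \<and> q = p + 1 * r"
      then obtain r where r: "degree r < n" "q = p + r" by auto
      then have "degree q = n" using p by (simp add: P_def degree_add_eq_left)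
      then show "P q" using r p by (auto simp: P_def coeff_eq_0)
    qed
    show "P l" if "\<And>k::nat. P (p k)" "degree l \<le> n" "\<And>i. (\<lambda>k. coeff (p k) i) \<longlonglongrightarrow> coeff l i" for p l
    proof -
      have "coeff (p k) n = 1" for k using that(1)[of k] by (auto simp: P_def)
      then have "coeff l n = 1" using that(3)[of n] by (simp add: LIMSEQ_const_iff)
      then show ?thesis using that(2) by (metis P_def le_antisym le_degree zero_neq_one)
    qed
  qed (use n in \<open>auto simp: P_def\<close>)
  have eq: "chebyshev_poly E n = (THE p. P p \<and> (\<forall>q. P q \<longrightarrow> sup_norm E p \<le> sup_norm E q))"
    unfolding chebyshev_poly_def P_def by (simp only: conj_assoc)
  from theI'[OF ex1] have "P (chebyshev_poly E n) \<and> (\<forall>q. P q \<longrightarrow> sup_norm E (chebyshev_poly E n) \<le> sup_norm E q)"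
    unfolding eq[symmetric] .
  then show "degree (chebyshev_poly E n) = n" "lead_coeff (chebyshev_poly E n) = 1"
    "\<And>q. degree q = n \<Longrightarrow> lead_coeff q = 1 \<Longrightarrow> sup_norm E (chebyshev_poly E n) \<le> sup_norm E q"
    by (auto simp: P_def)
qed

lemma residual_poly_minimal:
  assumes E: "compact E" "infinite E" and n: "n > 0" and a: "a \<notin> E"
  shows "degree (residual_poly E n a) \<le> n" "poly (residual_poly E n a) a = 1"
    "\<And>q. degree q \<le> n \<Longrightarrow> poly q a = 1 \<Longrightarrow> sup_norm E (residual_poly E n a) \<le> sup_norm E q"
proof -
  define P where "P p \<longleftrightarrow> degree p \<le> n \<and> poly p a = 1" for p :: "complex poly"
  have ex1: "\<exists>!p. P p \<and> (\<forall>q. P q \<longrightarrow> sup_norm E p \<le> sup_norm E q)"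
  proof (rule ex1_minimal_poly[OF E, of "[:- a, 1:]" n P])
    show "P 1" by (simp add: P_def)
    show "P q \<longleftrightarrow> (\<exists>r. degree r < n \<and> q = p + [:- a, 1:] * r)" if p: "P p" for p q
    proof
      assume q: "P q"
      have "poly (q - p) a = 0" using p q by (auto simp: P_def)
      then obtain r where r: "q - p = [:- a, 1:] * r" unfolding poly_eq_0_iff_dvd dvd_def by blast
      have "degree (q - p) \<le> n" using p q by (intro degree_diff_le) (auto simp: P_def)
      then have "degree r < n"
      proof (cases "r = 0")
        case False
        then have "degree ([:- a, 1:] * r) = 1 + degree r" by (subst degree_mult_eq) auto
        then show ?thesis using \<open>degree (q - p) \<le> n\<close> unfolding r by simp
      qed (use n in simp)
      then show "\<exists>r. degree r < n \<and> q = p + [:- a, 1:] * r" using r by (intro exI[of _ r]) (simp add: algebra_simps)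
    next
      assume "\<exists>r. degree r < n \<and> q = p + [:- a, 1:] * r"
      then obtain r where r: "degree r < n" "q = p + [:- a, 1:] * r" by auto
      have "degree ([:- a, 1:] * r) \<le> n" using degree_mult_le[of "[:- a, 1:]" r] r(1) by simp
      then show "P q" using r p by (auto simp: P_def intro!: degree_add_le)
    qed
    show "P l" if "\<And>k::nat. P (p k)" "degree l \<le> n" "\<And>i. (\<lambda>k. coeff (p k) i) \<longlonglongrightarrow> coeff l i" for p l
    proof -
      have "(\<lambda>k. poly (p k) a) \<longlonglongrightarrow> poly l a"
        using that by (intro poly_coeff_tendsto[of _ n]) (auto simp: P_def)
      then show ?thesis using that by (simp add: P_def LIMSEQ_const_iff)
    qed
  qed (use n a in \<open>auto simp: P_def\<close>)
  have eq: "residual_poly E n a = (THE p. P p \<and> (\<forall>q. P q \<longrightarrow> sup_norm E p \<le> sup_norm E q))"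
    unfolding residual_poly_def P_def by (simp only: conj_assoc)
  from theI'[OF ex1] have "P (residual_poly E n a) \<and> (\<forall>q. P q \<longrightarrow> sup_norm E (residual_poly E n a) \<le> sup_norm E q)"
    unfolding eq[symmetric] .
  then show "degree (residual_poly E n a) \<le> n" "poly (residual_poly E n a) a = 1"
    "\<And>q. degree q \<le> n \<Longrightarrow> poly q a = 1 \<Longrightarrow> sup_norm E (residual_poly E n a) \<le> sup_norm E q"
    by (auto simp: P_def)
qed

text \<open>Moduli are compared factor by factor. The last two conclusions are conditional because
  the uses differ: constants serve near a finite point but lose degree, multiples of
  \<open>z\<close> keep it and serve at infinity.\<close>

lemma replace_zeros:
  fixes p :: "complex poly"
  assumes p: "p \<noteq> 0" and r: "\<And>\<zeta>. \<zeta> \<in> S \<Longrightarrow> r \<zeta> \<noteq> 0 \<and> degree (r \<zeta>) \<le> 1 \<and> (\<forall>z\<in>S. poly (r \<zeta>) z \<noteq> 0) \<and>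
      (\<forall>z\<in>E. cmod (poly (r \<zeta>) z) \<le> cmod (z - \<zeta>))"
  obtains q where "q \<noteq> 0" "degree q \<le> degree p" "\<And>z. z \<in> S \<Longrightarrow> poly q z \<noteq> 0"
    "\<And>z. z \<in> E \<Longrightarrow> cmod (poly q z) \<le> cmod (poly p z)"
    "\<And>a. \<forall>\<zeta>\<in>S. cmod (a - \<zeta>) \<le> cmod (poly (r \<zeta>) a) \<Longrightarrow> cmod (poly p a) \<le> cmod (poly q a)"
    "\<forall>\<zeta>\<in>S. degree (r \<zeta>) = 1 \<and> cmod (lead_coeff (r \<zeta>)) \<ge> 1 \<Longrightarrow>
        degree q = degree p \<and> cmod (lead_coeff p) \<le> cmod (lead_coeff q)"
proof -
  obtain root where root: "smult (lead_coeff p) (\<Prod>i<degree p. [:- root i, 1:]) = p"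
    using complex_poly_decompose' by blast
  define f where "f \<zeta> = (if \<zeta> \<in> S then r \<zeta> else [:- \<zeta>, 1:])" for \<zeta>
  define q where "q = smult (lead_coeff p) (\<Prod>i<degree p. f (root i))"
  have lp: "lead_coeff p \<noteq> 0" using p by simp
  have f0: "f \<zeta> \<noteq> 0" "degree (f \<zeta>) \<le> 1" for \<zeta> using r by (auto simp: f_def)
  have pz: "poly p z = lead_coeff p * (\<Prod>i<degree p. z - root i)" for z
    by (subst root[symmetric]) (simp add: poly_prod)
  have qz: "poly q z = lead_coeff p * (\<Prod>i<degree p. poly (f (root i)) z)" for z
    by (simp add: q_def poly_prod)
  have dq: "degree q = (\<Sum>i<degree p. degree (f (root i)))"
    unfolding q_def using lp f0 by (simp add: degree_prod_sum_eq)
  show ?thesis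
  proof (rule that)
    show "q \<noteq> 0" using lp f0 by (simp add: q_def)
    show "degree q \<le> degree p" unfolding dq using sum_mono[of "{..<degree p}" "\<lambda>i. degree (f (root i))" "\<lambda>_. 1"] f0(2) by simp
    show "poly q z \<noteq> 0" if "z \<in> S" for z
      using that r lp by (auto simp: qz f_def)
    show "cmod (poly q z) \<le> cmod (poly p z)" if "z \<in> E" for z
      unfolding qz pz norm_mult prod_norm[symmetric]
      using that r by (intro mult_left_mono prod_mono) (auto simp: f_def)
    show "cmod (poly p a) \<le> cmod (poly q a)" if "\<forall>\<zeta>\<in>S. cmod (a - \<zeta>) \<le> cmod (poly (r \<zeta>) a)" for a
      unfolding qz pz norm_mult prod_norm[symmetric]
      using that by (intro mult_left_mono prod_mono) (auto simp: f_def)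
    show "degree q = degree p \<and> cmod (lead_coeff p) \<le> cmod (lead_coeff q)"
      if h: "\<forall>\<zeta>\<in>S. degree (r \<zeta>) = 1 \<and> cmod (lead_coeff (r \<zeta>)) \<ge> 1"
    proof
      have f1: "degree (f \<zeta>) = 1 \<and> cmod (lead_coeff (f \<zeta>)) \<ge> 1" for \<zeta>
      proof (cases "\<zeta> \<in> S")
        case True
        then show ?thesis unfolding f_def if_P[OF True] by (rule h[rule_format])
      qed (simp add: f_def)
      then have f1: "degree (f \<zeta>) = 1" "cmod (lead_coeff (f \<zeta>)) \<ge> 1" for \<zeta> by blast+
      show "degree q = degree p" unfolding dq f1(1) by simp
      have "lead_coeff q = lead_coeff p * (\<Prod>i<degree p. lead_coeff (f (root i)))"
        by (simp add: q_def lead_coeff_smult lead_coeff_prod)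
      moreover have "cmod (\<Prod>i<degree p. lead_coeff (f (root i))) \<ge> 1"
        unfolding prod_norm[symmetric] using f1(2) by (intro prod_ge_1) auto
      ultimately show "cmod (lead_coeff p) \<le> cmod (lead_coeff q)"
        using mult_left_mono[of 1 "cmod (\<Prod>i<degree p. lead_coeff (f (root i)))" "cmod (lead_coeff p)"] by (simp add: norm_mult)
    qed
  qed
qed

section \<open>The Green function\<close>

text \<open>At points off the carrier and within distance \<open>D\<close> of all of it,
  \<open>ln D - log_potential N\<close> extends \<open>potential D N\<close> from the line to the
  plane. Being real-valued, it can be differentiated.\<close>

definition log_potential :: "real measure \<Rightarrow> complex \<Rightarrow> real" where
  "log_potential N z = (\<integral>t. ln (cmod (z - of_real t)) \<partial>N)"

lemma integral_le_of_nn_integral_le: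
  assumes f: "integrable N f" and le: "(\<integral>\<^sup>+t. ennreal (f t) \<partial>N) \<le> ennreal V" and V: "V \<ge> 0"
  shows "(\<integral>t. f t \<partial>N) \<le> V"
proof -
  have i: "integrable N (\<lambda>t. max 0 (f t))" using f by simp
  have "ennreal (\<integral>t. max 0 (f t) \<partial>N) = (\<integral>\<^sup>+t. ennreal (max 0 (f t)) \<partial>N)"
    using i by (intro nn_integral_eq_integral[symmetric]) auto
  also have "\<dots> = (\<integral>\<^sup>+t. ennreal (f t) \<partial>N)"
    by (intro nn_integral_cong) (auto simp: max_def ennreal_neg)
  finally have "ennreal (\<integral>t. max 0 (f t) \<partial>N) \<le> ennreal V" using le by simp
  then have "(\<integral>t. max 0 (f t) \<partial>N) \<le> V" unfolding ennreal_le_iff[OF V] .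
  moreover have "(\<integral>t. f t \<partial>N) \<le> (\<integral>t. max 0 (f t) \<partial>N)" using f i by (intro integral_mono) auto
  ultimately show ?thesis by linarith
qed

lemma compact_of_real_image: "compact A \<Longrightarrow> compact (complex_of_real ` A)"
  by (intro compact_continuous_image continuous_intros)

lemma log_potential_props:
  assumes N: "N \<in> prob_on F" and F: "compact F"
  shows "hol_grad (log_potential N) (- complex_of_real ` F)"
    "\<And>z. z \<notin> complex_of_real ` F \<Longrightarrow> integrable N (\<lambda>t. ln (cmod (z - of_real t)))"
proof -
  have Fb: "F \<in> sets borel" using F by (simp add: borel_compact)
  have [measurable_cong]: "sets N = sets borel" using N prob_onD by blast
  obtain B where B: "\<And>x. x \<in> F \<Longrightarrow> \<bar>x\<bar> \<le> B"
    using compact_imp_bounded[OF F] by (auto simp: bounded_iff)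
  have AE: "AE t in N. t \<in> F" by (rule prob_on_AE[OF N Fb])
  have low: "\<exists>\<delta>>0. AE t in N. \<delta> \<le> cmod (- of_real t + 1 * z)" if z: "z \<in> - complex_of_real ` F" for z
  proof -
    obtain \<delta> where \<delta>: "\<delta> > 0" "\<And>w. w \<in> complex_of_real ` F \<Longrightarrow> \<delta> \<le> dist z w"
      using separate_point_closed[OF compact_imp_closed[OF compact_of_real_image[OF F]], of z] z by auto
    have "AE t in N. \<delta> \<le> cmod (- of_real t + 1 * z)"
      using AE by eventually_elim (use \<delta>(2) in \<open>simp add: dist_norm\<close>)
    then show ?thesis using \<delta>(1) by blast
  qed
  have B1: "AE t in N. cmod (- of_real t) \<le> max B 1" using AE by eventually_elim (use B in \<open>simp add: le_max_iff_disj\<close>)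
  have B2: "AE t in N. cmod (1::complex) \<le> max B 1" by simp
  have op: "open (- complex_of_real ` F)"
    using compact_imp_closed[OF compact_of_real_image[OF F]] by (simp add: open_Compl)
  note * = hol_grad_integral_ln[OF prob_onD(1)[OF N] _ _ B1 B2 op low]
  show "hol_grad (log_potential N) (- complex_of_real ` F)"
    using *(1) unfolding log_potential_def by simp
  show "integrable N (\<lambda>t. ln (cmod (z - of_real t)))" if "z \<notin> complex_of_real ` F" for z
    using *(2)[of z] that by simp
qed

lemma log_potential_mono_bounds:
  assumes N: "N \<in> prob_on F" and F: "compact F" and z: "z \<notin> complex_of_real ` F"
  shows "\<And>b. b > 0 \<Longrightarrow> (\<And>t. t \<in> F \<Longrightarrow> cmod (z - of_real t) \<le> b) \<Longrightarrow> log_potential N z \<le> ln b"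
    "\<And>b. b > 0 \<Longrightarrow> (\<And>t. t \<in> F \<Longrightarrow> b \<le> cmod (z - of_real t)) \<Longrightarrow> ln b \<le> log_potential N z"
proof -
  interpret prob_space N using N prob_onD by blast
  have Fb: "F \<in> sets borel" using F by (simp add: borel_compact)
  have AE: "AE t in N. t \<in> F" by (rule prob_on_AE[OF N Fb])
  note i = log_potential_props(2)[OF N F z]
  have nz: "cmod (z - of_real t) > 0" if "t \<in> F" for t using that z by auto
  show "log_potential N z \<le> ln b" if b: "b > 0" "\<And>t. t \<in> F \<Longrightarrow> cmod (z - of_real t) \<le> b" for b
  proof -
    have "log_potential N z \<le> (\<integral>t. ln b \<partial>N)" unfolding log_potential_def
    proof (rule integral_mono_AE[OF i])
      show "AE t in N. ln (cmod (z - of_real t)) \<le> ln b"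
        using AE by eventually_elim (use nz b in simp)
    qed simp
    then show ?thesis by (simp add: prob_space)
  qed
  show "ln b \<le> log_potential N z" if b: "b > 0" "\<And>t. t \<in> F \<Longrightarrow> b \<le> cmod (z - of_real t)" for b
  proof -
    have "(\<integral>t. ln b \<partial>N) \<le> log_potential N z" unfolding log_potential_def
    proof (rule integral_mono_AE[OF _ i])
      show "AE t in N. ln b \<le> ln (cmod (z - of_real t))"
        using AE by eventually_elim (use nz b in simp)
    qed simp
    then show ?thesis by (simp add: prob_space)
  qed
qed

text \<open>Semicontinuity of the potential for approach through the complex plane, by Fatou's lemma
  along a sequence. For negative \<open>T\<close> the last assumption is void, and the claim holds
  because \<open>ln D - log_potential N z\<close> is nonnegative within \<open>D / 4\<close> of
  \<open>x\<close>.\<close>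

lemma log_potential_boundary:
  assumes N: "N \<in> prob_on F" and F: "compact F" and D: "D > 0"
    and FD: "\<And>t. t \<in> F \<Longrightarrow> \<bar>t\<bar> \<le> D / 4" and x: "\<bar>x\<bar> \<le> D / 4"
    and T: "T \<ge> 0 \<Longrightarrow> ennreal T < (potential D N x)"
  shows "\<exists>r>0. \<forall>z\<in>ball (of_real x) r - complex_of_real ` F. T < ln D - log_potential N z"
proof (rule ccontr)
  assume "\<not> ?thesis"
  then have neg: "\<exists>z. z \<in> ball (of_real x) r - complex_of_real ` F \<and> ln D - log_potential N z \<le> T" if "r > 0" for r
    using that by (meson not_less)
  interpret prob_space N using N prob_onD by blast
  have [measurable_cong]: "sets N = sets borel" using N prob_onD by blast
  have Fb: "F \<in> sets borel" using F by (simp add: borel_compact)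
  have AE: "AE t in N. t \<in> F" by (rule prob_on_AE[OF N Fb])
  \<comment> \<open>\<open>D / 4\<close> keeps the distances to \<open>F\<close> below
    \<open>D\<close>; \<open>1 / Suc n\<close> forces convergence to \<open>x\<close>.\<close>
  define R where "R n = min (D / 4) (1 / real (Suc n))" for n
  have R: "R n > 0" "R n \<le> D / 4" "R n \<le> 1 / real (Suc n)" for n using D by (auto simp: R_def)
  obtain v where v: "\<And>n. v n \<in> ball (of_real x) (R n) - complex_of_real ` F" "\<And>n. ln D - log_potential N (v n) \<le> T"
    using neg[OF R(1)] by metis
  have "v \<longlonglongrightarrow> of_real x"
  proof (rule tendstoI)
    fix e :: real assume "e > 0"
    then obtain m where m: "1 / real (Suc m) < e" using nat_approx_posE by blast
    show "eventually (\<lambda>n. dist (v n) (of_real x) < e) sequentially"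
      using eventually_ge_at_top[of m]
    proof eventually_elim
      case (elim n)
      have "dist (v n) (of_real x) < R n" using v(1)[of n] by (simp add: dist_commute)
      also have "\<dots> \<le> 1 / real (Suc n)" by (rule R)
      also have "\<dots> \<le> 1 / real (Suc m)" using elim by (simp add: frac_le)
      finally show ?case using m by simp
    qed
  qed
  then have lim: "(\<lambda>n. cmod (v n - of_real t)) \<longlonglongrightarrow> cmod (of_real x - of_real t)" for t
    by (intro tendsto_intros)
  have eq: "(\<integral>\<^sup>+t. ennreal (ln (D / cmod (v n - of_real t))) \<partial>N) = ennreal (ln D - log_potential N (v n))"
    and nonneg: "ln D - log_potential N (v n) \<ge> 0" for n
  proof -
    have vF: "v n \<notin> complex_of_real ` F" using v(1)[of n] by simp
    note i = log_potential_props(2)[OF N F vF]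
    have le: "cmod (v n - of_real t) \<le> D" "cmod (v n - of_real t) > 0" if "t \<in> F" for t
    proof -
      have "cmod (v n - of_real t) \<le> cmod (v n - of_real x) + cmod (of_real x - of_real t)"
        using norm_triangle_ineq[of "v n - of_real x" "of_real x - of_real t"] by simp
      moreover have "cmod (v n - of_real x) < D / 4" using v(1)[of n] R(2)[of n] by (simp add: dist_norm norm_minus_commute)
      moreover have "cmod (complex_of_real x - of_real t) = \<bar>x - t\<bar>" by (metis norm_of_real of_real_diff)
      ultimately show "cmod (v n - of_real t) \<le> D" using x FD[OF that] by linarith
      show "cmod (v n - of_real t) > 0" using that vF by auto
    qed
    have "(\<integral>\<^sup>+t. ennreal (ln (D / cmod (v n - of_real t))) \<partial>N) = (\<integral>\<^sup>+t. ennreal (ln D - ln (cmod (v n - of_real t))) \<partial>N)"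
      using AE by (intro nn_integral_cong_AE, eventually_elim) (use le D in \<open>simp add: ln_div\<close>)
    also have "\<dots> = ennreal (\<integral>t. ln D - ln (cmod (v n - of_real t)) \<partial>N)"
    proof (rule nn_integral_eq_integral)
      show "integrable N (\<lambda>t. ln D - ln (cmod (v n - of_real t)))" using i by simp
      show "AE t in N. 0 \<le> ln D - ln (cmod (v n - of_real t))"
        using AE by eventually_elim (use le D in simp)
    qed
    also have "(\<integral>t. ln D - ln (cmod (v n - of_real t)) \<partial>N) = ln D - log_potential N (v n)"
      using i by (simp add: log_potential_def prob_space)
    finally show "(\<integral>\<^sup>+t. ennreal (ln (D / cmod (v n - of_real t))) \<partial>N) = ennreal (ln D - log_potential N (v n))" .
    show "ln D - log_potential N (v n) \<ge> 0"
      using log_potential_mono_bounds(1)[OF N F vF D le(1)] by simp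
  qed
  have T0: "T \<ge> 0" using nonneg[of 0] v(2)[of 0] by linarith
  have "potential D N x \<le> (\<integral>\<^sup>+t. liminf (\<lambda>n. ennreal (ln (D / cmod (v n - of_real t)))) \<partial>N)"
    using AE
  proof (intro nn_integral_mono_AE, eventually_elim)
    case (elim t)
    \<comment> \<open>The kernel depends on the distance only, so pairing 0 with that distance
      brings complex points under \<open>log_kernel_lsc\<close>.\<close>
    have "log_kernel D x t = log_kernel D 0 (cmod (of_real x - of_real t))"
      using norm_of_real[of "x - t", where 'a = complex] by (auto simp: log_kernel_def)
    moreover have "ennreal (ln (D / cmod (v n - of_real t))) = log_kernel D 0 (cmod (v n - of_real t))" for n
    proof -
      have "v n \<noteq> of_real t" using v(1)[of n] elim by auto
      then show ?thesis by (simp add: log_kernel_def)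
    qed
    ultimately show ?case
      using log_kernel_lsc[OF D tendsto_const lim[of t]] by (simp add: le_Liminf_iff)
  qed
  also have "\<dots> \<le> liminf (\<lambda>n. \<integral>\<^sup>+t. ennreal (ln (D / cmod (v n - of_real t))) \<partial>N)"
    by (intro nn_integral_liminf) measurable
  also have "\<dots> \<le> ennreal T"
    unfolding eq using v(2) by (intro Liminf_le always_eventually allI ennreal_leI) simp_all
  finally show False using T[OF T0] by simp
qed

text \<open>\<open>D / 4\<close>, stronger than the \<open>D / 2\<close> of the energy lemmas,
  leaves room for complex points near \<open>A\<close> and puts \<open>|z - t|\<close> between
  \<open>3 / 4\<close> and \<open>5 / 4\<close> of \<open>|z|\<close> when
  \<open>|z| >= D\<close>.\<close>

locale equilibrium =
  fixes A :: "real set" and D V :: real and M :: "real measure"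
  assumes A: "compact A"
    and D: "D \<ge> 1" "\<And>x. x \<in> A \<Longrightarrow> \<bar>x\<bar> \<le> D / 4"
    and M: "M \<in> prob_on A" and V: "V \<ge> 0"
    and frostman: "\<And>x. potential D M x \<le> ennreal V"
    and exceptional: "capacity (complex_of_real ` {x\<in>A. (potential D M x) < ennreal V}) = 0"
begin

abbreviation E :: "complex set" where "E \<equiv> complex_of_real ` A"

definition green :: "complex \<Rightarrow> real" where
  "green z = (if z \<in> E then 0 else V - ln D + log_potential M z)"

lemma compact_E: "compact E" using compact_of_real_image[OF A] .
lemma closed_E: "closed E" using compact_imp_closed[OF compact_E] .
lemma open_E: "open (- E)" using closed_E by (simp add: open_Compl)
lemma D0: "D > 0" using D by simp

lemma norm_E: "z \<in> E \<Longrightarrow> cmod z \<le> D / 4" using D by auto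

text \<open>An atom would make the potential infinite at its position, and a probability measure on
  a finite set has an atom.\<close>

lemma infinite_E: "infinite E"
proof
  assume "finite E"
  then have fin: "finite A" using finite_imageD[of complex_of_real A] by (simp add: inj_on_def)
  interpret prob_space M using M prob_onD by blast
  have s: "sets M = sets borel" using M prob_onD by blast
  note [measurable_cong] = s
  have "emeasure M {x} = 0" for x
  proof (rule ccontr)
    assume nz: "emeasure M {x} \<noteq> 0"
    have "\<infinity> * emeasure M {x} = (\<integral>\<^sup>+t. \<infinity> * indicator {x} t \<partial>M)"
      by (rule nn_integral_cmult_indicator[symmetric]) (simp add: s)
    also have "\<dots> \<le> potential D M x"
      by (intro nn_integral_mono) (auto simp: log_kernel_def indicator_def)
    also have "\<dots> < \<infinity>" using frostman[of x] by (rule le_less_trans) simp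
    finally show False using nz by (simp add: ennreal_top_mult)
  qed
  then have "(\<Sum>x\<in>A. emeasure M {x}) = 0" by simp
  moreover have "emeasure M A = (\<Sum>x\<in>A. emeasure M {x})"
    using fin s by (intro emeasure_eq_sum_singleton) auto
  ultimately show False using prob_onD(4)[OF M] by simp
qed

lemma hol_grad_green: "hol_grad green (- E)"
proof -
  have "hol_grad (\<lambda>z. 1 * (V - ln D) + 1 * log_potential M z) (- E)"
    by (intro hol_grad_lincomb hol_grad_const log_potential_props(1)[OF M A])
  then show ?thesis by (rule hol_grad_cong[OF _ open_E]) (simp add: green_def)
qed

text \<open>Passing from \<open>z\<close> to \<open>Re z\<close> shortens the distances to the real
  set \<open>A\<close>, so the bound \<open>V\<close> on the line extends to the plane.\<close>

lemma green_nonneg: "green z \<ge> 0"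
proof (cases "z \<in> E")
  case False
  interpret prob_space M using M prob_onD by blast
  note i = log_potential_props(2)[OF M A False]
  have Ab: "A \<in> sets borel" using A by (simp add: borel_compact)
  have AE: "AE t in M. t \<in> A" by (rule prob_on_AE[OF M Ab])
  have "(\<integral>\<^sup>+t. ennreal (ln D - ln (cmod (z - of_real t))) \<partial>M) \<le> (potential D M (Re z))"
    using AE
  proof (intro nn_integral_mono_AE, eventually_elim)
    case (elim t)
    then have nz: "z - of_real t \<noteq> 0" using False by auto
    show ?case
    proof (cases "Re z = t")
      case ne: False
      have "\<bar>Re z - t\<bar> \<le> cmod (z - of_real t)" using abs_Re_le_cmod[of "z - of_real t"] by simp
      then have "ln \<bar>Re z - t\<bar> \<le> ln (cmod (z - of_real t))" using ne by (subst ln_le_cancel_iff) auto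
      then show ?thesis using ne D0 nz by (auto simp: log_kernel_def ln_div intro!: ennreal_leI)
    qed (simp add: log_kernel_def)
  qed
  also have "\<dots> \<le> ennreal V" by (rule frostman)
  finally have "(\<integral>t. ln D - ln (cmod (z - of_real t)) \<partial>M) \<le> V"
    using i V by (intro integral_le_of_nn_integral_le) auto
  then show ?thesis using i False by (simp add: green_def log_potential_def prob_space)
qed (simp add: green_def)

lemma green_upper: "z \<notin> E \<Longrightarrow> green z \<le> V - ln D + ln (cmod z + D)"
proof -
  assume z: "z \<notin> E"
  have "cmod (z - of_real t) \<le> cmod z + D" if "t \<in> A" for t
    using norm_triangle_ineq4[of z "of_real t"] D(2)[OF that] D0 by simp
  then have "log_potential M z \<le> ln (cmod z + D)"
    using D0 norm_ge_zero[of z] by (intro log_potential_mono_bounds(1)[OF M A z]) (auto intro: add_nonneg_pos)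
  then show ?thesis using z by (simp add: green_def)
qed

lemma far_not_in_E: "cmod z \<ge> D \<Longrightarrow> z \<notin> E"
  using norm_E[of z] D0 by auto

lemma log_potential_far:
  assumes N: "N \<in> prob_on F" and F: "compact F" "F \<subseteq> A" and z: "cmod z \<ge> D"
  shows "ln (3 / 4) + ln (cmod z) \<le> log_potential N z" "log_potential N z \<le> ln (5 / 4) + ln (cmod z)"
proof -
  have zF: "z \<notin> complex_of_real ` F" using far_not_in_E[OF z] F by auto
  have t: "cmod (of_real t) \<le> cmod z / 4" if "t \<in> F" for t using D(2)[of t] that F z by auto
  have z0: "cmod z > 0" using z D0 by linarith
  have "ln (3 / 4 * cmod z) \<le> log_potential N z"
  proof (rule log_potential_mono_bounds(2)[OF N F(1) zF])
    show "3 / 4 * cmod z \<le> cmod (z - of_real t)" if "t \<in> F" for t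
      using norm_triangle_ineq2[of z "of_real t"] t[OF that] by linarith
  qed (use z0 in linarith)
  moreover have "ln (3 / 4 * cmod z) = ln (3 / 4) + ln (cmod z)" using z0 by (subst ln_mult) auto
  ultimately show "ln (3 / 4) + ln (cmod z) \<le> log_potential N z" by simp
  have "log_potential N z \<le> ln (5 / 4 * cmod z)"
  proof (rule log_potential_mono_bounds(1)[OF N F(1) zF])
    show "cmod (z - of_real t) \<le> 5 / 4 * cmod z" if "t \<in> F" for t
      using norm_triangle_ineq4[of z "of_real t"] t[OF that] by linarith
  qed (use z0 in linarith)
  moreover have "ln (5 / 4 * cmod z) = ln (5 / 4) + ln (cmod z)" using z0 by (subst ln_mult) auto
  ultimately show "log_potential N z \<le> ln (5 / 4) + ln (cmod z)" by simp
qed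

lemma green_far:
  assumes z: "cmod z \<ge> D"
  shows "V - ln D + ln (3 / 4) + ln (cmod z) \<le> green z" "green z \<le> V - ln D + ln (5 / 4) + ln (cmod z)"
  using log_potential_far[OF M A order_refl z] far_not_in_E[OF z]
  by (simp_all add: green_def)

lemma green_large: "\<exists>R. \<forall>z. cmod z \<ge> R \<longrightarrow> z \<notin> E \<and> K \<le> green z"
proof (intro exI allI impI conjI)
  fix z assume z: "cmod z \<ge> max D (exp (K - (V - ln D + ln (3 / 4))))"
  then show "z \<notin> E" using far_not_in_E by simp
  have "K - (V - ln D + ln (3 / 4)) \<le> ln (cmod z)"
    using z D0 by (subst ln_ge_iff) auto
  then show "K \<le> green z" using green_far(1)[of z] z by simp
qed

text \<open>Semicontinuity of the potential bounds \<open>green\<close> from above near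
  \<open>x\<close>; from below it is nonnegative.\<close>

lemma green_boundary:
  assumes x: "x \<in> A" "(potential D M x) = ennreal V"
  shows "(green \<longlongrightarrow> 0) (at (of_real x) within - E)"
proof (rule tendstoI)
  fix e :: real assume e: "e > 0"
  have "ennreal (V - e) < ennreal V" if "V - e \<ge> 0" using that e V by (simp add: ennreal_less_iff)
  then obtain r where r: "r > 0" "\<And>z. z \<in> ball (of_real x) r - E \<Longrightarrow> V - e < ln D - log_potential M z"
    using log_potential_boundary[OF M A D0 D(2) D(2)[OF x(1)], of "V - e"] x(2) by auto
  show "eventually (\<lambda>z. dist (green z) 0 < e) (at (of_real x) within - E)"
    unfolding eventually_at
  proof (intro exI conjI ballI impI)
    fix z assume z: "z \<in> - E" "z \<noteq> of_real x \<and> dist z (of_real x) < r"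
    then have "V - e < ln D - log_potential M z" by (intro r) (simp add: dist_commute)
    then show "dist (green z) 0 < e" using z green_nonneg[of z] by (simp add: dist_norm green_def)
  qed (rule r)
qed

section \<open>Defining properties of the Green function and the extended maximum principle\<close>

lemma of_real_image_borel: "B \<in> sets borel \<Longrightarrow> complex_of_real ` B \<in> sets borel"
proof -
  assume [measurable]: "B \<in> sets borel"
  have "complex_of_real ` B = {z. Im z = 0 \<and> Re z \<in> B}"
    by (auto simp: image_iff complex_eq_iff)
  also have "\<dots> \<in> sets borel" by measurable
  finally show ?thesis .
qed

lemma frontier_E: "frontier E \<subseteq> E" using closed_E frontier_subset_closed by blast

lemma is_green_function_green: "is_green_function E green"
  unfolding is_green_function_def
proof (intro conjI allI ballI)
  show "harmonic_on green (- E)" by (rule hol_grad_harmonic[OF open_E hol_grad_green])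
  show "bounded (green ` (cball 0 r - E))" for r
    unfolding bounded_iff
  proof (intro exI ballI)
    fix y assume "y \<in> green ` (cball 0 r - E)"
    then obtain z where z: "z \<notin> E" "cmod z \<le> r" "y = green z" by auto
    have "ln (cmod z + D) \<le> ln (r + D)"
      using z D0 norm_ge_zero[of z] by (intro ln_le_cancel_iff[THEN iffD2]) linarith+
    then show "norm y \<le> V - ln D + ln (r + D)" using green_upper[OF z(1)] green_nonneg[of z] z(3) by simp
  qed
  show "(\<lambda>z. green z - ln (cmod z)) \<in> O[at_infinity](\<lambda>_. 1)"
  proof (rule bigoI[where c = "\<bar>V - ln D\<bar> + \<bar>ln (3 / 4)\<bar> + \<bar>ln (5 / 4)\<bar>"])
    show "eventually (\<lambda>z. norm (green z - ln (cmod z)) \<le> (\<bar>V - ln D\<bar> + \<bar>ln (3 / 4)\<bar> + \<bar>ln (5 / 4)\<bar>) * norm (1::real)) at_infinity"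
      unfolding eventually_at_infinity
    proof (intro exI allI impI)
      fix z :: complex assume "D \<le> norm z"
      from green_far[OF this] show "norm (green z - ln (cmod z)) \<le> (\<bar>V - ln D\<bar> + \<bar>ln (3 / 4)\<bar> + \<bar>ln (5 / 4)\<bar>) * norm (1::real)"
        by (simp only: norm_one mult_1_right real_norm_def abs_one)
    qed
  qed
  show "\<exists>N. N \<in> sets borel \<and> capacity N = 0 \<and> (\<forall>\<zeta>\<in>frontier E - N. (green \<longlongrightarrow> 0) (at \<zeta> within - E))"
  proof (intro exI conjI ballI)
    have [measurable_cong]: "sets M = sets borel" using M prob_onD by blast
    interpret prob_space M using M prob_onD by blast
    have [measurable]: "A \<in> sets borel" using A by (simp add: borel_compact)
    show "complex_of_real ` {x\<in>A. (potential D M x) < ennreal V} \<in> sets borel"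
      by (intro of_real_image_borel) measurable
    show "capacity (complex_of_real ` {x\<in>A. (potential D M x) < ennreal V}) = 0" by (rule exceptional)
    fix \<zeta> assume \<zeta>: "\<zeta> \<in> frontier E - complex_of_real ` {x\<in>A. (potential D M x) < ennreal V}"
    then obtain x where x: "x \<in> A" "\<zeta> = of_real x" using frontier_E by blast
    then have "\<not> (potential D M x) < ennreal V" using \<zeta> by auto
    then have "(potential D M x) = ennreal V" using frostman[of x] by auto
    from green_boundary[OF x(1) this] show "(green \<longlongrightarrow> 0) (at \<zeta> within - E)" by (simp add: x)
  qed
qed (simp add: green_def)

text \<open>\<open>w\<close> is a potential from \<open>polar_barrier\<close>, continued to the
  plane. It behaves like \<open>- ln |z|\<close> far out, which \<open>green\<close> compensates.
  Its upper bound at a fixed \<open>z\<close> does not involve \<open>T\<close>, so division by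
  \<open>T\<close> makes it negligible there.\<close>

lemma barrier:
  assumes F: "compact F" "F \<subseteq> A" and T: "T \<ge> 0"
    and polar: "\<And>N. N \<in> prob_on F \<Longrightarrow> energy D N = \<infinity>"
  shows "\<exists>w. hol_grad w (- E) \<and> (\<forall>z. z \<notin> E \<longrightarrow> w z + green z \<ge> - 2) \<and>
    (\<forall>z. z \<notin> E \<longrightarrow> w z \<le> \<bar>ln D\<bar> + \<bar>ln (infdist z E)\<bar>) \<and>
    (\<forall>x\<in>F. \<exists>r>0. \<forall>z\<in>ball (of_real x) r - E. w z > T)"
proof (cases "F = {}")
  case True
  have "- 2 \<le> green z" for z using green_nonneg[of z] by linarith
  then show ?thesis using True by (intro exI[of _ "\<lambda>_. 0"]) (simp add: hol_grad_const)
next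
  case False
  obtain \<sigma> where \<sigma>: "\<sigma> \<in> prob_on F" and big: "\<And>x. x \<in> F \<Longrightarrow> ennreal (T + 1) \<le> potential D \<sigma> x"
    using polar_barrier[OF F(1) False D0 polar, of "T + 1"] by blast
  have sub: "complex_of_real ` F \<subseteq> E" using F by auto
  define w where "w z = ln D - log_potential \<sigma> z" for z
  have "hol_grad (\<lambda>z. 1 * ln D + (- 1) * log_potential \<sigma> z) (- complex_of_real ` F)"
    by (intro hol_grad_lincomb hol_grad_const log_potential_props(1)[OF \<sigma> F(1)])
  then have "hol_grad w (- E)" unfolding w_def using hol_grad_subset[of _ "- complex_of_real ` F" "- E"] sub by auto
  \<comment> \<open>Far out the potentials of \<open>M\<close> and \<open>\<sigma>\<close> differ by
    at most \<open>ln (5 / 4) - ln (3 / 4)\<close>; inside radius \<open>D\<close> one has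
    \<open>w z >= - ln 2\<close>. The constant 2 covers both.\<close>
  moreover have "w z + green z \<ge> - 2" if z: "z \<notin> E" for z
  proof (cases "cmod z \<ge> D")
    case True
    have "log_potential \<sigma> z \<le> ln (5 / 4) + ln (cmod z)" "ln (3 / 4) + ln (cmod z) \<le> log_potential M z"
      using log_potential_far(2)[OF \<sigma> F True] log_potential_far(1)[OF M A order_refl True] .
    moreover have "ln (5 / 4) \<le> (1 / 4 :: real)" using ln_le_minus_one[of "5 / 4"] by simp
    moreover have "- ln (3 / 4) \<le> (1 / 3 :: real)" using ln_le_minus_one[of "4 / 3"] by (simp add: ln_div)
    ultimately show ?thesis using V z by (simp add: w_def green_def)
  next
    case False
    have zF: "z \<notin> complex_of_real ` F" using z sub by auto
    have "log_potential \<sigma> z \<le> ln (2 * D)"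
    proof (rule log_potential_mono_bounds(1)[OF \<sigma> F(1) zF])
      show "cmod (z - of_real t) \<le> 2 * D" if "t \<in> F" for t
        using norm_triangle_ineq4[of z "of_real t"] D(2)[of t] that F False D0 by auto
    qed (use D0 in simp)
    also have "\<dots> = ln 2 + ln D" using D0 by (simp add: ln_mult)
    finally show ?thesis using green_nonneg[of z] ln_le_minus_one[of 2] by (simp add: w_def)
  qed
  moreover have "w z \<le> \<bar>ln D\<bar> + \<bar>ln (infdist z E)\<bar>" if z: "z \<notin> E" for z
  proof -
    have zF: "z \<notin> complex_of_real ` F" using z sub by auto
    have "E \<noteq> {}" using infinite_E by auto
    then have pos: "infdist z E > 0" using z closed_E by (simp add: infdist_pos_not_in_closed)
    have "ln (infdist z E) \<le> log_potential \<sigma> z"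
    proof (rule log_potential_mono_bounds(2)[OF \<sigma> F(1) zF pos])
      show "infdist z E \<le> cmod (z - of_real t)" if "t \<in> F" for t
        using infdist_le[of "of_real t" E z] that F by (auto simp: dist_norm)
    qed
    then show ?thesis by (simp add: w_def)
  qed
  moreover have "\<exists>r>0. \<forall>z\<in>ball (of_real x) r - E. w z > T" if x: "x \<in> F" for x
  proof -
    have "ennreal T < ennreal (T + 1)" using T by (simp add: ennreal_less_iff)
    then have "ennreal T < (potential D \<sigma> x)" using big[OF x] by (rule less_le_trans)
    then obtain r where "r > 0" "\<And>z. z \<in> ball (of_real x) r - complex_of_real ` F \<Longrightarrow> T < ln D - log_potential \<sigma> z"
      using log_potential_boundary[OF \<sigma> F(1) D0, of x T] D(2) F x by blast
    then show ?thesis using sub unfolding w_def by blast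
  qed
  ultimately show ?thesis by blast
qed

text \<open>A barrier that is large near the bad part of \<open>E\<close> and small at
  \<open>z0\<close> reduces this to \<open>harmonic_max_principle\<close>. The two exceptional sets,
  one for each function compared, meet in the argument only through their mass under finite energy
  measures, which is subadditive.\<close>

lemma extended_max_principle:
  assumes u: "harmonic_on u (- E)" and B: "\<And>z. z \<notin> E \<Longrightarrow> u z \<le> B" "B \<ge> 0"
    and N: "N1 \<in> sets borel" "capacity N1 = 0" "N2 \<in> sets borel" "capacity N2 = 0"
    and lim: "\<And>\<zeta>. \<zeta> \<in> E - N1 - N2 \<Longrightarrow> (u \<longlongrightarrow> 0) (at \<zeta> within - E)"
    and z0: "z0 \<notin> E"
  shows "u z0 \<le> 0"
proof (rule field_le_epsilon)
  fix e :: real assume e: "e > 0"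
  define \<delta> where "\<delta> = e / 3"
  have \<delta>: "\<delta> > 0" using e by (simp add: \<delta>_def)
  \<comment> \<open>Points where the limsup of \<open>u\<close> is at least \<open>\<delta>\<close>:
    a closed set, inside \<open>N1 \<union> N2\<close> because \<open>u\<close> tends to 0
    elsewhere.\<close>
  define F where "F = {x\<in>A. \<forall>r>0. \<forall>\<eta><\<delta>. \<exists>z\<in>ball (of_real x) r - E. u z > \<eta>}"
  have "closed F"
    unfolding closed_sequential_limits
  proof (intro allI impI)
    fix s x assume s: "(\<forall>n. s n \<in> F) \<and> s \<longlonglongrightarrow> x"
    have "x \<in> A" using closed_sequentially[OF compact_imp_closed[OF A], of s x] s by (auto simp: F_def)
    moreover have "\<exists>z\<in>ball (of_real x) r - E. u z > \<eta>" if r: "r > 0" "\<eta> < \<delta>" for r \<eta>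
    proof -
      have "eventually (\<lambda>n. dist (s n) x < r / 2) sequentially" using s r by (intro tendstoD) auto
      then obtain n where n: "dist (s n) x < r / 2" by (auto simp: eventually_sequentially)
      have "\<forall>r>0. \<forall>\<eta><\<delta>. \<exists>z\<in>ball (of_real (s n)) r - E. u z > \<eta>" using s by (simp add: F_def)
      moreover have "r / 2 > 0" using r by simp
      ultimately obtain z where z: "z \<in> ball (of_real (s n)) (r / 2) - E" "u z > \<eta>" using r(2) by blast
      have "dist (complex_of_real x) (of_real (s n)) < r / 2" using n by (simp add: dist_of_real dist_commute)
      then have "dist (of_real x) z < r" using z dist_triangle[of "of_real x" z "of_real (s n)"] by simp
      then show ?thesis using z by auto
    qed
    ultimately show "x \<in> F" by (simp add: F_def)
  qed
  moreover have FA: "F \<subseteq> A" by (auto simp: F_def)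
  ultimately have F: "compact F" using compact_Int_closed[OF A, of F] by (simp add: Int_absorb1)
  have FN: "of_real x \<in> N1 \<union> N2" if x: "x \<in> F" for x
  proof (rule ccontr)
    assume "of_real x \<notin> N1 \<union> N2"
    then have "(u \<longlongrightarrow> 0) (at (of_real x) within - E)" using x FA by (intro lim) auto
    then have "eventually (\<lambda>z. u z < \<delta> / 2) (at (of_real x) within - E)" using \<delta> by (intro order_tendstoD(2)) auto
    then obtain r where r: "r > 0" "\<And>z. z \<in> - E \<Longrightarrow> z \<noteq> of_real x \<Longrightarrow> dist z (of_real x) < r \<Longrightarrow> u z < \<delta> / 2"
      unfolding eventually_at by blast
    have "\<forall>r>0. \<forall>\<eta><\<delta>. \<exists>z\<in>ball (of_real x) r - E. u z > \<eta>" using x by (simp add: F_def)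
    moreover have "\<delta> / 2 < \<delta>" using \<delta> by simp
    ultimately obtain z where z: "z \<in> ball (of_real x) r - E" "u z > \<delta> / 2" using r(1) by blast
    then have "z \<noteq> of_real x" using x FA by auto
    then show False using r(2)[of z] z by (simp add: dist_commute)
  qed
  \<comment> \<open>A finite energy measure would give mass 0 to both exceptional sets, hence to
    \<open>F\<close>.\<close>
  have polar: "energy D N = \<infinity>" if NF: "N \<in> prob_on F" for N
  proof (rule ccontr)
    assume "energy D N \<noteq> \<infinity>"
    then have fin: "energy D N < \<infinity>" by (simp add: less_top)
    have Fb: "F \<in> sets borel" using F by (simp add: borel_compact)
    have FD: "\<bar>x\<bar> \<le> D / 2" if "x \<in> F" for x using D(2)[of x] FA that D0 by auto
    have sN: "sets N = sets borel" using NF prob_onD by blast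
    have b: "F \<inter> complex_of_real -` S \<in> sets N" if "S \<in> sets borel" for S
      using measurable_sets[of complex_of_real borel borel S] that Fb sN by auto
    have "emeasure N F \<le> emeasure N ((F \<inter> complex_of_real -` N1) \<union> (F \<inter> complex_of_real -` N2))"
      using FN N b by (intro emeasure_mono) auto
    also have "\<dots> \<le> emeasure N (F \<inter> complex_of_real -` N1) + emeasure N (F \<inter> complex_of_real -` N2)"
      using N b by (intro emeasure_subadditive) auto
    also have "\<dots> = 0"
      using finite_energy_null[OF NF Fb N(1,2) fin D(1) FD] finite_energy_null[OF NF Fb N(3,4) fin D(1) FD] by simp
    finally show False using prob_onD(4)[OF NF] by simp
  qed
  define C where "C = \<bar>ln D\<bar> + \<bar>ln (infdist z0 E)\<bar>"
  have est: "u z0 \<le> \<delta> + B / T * (C + green z0 + 2) + \<epsilon> * green z0" if T: "T > 0" and \<epsilon>: "\<epsilon> > 0" for T \<epsilon>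
  proof -
    obtain w where w: "hol_grad w (- E)" "\<And>z. z \<notin> E \<Longrightarrow> w z + green z \<ge> - 2"
      "\<And>z. z \<notin> E \<Longrightarrow> w z \<le> \<bar>ln D\<bar> + \<bar>ln (infdist z E)\<bar>"
      "\<And>x. x \<in> F \<Longrightarrow> \<exists>r>0. \<forall>z\<in>ball (of_real x) r - E. w z > T"
      using barrier[OF F FA less_imp_le[OF T] polar] by blast
    \<comment> \<open>Near \<open>F\<close> the barrier term is at least \<open>B\<close>, near the
      rest of \<open>E\<close> the constant \<open>\<delta>\<close> absorbs \<open>u\<close>, and
      \<open>\<epsilon> * green\<close> settles infinity.\<close>
    define \<Psi> where "\<Psi> z = u z - \<delta> - B / T * (w z + green z + 2) - \<epsilon> * green z" for z
    have nn: "B / T * (w z + green z + 2) \<ge> 0" "\<epsilon> * green z \<ge> 0" if "z \<notin> E" for z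
      using w(2)[OF that] B(2) T \<epsilon> green_nonneg[of z] by (auto intro!: mult_nonneg_nonneg divide_nonneg_pos)
    have "\<Psi> z0 \<le> 0"
    proof (rule harmonic_max_principle[OF closed_E])
      have hg: "harmonic_on green (- E)" "harmonic_on w (- E)" "harmonic_on (\<lambda>_. 1) (- E)"
        by (intro hol_grad_harmonic[OF open_E] hol_grad_green w hol_grad_const)+
      have "harmonic_on (\<lambda>z. 1 * (1 * u z + (- \<delta> - B / T * 2) * 1) + 1 * ((- B / T) * w z + (- B / T - \<epsilon>) * green z)) (- E)"
        by (intro harmonic_on_lincomb u hg)
      then show "harmonic_on \<Psi> (- E)"
        by (rule harmonic_on_cong[OF _ open_E]) (simp add: \<Psi>_def algebra_simps)
    next
      fix \<zeta> \<eta> assume \<zeta>: "\<zeta> \<in> E" and \<eta>: "(\<eta>::real) > 0"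
      then obtain x where x: "x \<in> A" "\<zeta> = of_real x" by blast
      show "\<exists>r>0. \<forall>z\<in>ball \<zeta> r - E. \<Psi> z < \<eta>"
      proof (cases "x \<in> F")
        case True
        obtain r where r: "r > 0" "\<And>z. z \<in> ball \<zeta> r - E \<Longrightarrow> w z > T" using w(4)[OF True] x by blast
        have "\<Psi> z < \<eta>" if z: "z \<in> ball \<zeta> r - E" for z
        proof -
          have "B / T * T \<le> B / T * (w z + green z + 2)"
            using r(2)[OF z] green_nonneg[of z] B(2) T by (intro mult_left_mono) auto
          then have "B \<le> B / T * (w z + green z + 2)" using T by simp
          then show ?thesis using B(1)[of z] nn(2)[of z] z \<delta> \<eta> unfolding \<Psi>_def by simp
        qed
        then show ?thesis using r(1) by blast
      next
        case False
        then obtain r \<eta>' where r: "r > 0" "\<eta>' < \<delta>" "\<And>z. z \<in> ball \<zeta> r - E \<Longrightarrow> u z \<le> \<eta>'"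
          using x by (auto simp: F_def not_less)
        have "\<Psi> z < \<eta>" if z: "z \<in> ball \<zeta> r - E" for z
          using r(2) r(3)[OF z] nn[of z] z \<eta> unfolding \<Psi>_def by simp
        then show ?thesis using r(1) by blast
      qed
    next
      fix \<eta> :: real assume \<eta>: "\<eta> > 0"
      obtain R where R: "\<And>z. cmod z \<ge> R \<Longrightarrow> z \<notin> E \<and> B / \<epsilon> \<le> green z" using green_large by blast
      have "\<Psi> z < \<eta>" if "z \<notin> E" "cmod z \<ge> R" for z
      proof -
        have "B \<le> \<epsilon> * green z" using R[OF that(2)] \<epsilon> by (simp add: field_simps)
        then show ?thesis using B(1)[OF that(1)] nn(1)[OF that(1)] \<delta> \<eta> unfolding \<Psi>_def by simp
      qed
      then show "\<exists>R. \<forall>z. z \<notin> E \<longrightarrow> R \<le> cmod z \<longrightarrow> \<Psi> z < \<eta>" by blast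
    qed (rule z0)
    moreover have "B / T * (w z0 + green z0 + 2) \<le> B / T * (C + green z0 + 2)"
      using w(3)[OF z0] B(2) T by (intro mult_left_mono) (auto simp: C_def)
    ultimately show ?thesis unfolding \<Psi>_def by linarith
  qed
  define K where "K = C + green z0 + 2"
  have K: "K > 0" using green_nonneg[of z0] by (simp add: K_def C_def)
  \<comment> \<open>\<open>T\<close> and \<open>\<epsilon>\<close> are chosen so that each error is
    at most \<open>\<delta>\<close>, a third of \<open>e\<close>; the summands 1 keep
    \<open>T\<close> and the denominator positive.\<close>
  have "u z0 \<le> \<delta> + B / ((B * K + 1) / \<delta>) * K + \<delta> / (green z0 + 1) * green z0"
    using est[of "(B * K + 1) / \<delta>" "\<delta> / (green z0 + 1)"] \<delta> K B(2) green_nonneg[of z0]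
    unfolding K_def[symmetric] by (simp add: add_nonneg_pos)
  moreover have "B / ((B * K + 1) / \<delta>) * K \<le> \<delta>"
  proof -
    have p: "B * K + 1 > 0" using B(2) K by (simp add: add_nonneg_pos)
    have "B / ((B * K + 1) / \<delta>) * K = \<delta> * (B * K / (B * K + 1))" by simp
    also have "\<dots> \<le> \<delta> * 1" using p \<delta> by (intro mult_left_mono) auto
    finally show ?thesis by simp
  qed
  moreover have "\<delta> / (green z0 + 1) * green z0 \<le> \<delta>"
  proof -
    have "\<delta> / (green z0 + 1) * green z0 = \<delta> * (green z0 / (green z0 + 1))" by simp
    also have "\<dots> \<le> \<delta> * 1" using green_nonneg[of z0] \<delta> by (intro mult_left_mono) auto
    finally show ?thesis by simp
  qed
  ultimately have "u z0 \<le> \<delta> + \<delta> + \<delta>" by linarith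
  then show "u z0 \<le> 0 + e" by (simp add: \<delta>_def)
qed

section \<open>Uniqueness of the Green function\<close>

lemma E_subset_frontier: "E \<subseteq> frontier E"
proof -
  have "interior E = {}"
  proof (rule ccontr)
    assume "interior E \<noteq> {}"
    then obtain z r where r: "r > 0" "ball z r \<subseteq> E" by (auto simp: mem_interior)
    have "z \<in> E" "z + \<i> * of_real (r / 2) \<in> E" using r by (auto simp: subset_eq dist_norm norm_mult)
    then show False using r(1) by (auto simp: complex_eq_iff)
  qed
  then show ?thesis using closed_E by (simp add: frontier_def)
qed

lemma is_green_function_bounded_diff:
  assumes g: "is_green_function E g" and h: "is_green_function E h"
  obtains B where "B \<ge> 0" "\<And>z. z \<notin> E \<Longrightarrow> g z - h z \<le> B" "\<And>z. z \<notin> E \<Longrightarrow> h z - g z \<le> B"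
proof -
  have far: "\<exists>c R. \<forall>z. cmod z \<ge> R \<longrightarrow> \<bar>f z - ln (cmod z)\<bar> \<le> c" if "is_green_function E f" for f
  proof -
    have "(\<lambda>z. f z - ln (cmod z)) \<in> O[at_infinity](\<lambda>_. 1)" using that by (simp add: is_green_function_def)
    then obtain c where "eventually (\<lambda>z. norm (f z - ln (cmod z)) \<le> c * norm (1::real)) at_infinity"
      by (rule landau_o.bigE)
    then show ?thesis by (auto simp: eventually_at_infinity)
  qed
  obtain c1 R1 where 1: "\<And>z. cmod z \<ge> R1 \<Longrightarrow> \<bar>g z - ln (cmod z)\<bar> \<le> c1" using far[OF g] by blast
  obtain c2 R2 where 2: "\<And>z. cmod z \<ge> R2 \<Longrightarrow> \<bar>h z - ln (cmod z)\<bar> \<le> c2" using far[OF h] by blast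
  define R where "R = max R1 R2"
  have "bounded (g ` (cball 0 R - E))" "bounded (h ` (cball 0 R - E))" using g h by (auto simp: is_green_function_def)
  then obtain b1 b2 where b: "\<And>z. z \<in> cball 0 R - E \<Longrightarrow> \<bar>g z\<bar> \<le> b1" "\<And>z. z \<in> cball 0 R - E \<Longrightarrow> \<bar>h z\<bar> \<le> b2"
    unfolding bounded_iff by (metis imageI real_norm_def)
  have "\<bar>g z - h z\<bar> \<le> \<bar>c1\<bar> + \<bar>c2\<bar> + \<bar>b1\<bar> + \<bar>b2\<bar>" if z: "z \<notin> E" for z
  proof (cases "cmod z \<le> R")
    case True
    then have "\<bar>g z\<bar> \<le> b1" "\<bar>h z\<bar> \<le> b2" using b[of z] z by auto
    then show ?thesis by linarith
  next
    case False
    then have "\<bar>g z - ln (cmod z)\<bar> \<le> c1" "\<bar>h z - ln (cmod z)\<bar> \<le> c2" using 1[of z] 2[of z] by (auto simp: R_def)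
    then show ?thesis by linarith
  qed
  then have "g z - h z \<le> \<bar>c1\<bar> + \<bar>c2\<bar> + \<bar>b1\<bar> + \<bar>b2\<bar>" "h z - g z \<le> \<bar>c1\<bar> + \<bar>c2\<bar> + \<bar>b1\<bar> + \<bar>b2\<bar>" if "z \<notin> E" for z
    using that by (meson abs_le_D1, metis abs_le_D2 minus_diff_eq)
  then show ?thesis by (intro that[of "\<bar>c1\<bar> + \<bar>c2\<bar> + \<bar>b1\<bar> + \<bar>b2\<bar>"]) auto
qed

lemma is_green_function_le:
  assumes g: "is_green_function E g" and h: "is_green_function E h" and z: "z \<notin> E"
  shows "g z \<le> h z"
proof -
  obtain B where B: "B \<ge> 0" "\<And>z. z \<notin> E \<Longrightarrow> g z - h z \<le> B"
    by (rule is_green_function_bounded_diff[OF g h]) blast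
  obtain N1 where N1: "N1 \<in> sets borel" "capacity N1 = 0" "\<And>\<zeta>. \<zeta> \<in> frontier E - N1 \<Longrightarrow> (g \<longlongrightarrow> 0) (at \<zeta> within - E)"
    using g unfolding is_green_function_def by blast
  obtain N2 where N2: "N2 \<in> sets borel" "capacity N2 = 0" "\<And>\<zeta>. \<zeta> \<in> frontier E - N2 \<Longrightarrow> (h \<longlongrightarrow> 0) (at \<zeta> within - E)"
    using h unfolding is_green_function_def by blast
  have hm: "harmonic_on g (- E)" "harmonic_on h (- E)" using g h by (simp_all add: is_green_function_def)
  have "g z - h z \<le> 0"
  proof (rule extended_max_principle[OF _ B(2) B(1) N1(1,2) N2(1,2) _ z])
    show "harmonic_on (\<lambda>z. g z - h z) (- E)" using harmonic_on_lincomb[OF hm, of 1 "-1"] by simp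
    show "((\<lambda>z. g z - h z) \<longlongrightarrow> 0) (at \<zeta> within - E)" if \<zeta>: "\<zeta> \<in> E - N1 - N2" for \<zeta>
    proof -
      have "\<zeta> \<in> frontier E" using \<zeta> E_subset_frontier by blast
      then show ?thesis using tendsto_diff[OF N1(3) N2(3)] \<zeta> by fastforce
    qed
  qed
  then show ?thesis by simp
qed

lemma green_function_eq: "green_function E = green"
  unfolding green_function_def
proof (rule the_equality)
  show "is_green_function E green" by (rule is_green_function_green)
next
  fix g assume g: "is_green_function E g"
  show "g = green"
  proof
    fix z
    show "g z = green z"
    proof (cases "z \<in> E")
      case True
      moreover have "\<forall>z\<in>E. g z = 0" using g unfolding is_green_function_def by blast
      ultimately show ?thesis using bspec[of E "\<lambda>z. g z = 0" z] by (simp add: green_def)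
    next
      case False
      then show ?thesis
        using is_green_function_le[OF g is_green_function_green False] is_green_function_le[OF is_green_function_green g False]
        by simp
    qed
  qed
qed

section \<open>The Bernstein-Walsh inequality\<close>

lemma poly_norm_bound:
  fixes p :: "complex poly"
  assumes "degree p \<le> n"
  obtains C where "C > 0" "\<And>z. cmod z \<ge> 1 \<Longrightarrow> cmod (poly p z) \<le> C * cmod z ^ n"
proof -
  have "cmod (poly p z) \<le> ((\<Sum>i\<le>degree p. cmod (coeff p i)) + 1) * cmod z ^ n" if z: "cmod z \<ge> 1" for z
  proof -
    have "cmod (poly p z) \<le> (\<Sum>i\<le>degree p. cmod (coeff p i * z ^ i))"
      unfolding poly_altdef by (rule norm_sum)
    also have "\<dots> \<le> (\<Sum>i\<le>degree p. cmod (coeff p i) * cmod z ^ n)"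
      unfolding norm_mult norm_power using z assms
      by (intro sum_mono mult_left_mono power_increasing) auto
    also have "\<dots> = (\<Sum>i\<le>degree p. cmod (coeff p i)) * cmod z ^ n" by (simp add: sum_distrib_right)
    also have "\<dots> \<le> ((\<Sum>i\<le>degree p. cmod (coeff p i)) + 1) * cmod z ^ n" by (intro mult_right_mono) auto
    finally show ?thesis .
  qed
  moreover have "(\<Sum>i\<le>degree p. cmod (coeff p i)) + 1 > 0" by (intro add_nonneg_pos sum_nonneg) auto
  ultimately show ?thesis using that by blast
qed

text \<open>Maximum principle for \<open>ln |p| - (n + \<epsilon>) G\<close> off \<open>E\<close>
  and the zeros of \<open>p\<close>. The surplus \<open>\<epsilon> G\<close> makes it nonpositive
  far out, where \<open>ln |p| - n G\<close> is merely bounded above; near \<open>E\<close> and near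
  zeros \<open>ln |p|\<close> itself is small enough.\<close>

lemma Bernstein_Walsh:
  assumes p: "degree p \<le> n" and le: "\<And>z. z \<in> E \<Longrightarrow> cmod (poly p z) \<le> 1" and z: "z \<notin> E" "poly p z \<noteq> 0"
  shows "ln (cmod (poly p z)) \<le> n * green z"
proof (rule field_le_epsilon)
  fix e :: real assume e: "e > 0"
  define \<epsilon> where "\<epsilon> = e / (green z + 1)"
  have \<epsilon>: "\<epsilon> > 0" using e green_nonneg[of z] by (simp add: \<epsilon>_def add_nonneg_pos)
  have p0: "p \<noteq> 0" using z by auto
  define S where "S = E \<union> {z. poly p z = 0}"
  have S: "closed S" unfolding S_def by (intro closed_Un closed_E finite_imp_closed poly_roots_finite p0)
  define u where "u z = ln (cmod (poly p z)) - (n + \<epsilon>) * green z" for z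
  have "u z \<le> 0"
  proof (rule harmonic_max_principle[OF S])
    have "hol_grad (\<lambda>z. 1 * ln (cmod (poly p z)) + (- (n + \<epsilon>)) * green z) (- S)"
      by (intro hol_grad_lincomb hol_grad_ln_poly hol_grad_subset[OF hol_grad_green]) (auto simp: S_def)
    moreover have "(\<lambda>z. 1 * ln (cmod (poly p z)) + (- (n + \<epsilon>)) * green z) = u"
      by (simp add: u_def fun_eq_iff algebra_simps)
    ultimately show "harmonic_on u (- S)" using S by (intro hol_grad_harmonic) (auto simp: open_Compl)
    have small: "u w \<le> ln (cmod (poly p w))" for w using green_nonneg[of w] \<epsilon> by (simp add: u_def)
    show "\<exists>r>0. \<forall>z\<in>ball \<zeta> r - S. u z < \<eta>" if \<zeta>: "\<zeta> \<in> S" and \<eta>: "\<eta> > 0" for \<zeta> \<eta>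
    proof -
      have "cmod (poly p \<zeta>) < exp \<eta>"
        using \<zeta> \<eta> le[of \<zeta>] unfolding S_def by (auto intro: le_less_trans[of _ 1])
      moreover have "open {z. cmod (poly p z) < exp \<eta>}" by (intro open_Collect_less continuous_intros)
      ultimately obtain r where r: "r > 0" "ball \<zeta> r \<subseteq> {z. cmod (poly p z) < exp \<eta>}"
        unfolding open_contains_ball by blast
      have "u z < \<eta>" if "z \<in> ball \<zeta> r - S" for z
      proof -
        have "cmod (poly p z) < exp \<eta>" "cmod (poly p z) > 0" using that r(2) by (auto simp: S_def)
        then have "ln (cmod (poly p z)) < \<eta>" by (metis exp_less_cancel_iff exp_ln)
        then show ?thesis using small[of z] by simp
      qed
      then show ?thesis using r(1) by blast
    qed
    obtain C where C: "C > 0" "\<And>z. cmod z \<ge> 1 \<Longrightarrow> cmod (poly p z) \<le> C * cmod z ^ n"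
      using poly_norm_bound[OF p] by blast
    \<comment> \<open>Where \<open>green\<close> is at least \<open>K\<close>, the surplus dominates
      the constant left over at infinity.\<close>
    define K where "K = (ln C - n * (V - ln D + ln (3 / 4))) / \<epsilon>"
    obtain R where R: "\<And>z. cmod z \<ge> R \<Longrightarrow> z \<notin> E \<and> K \<le> green z" using green_large[of K] by blast
    show "\<exists>R. \<forall>z. z \<notin> S \<longrightarrow> R \<le> cmod z \<longrightarrow> u z < \<eta>" if \<eta>: "\<eta> > 0" for \<eta>
    proof (intro exI allI impI)
      fix z assume zS: "z \<notin> S" and z: "max R D \<le> cmod z"
      have z1: "cmod z \<ge> 1" using z D(1) by simp
      have nz: "cmod (poly p z) > 0" using zS by (simp add: S_def)
      have "ln (cmod (poly p z)) \<le> ln (C * cmod z ^ n)" using nz C(2)[OF z1] by (intro ln_mono) auto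
      also have "\<dots> = ln C + n * ln (cmod z)" using C(1) z1 by (subst ln_mult) (auto simp: ln_realpow)
      also have "\<dots> \<le> ln C + n * (green z - (V - ln D + ln (3 / 4)))"
        using green_far(1)[of z] z by (intro add_left_mono mult_left_mono) auto
      also have "\<dots> = n * green z + \<epsilon> * K"
      proof -
        have "\<epsilon> * K = ln C - n * (V - ln D + ln (3 / 4))" using \<epsilon> by (simp add: K_def)
        then show ?thesis by (simp add: algebra_simps)
      qed
      also have "\<dots> \<le> n * green z + \<epsilon> * green z" using R[of z] z \<epsilon> by (intro add_left_mono mult_left_mono) auto
      finally have "u z \<le> 0" by (simp add: u_def algebra_simps)
      then show "u z < \<eta>" using \<eta> by simp
    qed
  qed (use z in \<open>simp add: S_def\<close>)
  moreover have "\<epsilon> * green z \<le> e"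
  proof -
    have "\<epsilon> * green z = e * (green z / (green z + 1))" by (simp add: \<epsilon>_def)
    also have "\<dots> \<le> e * 1" using green_nonneg[of z] e by (intro mult_left_mono) auto
    finally show ?thesis by simp
  qed
  ultimately show "ln (cmod (poly p z)) \<le> n * green z + e" by (simp add: u_def algebra_simps)
qed

end

section \<open>Growth of extremal polynomials\<close>

context equilibrium begin

text \<open>Up to constants this is boundedness of the Widom factors at \<open>a\<close>. It makes sense for all
  complex \<open>a\<close>, which allows to pass from one real point to another through the half plane.\<close>

definition extremal_growth_at :: "complex \<Rightarrow> bool" where
  "extremal_growth_at a \<longleftrightarrow> (\<exists>C>0. \<forall>n\<ge>1. \<exists>p. degree p \<le> n \<and> (\<forall>z\<in>E. cmod (poly p z) \<le> 1) \<and>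
     exp (n * green a) \<le> C * cmod (poly p a))"

text \<open>\<open>green z - ln |z|\<close> tends to \<open>V - ln D\<close>, so
  \<open>n * (V - ln D) - ln |lead_coeff p|\<close> is the limit of \<open>n G - ln |p|\<close> at
  infinity. The degree is exactly \<open>n\<close>, since otherwise that limit would be
  infinite.\<close>

definition extremal_growth_at_infinity :: bool where
  "extremal_growth_at_infinity \<longleftrightarrow> (\<exists>C>0. \<forall>n\<ge>1. \<exists>p. degree p = n \<and> (\<forall>z\<in>E. cmod (poly p z) \<le> 1) \<and>
     exp (n * (V - ln D)) \<le> C * cmod (lead_coeff p))"

lemma exp_le_mult_iff:
  fixes C y :: real
  assumes "C > 0" "y \<ge> 0" shows "exp x \<le> C * y \<longleftrightarrow> y > 0 \<and> x - ln y \<le> ln C"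
proof (cases "y = 0")
  case False
  then have y: "y > 0" using assms by simp
  have "exp x \<le> C * y \<longleftrightarrow> x \<le> ln (C * y)" using assms y by (subst ln_ge_iff) auto
  then show ?thesis using assms y by (auto simp: ln_mult)
qed (simp add: not_le)

text \<open>Zeros within \<open>2 \<rho>\<close> of \<open>c\<close> are at most
  \<open>3 \<rho>\<close> from \<open>a\<close> and \<open>b\<close> and at least
  \<open>3 \<rho>\<close> from \<open>E\<close>, so the constant \<open>3 \<rho>\<close> can replace
  their factors. Harnack in that disc, between \<open>b\<close> and \<open>c\<close> and between
  \<open>c\<close> and \<open>a\<close>, costs \<open>3 * 3 = 9\<close>, and \<open>C\<close>
  becomes \<open>C^9\<close> for every \<open>n\<close>.\<close>

lemma extremal_growth_local:
  assumes \<rho>: "\<rho> > 0" and E: "ball c (5 * \<rho>) \<inter> E = {}" and a: "dist c a \<le> \<rho>" and b: "dist c b \<le> \<rho>"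
    and good: "extremal_growth_at a"
  shows "extremal_growth_at b"
proof -
  obtain C where C: "C > 0" and ex: "\<And>n. n \<ge> 1 \<Longrightarrow> \<exists>p. degree p \<le> n \<and> (\<forall>z\<in>E. cmod (poly p z) \<le> 1) \<and>
     exp (real n * green a) \<le> C * cmod (poly p a)"
    using good by (auto simp: extremal_growth_at_def)
  have "\<exists>q. degree q \<le> n \<and> (\<forall>z\<in>E. cmod (poly q z) \<le> 1) \<and> exp (real n * green b) \<le> exp (9 * ln C) * cmod (poly q b)"
    if n: "n \<ge> 1" for n
  proof -
    obtain p where p: "degree p \<le> n" "\<And>z. z \<in> E \<Longrightarrow> cmod (poly p z) \<le> 1" "exp (real n * green a) \<le> C * cmod (poly p a)"
      using ex[OF n] by blast
    have pa: "cmod (poly p a) > 0" "n * green a - ln (cmod (poly p a)) \<le> ln C"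
      using p(3) C by (simp_all add: exp_le_mult_iff)
    then have p0: "p \<noteq> 0" by auto
    let ?S = "ball c (2 * \<rho>)"
    have far: "3 * \<rho> \<le> cmod (z - \<zeta>)" if "\<zeta> \<in> ?S" "z \<in> E" for z \<zeta>
    proof -
      have "dist c z \<ge> 5 * \<rho>" using E that(2) by (auto simp: disjoint_iff not_less)
      then show ?thesis using dist_triangle[of c z \<zeta>] that(1) by (simp add: dist_norm norm_minus_commute)
    qed
    have near: "cmod (x - \<zeta>) \<le> 3 * \<rho>" if "\<zeta> \<in> ?S" "dist c x \<le> \<rho>" for x \<zeta>
      using dist_triangle[of x \<zeta> c] that by (simp add: dist_norm norm_minus_commute)
    have r: "[:of_real (3 * \<rho>):] \<noteq> (0::complex poly) \<and> degree [:complex_of_real (3 * \<rho>):] \<le> 1 \<and>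
        (\<forall>z\<in>?S. poly [:complex_of_real (3 * \<rho>):] z \<noteq> 0) \<and>
        (\<forall>z\<in>E. cmod (poly [:complex_of_real (3 * \<rho>):] z) \<le> cmod (z - \<zeta>))" if "\<zeta> \<in> ?S" for \<zeta>
      using \<rho> far[OF that] by (auto simp: norm_mult)
    obtain q where q: "q \<noteq> 0" "degree q \<le> degree p" "\<And>z. z \<in> ?S \<Longrightarrow> poly q z \<noteq> 0"
      "\<And>z. z \<in> E \<Longrightarrow> cmod (poly q z) \<le> cmod (poly p z)"
      "\<And>x. \<forall>\<zeta>\<in>?S. cmod (x - \<zeta>) \<le> cmod (poly [:of_real (3 * \<rho>):] x) \<Longrightarrow> cmod (poly p x) \<le> cmod (poly q x)"
      by (rule replace_zeros[of p ?S "\<lambda>_. [:of_real (3 * \<rho>):]" E, OF p0 r]) (assumption, (rule that; assumption))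
    have q1: "cmod (poly q z) \<le> 1" if "z \<in> E" for z using q(4)[OF that] p(2)[OF that] by simp
    have qa: "cmod (poly p a) \<le> cmod (poly q a)" by (rule q(5)) (use near a \<rho> in \<open>simp add: norm_mult\<close>)
    define h where "h z = n * green z - ln (cmod (poly q z))" for z
    have "?S \<subseteq> ball c (5 * \<rho>)" using \<rho> by (intro subset_ball) simp
    then have SE: "?S \<subseteq> - E" using E by blast
    have hg: "hol_grad h ?S"
    proof -
      have "hol_grad (\<lambda>z. real n * green z + (- 1) * ln (cmod (poly q z))) ?S"
        by (intro hol_grad_lincomb hol_grad_subset[OF hol_grad_green SE] hol_grad_ln_poly q)
      then show ?thesis unfolding h_def by simp
    qed
    have pos: "h z \<ge> 0" if "z \<in> ?S" for z
      using Bernstein_Walsh[of q n z] q(2) p(1) q1 q(3)[OF that] SE that by (auto simp: h_def)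
    have "h b \<le> 3 * h c" using Harnack(1)[OF _ hg pos, of b] b \<rho> by simp
    also have "h c \<le> 3 * h a" using Harnack(2)[OF _ hg pos, of a] a \<rho> by simp
    finally have "h b \<le> 9 * h a" by simp
    moreover have "h a \<le> ln C"
    proof -
      have "ln (cmod (poly p a)) \<le> ln (cmod (poly q a))" using qa pa by (intro ln_mono) auto
      then show ?thesis using pa(2) by (simp add: h_def)
    qed
    ultimately have hb: "n * green b - ln (cmod (poly q b)) \<le> ln (exp (9 * ln C))" by (simp add: h_def)
    have "poly q b \<noteq> 0" using q(3)[of b] b \<rho> by simp
    then have "exp (real n * green b) \<le> exp (9 * ln C) * cmod (poly q b)"
      using hb by (subst exp_le_mult_iff) auto
    then show ?thesis using q(2) p(1) q1 by (intro exI[of _ q]) auto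
  qed
  then show ?thesis unfolding extremal_growth_at_def by (intro exI[of _ "exp (9 * ln C)"]) auto
qed

lemma extremal_growth_connected:
  assumes S: "connected S" "S \<inter> E = {}" and ab: "a \<in> S" "b \<in> S"
  shows "extremal_growth_at a \<longleftrightarrow> extremal_growth_at b"
proof (rule connected_local_const[OF S(1) ab], rule ballI)
  fix c assume "c \<in> S"
  then obtain r where r: "r > 0" "ball c r \<subseteq> - E" using S(2) open_E by (metis ComplI disjoint_iff open_contains_ball)
  define \<rho> where "\<rho> = r / 5"
  have \<rho>: "\<rho> > 0" "ball c (5 * \<rho>) \<inter> E = {}" using r by (auto simp: \<rho>_def)
  have "extremal_growth_at c = extremal_growth_at x" if "dist x c < \<rho>" for x
    using extremal_growth_local[OF \<rho>, of c x] extremal_growth_local[OF \<rho>, of x c] that \<rho>(1)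
    by (auto simp: dist_commute)
  then show "eventually (\<lambda>x. extremal_growth_at c = extremal_growth_at x) (at c within S)"
    unfolding eventually_at using \<rho>(1) by blast
qed

text \<open>The segment from \<open>x\<close> to \<open>\<i>\<close> meets the real axis only in
  \<open>x\<close>, so \<open>\<i>\<close> is a common base point for all gaps of
  \<open>E\<close>.\<close>

lemma extremal_growth_real:
  assumes "of_real x \<notin> E"
  shows "extremal_growth_at (of_real x) \<longleftrightarrow> extremal_growth_at \<i>"
proof (rule extremal_growth_connected)
  show "closed_segment (of_real x) \<i> \<inter> E = {}"
    using assms by (auto simp: closed_segment_def complex_eq_iff)
qed auto

text \<open>In the coordinate \<open>\<zeta> = 1 / z\<close> the function \<open>n G - ln |q|\<close> extends harmonically to \<open>\<zeta> = 0\<close>.\<close>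

lemma Harnack_at_infinity:
  assumes q: "q \<noteq> 0" "degree q = n" "\<And>z. cmod z > D \<Longrightarrow> poly q z \<noteq> 0" "\<And>z. z \<in> E \<Longrightarrow> cmod (poly q z) \<le> 1"
    and b: "cmod b \<ge> 2 * D"
  defines "h0 \<equiv> n * (V - ln D) - ln (cmod (lead_coeff q))"
  defines "hb \<equiv> n * green b - ln (cmod (poly q b))"
  shows "hb \<le> 3 * h0" "h0 \<le> 3 * hb"
proof -
  interpret prob_space M using M prob_onD by blast
  have sM [measurable_cong]: "sets M = sets borel" using M prob_onD by blast
  have Ab: "A \<in> sets borel" using A by (simp add: borel_compact)
  have AE: "AE t in M. t \<in> A" by (rule prob_on_AE[OF M Ab])
  \<comment> \<open>With \<open>\<zeta> = 1 / z\<close> this is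
    \<open>log_potential M z - ln |z|\<close>, extended by the value 0 at
    \<open>\<zeta> = 0\<close>.\<close>
  define u where "u \<zeta> = (\<integral>t. ln (cmod (1 + (- of_real t) * \<zeta>)) \<partial>M)" for \<zeta> :: complex
  let ?S = "ball 0 (1 / D) :: complex set"
  have hu: "hol_grad u ?S" unfolding u_def
  proof (rule hol_grad_integral_ln(1)[OF prob_space_axioms])
    show "AE t in M. cmod (1::complex) \<le> max 1 D" by simp
    show "AE t in M. cmod (- of_real t) \<le> max 1 D"
      using AE by eventually_elim (use D D0 in fastforce)
    show "\<exists>\<delta>>0. AE t in M. \<delta> \<le> cmod (1 + (- of_real t) * \<zeta>)" if \<zeta>: "\<zeta> \<in> ?S" for \<zeta>
    proof (intro exI conjI)
      show "AE t in M. 3 / 4 \<le> cmod (1 + (- of_real t) * \<zeta>)"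
        using AE
      proof eventually_elim
        case (elim t)
        have "cmod (of_real t * \<zeta>) \<le> D / 4 * (1 / D)"
          unfolding norm_mult using D(2)[OF elim] \<zeta> D0 by (intro mult_mono) auto
        also have "\<dots> = 1 / 4" using D0 by simp
        finally show ?case using norm_triangle_ineq2[of 1 "of_real t * \<zeta>"] by simp
      qed
    qed simp
  qed auto
  have rq: "poly (reflect_poly q) \<zeta> \<noteq> 0" if "\<zeta> \<in> ?S" for \<zeta>
  proof (cases "\<zeta> = 0")
    case False
    have "cmod (inverse \<zeta>) > D" unfolding norm_inverse using that False D0 by (simp add: field_simps)
    then show ?thesis using q(3) False by (simp add: poly_reflect_poly_nz)
  qed (use q(1) in simp)
  \<comment> \<open>\<open>reflect_poly q\<close> takes the value \<open>lead_coeff q\<close> at 0,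
    so \<open>H 0 = h0\<close>.\<close>
  define H where "H \<zeta> = n * (V - ln D) + n * u \<zeta> - ln (cmod (poly (reflect_poly q) \<zeta>))" for \<zeta>
  have hH: "hol_grad H ?S"
  proof -
    have "hol_grad (\<lambda>\<zeta>. 1 * (n * (V - ln D)) + 1 * (real n * u \<zeta> + (- 1) * ln (cmod (poly (reflect_poly q) \<zeta>)))) ?S"
      by (intro hol_grad_lincomb hol_grad_const hu hol_grad_ln_poly rq)
    then show ?thesis unfolding H_def by (simp add: add_diff_eq)
  qed
  have H: "H \<zeta> = n * green (inverse \<zeta>) - ln (cmod (poly q (inverse \<zeta>)))" "H \<zeta> \<ge> 0" if \<zeta>: "\<zeta> \<in> ?S" "\<zeta> \<noteq> 0" for \<zeta>
  proof -
    define z where "z = inverse \<zeta>"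
    have z: "cmod z > D" unfolding z_def norm_inverse using \<zeta> D0 by (simp add: field_simps)
    have zE: "z \<notin> E" using far_not_in_E[of z] z by simp
    have qz: "poly q z \<noteq> 0" by (rule q(3)[OF z])
    have "u \<zeta> = (\<integral>t. ln (cmod (z - of_real t)) + ln (cmod \<zeta>) \<partial>M)"
      unfolding u_def
    proof (rule integral_cong_AE)
      show "AE t in M. ln (cmod (1 + (- of_real t) * \<zeta>)) = ln (cmod (z - of_real t)) + ln (cmod \<zeta>)"
        using AE
      proof eventually_elim
        case (elim t)
        have "1 + (- of_real t) * \<zeta> = (z - of_real t) * \<zeta>" using \<zeta>(2) by (simp add: z_def algebra_simps)
        moreover have "z - of_real t \<noteq> 0" using zE elim by auto
        ultimately show ?case using \<zeta>(2) by (simp add: norm_mult ln_mult)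
      qed
    qed measurable
    also have "\<dots> = log_potential M z + ln (cmod \<zeta>)"
      using log_potential_props(2)[OF M A zE] by (simp add: log_potential_def prob_space)
    finally have uz: "u \<zeta> = log_potential M z + ln (cmod \<zeta>)" .
    have "ln (cmod (poly (reflect_poly q) \<zeta>)) = n * ln (cmod \<zeta>) + ln (cmod (poly q z))"
      using \<zeta>(2) qz q(2) by (simp add: poly_reflect_poly_nz z_def norm_mult norm_power ln_mult ln_realpow)
    then have "H \<zeta> = n * green z - ln (cmod (poly q z))"
      using zE by (simp add: H_def uz green_def algebra_simps)
    then show "H \<zeta> = n * green (inverse \<zeta>) - ln (cmod (poly q (inverse \<zeta>)))" by (simp add: z_def)
    then show "H \<zeta> \<ge> 0" using Bernstein_Walsh[of q n z] q zE qz by (simp add: z_def)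
  qed
  have u0: "u 0 = 0" by (simp add: u_def)
  have H0: "H 0 = h0" using u0 by (simp add: H_def h0_def)
  \<comment> \<open>Bernstein-Walsh covers the punctured disc; continuity adds its centre.\<close>
  have "H 0 \<ge> 0"
  proof (rule tendsto_lowerbound)
    show "(H \<longlongrightarrow> H 0) (at 0)" using hol_grad_continuous[OF hH, of 0] D0 by (simp add: isCont_def)
    show "eventually (\<lambda>\<zeta>. 0 \<le> H \<zeta>) (at 0)"
      unfolding eventually_at using H(2) D0 by (intro exI[of _ "1 / D"]) (auto simp: dist_commute)
  qed simp
  then have pos: "H \<zeta> \<ge> 0" if "\<zeta> \<in> ?S" for \<zeta> using H(2)[OF that] by (cases "\<zeta> = 0") auto
  have b0: "cmod b > 0" using b D0 by linarith
  \<comment> \<open>\<open>|b| >= 2 * D\<close> puts \<open>1 / b\<close> within half the radius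
    \<open>1 / D\<close>, as Harnack requires.\<close>
  have ib: "dist 0 (inverse b) \<le> 1 / D / 2" "inverse b \<in> ?S" "inverse b \<noteq> 0"
  proof -
    have "dist 0 (inverse b) = 1 / cmod b" by (simp add: dist_norm norm_divide inverse_eq_divide)
    also have "\<dots> \<le> 1 / (2 * D)" using b b0 D0 by (intro divide_left_mono) (auto intro!: mult_pos_pos)
    also have "\<dots> = 1 / D / 2" by simp
    finally show d: "dist 0 (inverse b) \<le> 1 / D / 2" .
    have "x / 2 < x" if "x > 0" for x :: real using that by simp
    from this[of "1 / D"] have "1 / D / 2 < 1 / D" using D0 by simp
    then show "inverse b \<in> ?S" unfolding mem_ball using d by (rule le_less_trans[rotated])
    show "inverse b \<noteq> 0" using b0 by auto
  qed
  have Hb: "H (inverse b) = hb" using H(1)[OF ib(2,3)] by (simp add: hb_def)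
  show "hb \<le> 3 * h0" using Harnack(1)[OF _ hH pos ib(1)] D0 by (simp add: Hb H0)
  show "h0 \<le> 3 * hb" using Harnack(2)[OF _ hH pos ib(1)] D0 by (simp add: Hb H0)
qed

lemma replace_far_zeros:
  assumes p: "p \<noteq> 0" and le: "\<And>z. z \<in> E \<Longrightarrow> cmod (poly p z) \<le> 1"
  obtains q where "q \<noteq> 0" "degree q = degree p" "\<And>z. cmod z > D \<Longrightarrow> poly q z \<noteq> 0"
    "\<And>z. z \<in> E \<Longrightarrow> cmod (poly q z) \<le> 1" "cmod (lead_coeff p) \<le> cmod (lead_coeff q)"
    "\<And>b. cmod b \<ge> 2 * D \<Longrightarrow> cmod (poly p b) \<le> cmod (poly q b)"
proof -
  let ?S = "{z. cmod z > D}"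
  \<comment> \<open>Chosen so that \<open>|z| * s <= |\<zeta>| - D / 4 <= |z - \<zeta>|\<close> for
    \<open>|z| <= D / 4\<close>. For \<open>|\<zeta>| > D\<close> it is at least 3, so the leading
    coefficient does not shrink, and \<open>|b| * s >= |b| + |\<zeta>|\<close> once
    \<open>|b| >= 2 * D\<close>.\<close>
  define s where "s \<zeta> = 4 * cmod \<zeta> / D - 1" for \<zeta> :: complex
  define r where "r \<zeta> = [:0, complex_of_real (s \<zeta>):]" for \<zeta> :: complex
  have s: "s \<zeta> \<ge> 3" if "\<zeta> \<in> ?S" for \<zeta>
    using that D0 by (simp add: s_def field_simps)
  have nr: "cmod (poly (r \<zeta>) z) = cmod z * s \<zeta>" if "\<zeta> \<in> ?S" for \<zeta> z
    using s[OF that] unfolding r_def by (simp add: norm_mult)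
  have lr: "degree (r \<zeta>) = 1 \<and> cmod (lead_coeff (r \<zeta>)) \<ge> 1" if "\<zeta> \<in> ?S" for \<zeta>
    using s[OF that] unfolding r_def by simp
  have rr: "r \<zeta> \<noteq> 0 \<and> degree (r \<zeta>) \<le> 1 \<and> (\<forall>z\<in>?S. poly (r \<zeta>) z \<noteq> 0) \<and>
      (\<forall>z\<in>E. cmod (poly (r \<zeta>) z) \<le> cmod (z - \<zeta>))" if \<zeta>: "\<zeta> \<in> ?S" for \<zeta>
  proof (intro conjI ballI)
    show "r \<zeta> \<noteq> 0" "degree (r \<zeta>) \<le> 1" using lr[OF \<zeta>] by auto
    show "poly (r \<zeta>) z \<noteq> 0" if "z \<in> ?S" for z
    proof -
      have "cmod z * s \<zeta> > 0" using that s[OF \<zeta>] D0 by (intro mult_pos_pos) auto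
      then show ?thesis using nr[OF \<zeta>, of z] by auto
    qed
    show "cmod (poly (r \<zeta>) z) \<le> cmod (z - \<zeta>)" if "z \<in> E" for z
    proof -
      have "cmod (poly (r \<zeta>) z) \<le> D / 4 * s \<zeta>"
        unfolding nr[OF \<zeta>] using norm_E[OF that] s[OF \<zeta>] by (intro mult_right_mono) auto
      also have "\<dots> = cmod \<zeta> - D / 4" using D0 by (simp add: s_def field_simps)
      also have "\<dots> \<le> cmod (z - \<zeta>)"
        using norm_triangle_ineq2[of \<zeta> z] norm_E[OF that] by (simp add: norm_minus_commute)
      finally show ?thesis .
    qed
  qed
  obtain q where q: "q \<noteq> 0" "\<And>z. z \<in> ?S \<Longrightarrow> poly q z \<noteq> 0"
    "\<And>z. z \<in> E \<Longrightarrow> cmod (poly q z) \<le> cmod (poly p z)"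
    "\<And>a. \<forall>\<zeta>\<in>?S. cmod (a - \<zeta>) \<le> cmod (poly (r \<zeta>) a) \<Longrightarrow> cmod (poly p a) \<le> cmod (poly q a)"
    "\<forall>\<zeta>\<in>?S. degree (r \<zeta>) = 1 \<and> cmod (lead_coeff (r \<zeta>)) \<ge> 1 \<Longrightarrow>
        degree q = degree p \<and> cmod (lead_coeff p) \<le> cmod (lead_coeff q)"
    by (rule replace_zeros[of p ?S r E, OF p rr]) (assumption, (rule that; assumption))
  have "degree q = degree p \<and> cmod (lead_coeff p) \<le> cmod (lead_coeff q)"
    by (rule q(5)) (use lr in blast)
  then show ?thesis
  proof (intro that)
    show "cmod (poly q z) \<le> 1" if "z \<in> E" for z using q(3)[OF that] le[OF that] by simp
    show "cmod (poly p b) \<le> cmod (poly q b)" if b: "cmod b \<ge> 2 * D" for b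
    proof (rule q(4), rule ballI)
      fix \<zeta> assume \<zeta>: "\<zeta> \<in> ?S"
      have "cmod (b - \<zeta>) \<le> cmod b + cmod \<zeta>" by (rule norm_triangle_ineq4)
      also have "\<dots> \<le> cmod b + cmod b * (3 * cmod \<zeta> / D - 2)"
      proof -
        have "cmod \<zeta> \<le> 2 * D * (3 * cmod \<zeta> / D - 2)" using \<zeta> D0 by (simp add: field_simps)
        also have "\<dots> \<le> cmod b * (3 * cmod \<zeta> / D - 2)" using b \<zeta> D0 by (intro mult_right_mono) (auto simp: field_simps)
        finally show ?thesis by simp
      qed
      also have "\<dots> \<le> cmod b * s \<zeta>"
      proof -
        have "1 + (3 * cmod \<zeta> / D - 2) \<le> s \<zeta>" using \<zeta> D0 by (simp add: s_def field_simps)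
        then have "cmod b * (1 + (3 * cmod \<zeta> / D - 2)) \<le> cmod b * s \<zeta>" by (intro mult_left_mono) auto
        then show ?thesis by (simp only: distrib_left mult_1_right)
      qed
      finally show "cmod (b - \<zeta>) \<le> cmod (poly (r \<zeta>) b)" unfolding nr[OF \<zeta>] .
    qed
  qed (use q(1,2) in auto)
qed

lemma extremal_growth_infinity:
  assumes b: "cmod b \<ge> 2 * D"
  shows "extremal_growth_at b \<longleftrightarrow> extremal_growth_at_infinity"
proof
  assume "extremal_growth_at b"
  then obtain C where C: "C > 0" and ex: "\<And>n. n \<ge> 1 \<Longrightarrow> \<exists>p. degree p \<le> n \<and> (\<forall>z\<in>E. cmod (poly p z) \<le> 1) \<and>
     exp (real n * green b) \<le> C * cmod (poly p b)"
    by (auto simp: extremal_growth_at_def)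
  have "\<exists>q. degree q = n \<and> (\<forall>z\<in>E. cmod (poly q z) \<le> 1) \<and> exp (real n * (V - ln D)) \<le> exp (3 * ln C) * cmod (lead_coeff q)"
    if n: "n \<ge> 1" for n
  proof -
    obtain p where p: "degree p \<le> n" "\<And>z. z \<in> E \<Longrightarrow> cmod (poly p z) \<le> 1" "exp (real n * green b) \<le> C * cmod (poly p b)"
      using ex[OF n] by blast
    have pb: "cmod (poly p b) > 0" "n * green b - ln (cmod (poly p b)) \<le> ln C"
      using p(3) C by (simp_all add: exp_le_mult_iff)
    then have p0: "p \<noteq> 0" by auto
    \<comment> \<open>Raises the degree to exactly \<open>n\<close>: \<open>4 z / D\<close> has
      modulus at most 1 on \<open>E\<close> and at least 1 at \<open>b\<close>.\<close>
    define p1 where "p1 = p * [:0, complex_of_real (4 / D):] ^ (n - degree p)"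
    have l0: "complex_of_real (4 / D) \<noteq> 0" using D0 by simp
    have p10: "p1 \<noteq> 0" using p0 l0 by (simp add: p1_def)
    have dp1: "degree p1 = n" using p0 l0 p(1) by (simp add: p1_def degree_mult_eq degree_power_eq)
    have np1: "cmod (poly p1 z) = cmod (poly p z) * (cmod z * (4 / D)) ^ (n - degree p)" for z
      using D0 by (simp add: p1_def norm_mult norm_power norm_divide poly_power)
    have le1: "cmod (poly p1 z) \<le> 1" if "z \<in> E" for z
    proof -
      have "(cmod z * (4 / D)) ^ (n - degree p) \<le> 1"
        using norm_E[OF that] D0 by (intro power_le_one) (auto simp: field_simps)
      then show ?thesis unfolding np1 using p(2)[OF that] D0 by (intro mult_le_one) auto
    qed
    have pb1: "cmod (poly p b) \<le> cmod (poly p1 b)"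
    proof -
      have "1 \<le> (cmod b * (4 / D)) ^ (n - degree p)"
        using b D0 by (intro one_le_power) (simp add: field_simps)
      then show ?thesis unfolding np1 using mult_left_mono[of 1 _ "cmod (poly p b)"] by simp
    qed
    obtain q where q: "q \<noteq> 0" "degree q = degree p1" "\<And>z. cmod z > D \<Longrightarrow> poly q z \<noteq> 0"
      "\<And>z. z \<in> E \<Longrightarrow> cmod (poly q z) \<le> 1" "\<And>b. cmod b \<ge> 2 * D \<Longrightarrow> cmod (poly p1 b) \<le> cmod (poly q b)"
      by (rule replace_far_zeros[OF p10 le1]) (assumption, (rule that; assumption))
    have "ln (cmod (poly p b)) \<le> ln (cmod (poly q b))"
      using pb(1) pb1 q(5)[OF b] by (intro ln_mono) auto
    then have "n * (V - ln D) - ln (cmod (lead_coeff q)) \<le> ln (exp (3 * ln C))"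
      using Harnack_at_infinity(2)[of q n b] q dp1 b pb(2) by simp
    then have "exp (real n * (V - ln D)) \<le> exp (3 * ln C) * cmod (lead_coeff q)"
      using q(1) by (subst exp_le_mult_iff) auto
    then show ?thesis using q dp1 by blast
  qed
  then show extremal_growth_at_infinity
    unfolding extremal_growth_at_infinity_def by (intro exI[of _ "exp (3 * ln C)"]) auto
next
  assume extremal_growth_at_infinity
  then obtain C where C: "C > 0" and ex: "\<And>n. n \<ge> 1 \<Longrightarrow> \<exists>p. degree p = n \<and> (\<forall>z\<in>E. cmod (poly p z) \<le> 1) \<and>
     exp (real n * (V - ln D)) \<le> C * cmod (lead_coeff p)"
    by (auto simp: extremal_growth_at_infinity_def)
  have "\<exists>q. degree q \<le> n \<and> (\<forall>z\<in>E. cmod (poly q z) \<le> 1) \<and> exp (real n * green b) \<le> exp (3 * ln C) * cmod (poly q b)"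
    if n: "n \<ge> 1" for n
  proof -
    obtain p where p: "degree p = n" "\<And>z. z \<in> E \<Longrightarrow> cmod (poly p z) \<le> 1" "exp (real n * (V - ln D)) \<le> C * cmod (lead_coeff p)"
      using ex[OF n] by blast
    have pl: "cmod (lead_coeff p) > 0" "n * (V - ln D) - ln (cmod (lead_coeff p)) \<le> ln C"
      using p(3) C exp_le_mult_iff[OF C, of "cmod (lead_coeff p)"] by auto
    then have p0: "p \<noteq> 0" by auto
    obtain q where q: "q \<noteq> 0" "degree q = degree p" "\<And>z. cmod z > D \<Longrightarrow> poly q z \<noteq> 0"
      "\<And>z. z \<in> E \<Longrightarrow> cmod (poly q z) \<le> 1" "cmod (lead_coeff p) \<le> cmod (lead_coeff q)"
      by (rule replace_far_zeros[OF p0 p(2)]) (assumption, (rule that; assumption))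
    have "ln (cmod (lead_coeff p)) \<le> ln (cmod (lead_coeff q))"
      using pl(1) q(5) by (intro ln_mono) auto
    then have *: "n * green b - ln (cmod (poly q b)) \<le> ln (exp (3 * ln C))"
      using Harnack_at_infinity(1)[of q n b] q p(1) b pl(2) by simp
    have "poly q b \<noteq> 0" using q(3)[of b] b D0 by simp
    then have "exp (real n * green b) \<le> exp (3 * ln C) * cmod (poly q b)"
      using * by (subst exp_le_mult_iff) auto
    then show ?thesis using q p(1) by (intro exI[of _ q]) auto
  qed
  then show "extremal_growth_at b"
    unfolding extremal_growth_at_def by (intro exI[of _ "exp (3 * ln C)"]) auto
qed

section \<open>Comparison with the Widom factors\<close>

lemma E_nonempty: "E \<noteq> {}" using infinite_E by auto

lemma sup_norm_smult: "sup_norm E (smult c p) = cmod c * sup_norm E p"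
proof (cases "c = 0")
  case True
  then show ?thesis using E_nonempty by (simp add: sup_norm_def)
next
  case False
  have le: "sup_norm E (smult c p) \<le> cmod c * sup_norm E p" for c p
    using sup_norm_upper[OF compact_E] by (intro sup_norm_least[OF E_nonempty]) (auto simp: norm_mult intro!: mult_left_mono)
  have "sup_norm E p = sup_norm E (smult (inverse c) (smult c p))" using False by simp
  also have "\<dots> \<le> cmod (inverse c) * sup_norm E (smult c p)" by (rule le)
  finally have "cmod c * sup_norm E p \<le> sup_norm E (smult c p)" using False unfolding norm_inverse by (simp add: field_simps)
  then show ?thesis using le[of c p] by simp
qed

text \<open>Scaling exchanges value 1 at \<open>a\<close> with small norm for norm at most 1 with a
  large value at \<open>a\<close>. Since \<open>green a >= 0\<close>, the two powers add up to at
  most \<open>2 * exp (n * green a)\<close>, hence \<open>2 * C\<close>.\<close>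

lemma widom_factor_bounded_iff_growth_at:
  assumes a: "a \<notin> E"
  shows "(\<exists>C. \<forall>n\<ge>1. widom_factor E n (Some a) \<le> C) \<longleftrightarrow> extremal_growth_at a"
proof
  define T where "T n = residual_poly E n a" for n
  have wf: "widom_factor E n (Some a) = sup_norm E (T n) * (exp (- (n * green a)) + exp (n * green a))" for n
  proof -
    have "capacity_at E a ^ n = exp (- (n * green a))"
      by (simp add: capacity_at_def green_function_eq exp_of_nat_mult[symmetric])
    moreover have "inverse (capacity_at E a) ^ n = exp (n * green a)"
      by (simp add: capacity_at_def green_function_eq exp_of_nat_mult[symmetric] exp_minus)
    ultimately show ?thesis by (simp add: widom_factor_def T_def)
  qed
  have T: "degree (T n) \<le> n" "poly (T n) a = 1" "\<And>q. degree q \<le> n \<Longrightarrow> poly q a = 1 \<Longrightarrow> sup_norm E (T n) \<le> sup_norm E q"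
    "sup_norm E (T n) > 0" if "n \<ge> 1" for n
  proof -
    have n: "n > 0" using that by simp
    note r = residual_poly_minimal[OF compact_E infinite_E n a]
    show "degree (T n) \<le> n" "poly (T n) a = 1" "\<And>q. degree q \<le> n \<Longrightarrow> poly q a = 1 \<Longrightarrow> sup_norm E (T n) \<le> sup_norm E q"
      using r by (auto simp: T_def)
    then show "sup_norm E (T n) > 0" by (intro sup_norm_pos[OF compact_E infinite_E]) auto
  qed
  {
    assume "\<exists>C. \<forall>n\<ge>1. widom_factor E n (Some a) \<le> C"
    then obtain C where C: "\<And>n. n \<ge> 1 \<Longrightarrow> widom_factor E n (Some a) \<le> C" by blast
    have "\<exists>p. degree p \<le> n \<and> (\<forall>z\<in>E. cmod (poly p z) \<le> 1) \<and> exp (real n * green a) \<le> max C 1 * cmod (poly p a)"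
      if n: "n \<ge> 1" for n
    proof (intro exI conjI ballI)
      let ?p = "smult (of_real (1 / sup_norm E (T n))) (T n)"
      show "degree ?p \<le> n" using T(1)[OF n] degree_smult_le order_trans by blast
      show "cmod (poly ?p z) \<le> 1" if "z \<in> E" for z
        using sup_norm_upper[OF compact_E that, of "T n"] T(4)[OF n] by (simp add: norm_mult norm_divide)
      have "sup_norm E (T n) * exp (n * green a) \<le> widom_factor E n (Some a)"
        unfolding wf using T(4)[OF n] by (intro mult_left_mono) auto
      also have "\<dots> \<le> max C 1" using C[OF n] by simp
      finally show "exp (real n * green a) \<le> max C 1 * cmod (poly ?p a)"
        using T(2,4)[OF n] by (simp add: norm_divide field_simps)
    qed
    then show "extremal_growth_at a" unfolding extremal_growth_at_def by (intro exI[of _ "max C 1"]) auto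
  }
  {
    assume "extremal_growth_at a"
    then obtain C where C: "C > 0" and ex: "\<And>n. n \<ge> 1 \<Longrightarrow> \<exists>p. degree p \<le> n \<and> (\<forall>z\<in>E. cmod (poly p z) \<le> 1) \<and>
       exp (real n * green a) \<le> C * cmod (poly p a)"
      by (auto simp: extremal_growth_at_def)
    have "widom_factor E n (Some a) \<le> 2 * C" if n: "n \<ge> 1" for n
    proof -
      obtain p where p: "degree p \<le> n" "\<And>z. z \<in> E \<Longrightarrow> cmod (poly p z) \<le> 1" "exp (real n * green a) \<le> C * cmod (poly p a)"
        using ex[OF n] by blast
      have pa: "cmod (poly p a) > 0" using p(3) C by (simp add: exp_le_mult_iff)
      have "sup_norm E (T n) \<le> sup_norm E (smult (inverse (poly p a)) p)"
        using pa p(1) degree_smult_le[of "inverse (poly p a)" p] by (intro T(3)[OF n]) auto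
      also have "\<dots> \<le> inverse (cmod (poly p a)) * 1"
        unfolding sup_norm_smult norm_inverse using p(2) by (intro mult_left_mono sup_norm_least E_nonempty) auto
      finally have s: "sup_norm E (T n) \<le> 1 / cmod (poly p a)" by (simp add: inverse_eq_divide)
      have "exp (- (n * green a)) \<le> exp (n * green a)" using green_nonneg[of a] by simp
      then have "widom_factor E n (Some a) \<le> 1 / cmod (poly p a) * (2 * exp (n * green a))"
        unfolding wf using s pa by (intro mult_mono) auto
      also have "\<dots> \<le> 1 / cmod (poly p a) * (2 * (C * cmod (poly p a)))" using p(3) pa by (intro mult_left_mono) auto
      also have "\<dots> = 2 * C" using pa by simp
      finally show ?thesis .
    qed
    then show "\<exists>C. \<forall>n\<ge>1. widom_factor E n (Some a) \<le> C" by blast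
  }
qed

text \<open>As \<open>1 / capacity E = exp (V - ln D)\<close>, scaling by the leading coefficient or
  by the norm exchanges the two normalizations, here without a factor 2.\<close>

lemma widom_factor_bounded_iff_growth_at_infinity:
  assumes cap: "capacity E = exp (ln D - V)"
  shows "(\<exists>C. \<forall>n\<ge>1. widom_factor E n None \<le> C) \<longleftrightarrow> extremal_growth_at_infinity"
proof
  define T where "T n = chebyshev_poly E n" for n
  have wf: "widom_factor E n None = sup_norm E (T n) * exp (n * (V - ln D))" for n
  proof -
    have "1 / capacity E ^ n = exp (n * (V - ln D))"
      unfolding cap exp_of_nat_mult[symmetric] by (simp add: exp_minus[symmetric] inverse_eq_divide[symmetric] algebra_simps)
    then show ?thesis by (simp add: widom_factor_def T_def divide_inverse)
  qed
  have T: "degree (T n) = n" "lead_coeff (T n) = 1" "\<And>q. degree q = n \<Longrightarrow> lead_coeff q = 1 \<Longrightarrow> sup_norm E (T n) \<le> sup_norm E q"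
    "sup_norm E (T n) > 0" if "n \<ge> 1" for n
  proof -
    have n: "n > 0" using that by simp
    note r = chebyshev_poly_minimal[OF compact_E infinite_E n]
    show "degree (T n) = n" "lead_coeff (T n) = 1" "\<And>q. degree q = n \<Longrightarrow> lead_coeff q = 1 \<Longrightarrow> sup_norm E (T n) \<le> sup_norm E q"
      unfolding T_def by (rule r)+
    have "T n \<noteq> 0" using \<open>lead_coeff (T n) = 1\<close> by auto
    then show "sup_norm E (T n) > 0" by (intro sup_norm_pos[OF compact_E infinite_E])
  qed
  {
    assume "\<exists>C. \<forall>n\<ge>1. widom_factor E n None \<le> C"
    then obtain C where C: "\<And>n. n \<ge> 1 \<Longrightarrow> widom_factor E n None \<le> C" by blast
    have "\<exists>p. degree p = n \<and> (\<forall>z\<in>E. cmod (poly p z) \<le> 1) \<and> exp (real n * (V - ln D)) \<le> max C 1 * cmod (lead_coeff p)"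
      if n: "n \<ge> 1" for n
    proof (intro exI conjI ballI)
      let ?p = "smult (of_real (1 / sup_norm E (T n))) (T n)"
      show "degree ?p = n" using T(1,4)[OF n] by simp
      show "cmod (poly ?p z) \<le> 1" if "z \<in> E" for z
        using sup_norm_upper[OF compact_E that, of "T n"] T(4)[OF n] by (simp add: norm_mult norm_divide)
      have "lead_coeff ?p = of_real (1 / sup_norm E (T n))" using T(2)[OF n] by (simp add: lead_coeff_smult)
      then have lc: "cmod (lead_coeff ?p) = 1 / sup_norm E (T n)" using T(4)[OF n] by (simp add: norm_divide)
      have "sup_norm E (T n) * exp (n * (V - ln D)) \<le> max C 1" using C[OF n] by (simp add: wf)
      then show "exp (real n * (V - ln D)) \<le> max C 1 * cmod (lead_coeff ?p)"
        unfolding lc using T(4)[OF n] by (simp add: field_simps)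
    qed
    then show extremal_growth_at_infinity unfolding extremal_growth_at_infinity_def by (intro exI[of _ "max C 1"]) auto
  }
  {
    assume extremal_growth_at_infinity
    then obtain C where C: "C > 0" and ex: "\<And>n. n \<ge> 1 \<Longrightarrow> \<exists>p. degree p = n \<and> (\<forall>z\<in>E. cmod (poly p z) \<le> 1) \<and>
       exp (real n * (V - ln D)) \<le> C * cmod (lead_coeff p)"
      by (auto simp: extremal_growth_at_infinity_def)
    have "widom_factor E n None \<le> C" if n: "n \<ge> 1" for n
    proof -
      obtain p where p: "degree p = n" "\<And>z. z \<in> E \<Longrightarrow> cmod (poly p z) \<le> 1" "exp (real n * (V - ln D)) \<le> C * cmod (lead_coeff p)"
        using ex[OF n] by blast
      have pl: "cmod (lead_coeff p) > 0" using p(3) exp_le_mult_iff[OF C, of "cmod (lead_coeff p)"] by auto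
      have "degree (smult (inverse (lead_coeff p)) p) = n" using pl p(1) by simp
      moreover have "lead_coeff (smult (inverse (lead_coeff p)) p) = 1" unfolding lead_coeff_smult using pl by simp
      ultimately have "sup_norm E (T n) \<le> sup_norm E (smult (inverse (lead_coeff p)) p)" by (rule T(3)[OF n])
      also have "\<dots> \<le> inverse (cmod (lead_coeff p)) * 1"
        unfolding sup_norm_smult norm_inverse using p(2) by (intro mult_left_mono sup_norm_least E_nonempty) auto
      finally have s: "sup_norm E (T n) \<le> 1 / cmod (lead_coeff p)" by (simp add: inverse_eq_divide)
      have "widom_factor E n None \<le> 1 / cmod (lead_coeff p) * exp (n * (V - ln D))"
        unfolding wf using s by (intro mult_right_mono) auto
      also have "\<dots> \<le> 1 / cmod (lead_coeff p) * (C * cmod (lead_coeff p))" using p(3) pl by (intro mult_left_mono) auto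
      also have "\<dots> = C" using pl by simp
      finally show ?thesis .
    qed
    then show "\<exists>C. \<forall>n\<ge>1. widom_factor E n None \<le> C" by blast
  }
qed

lemma widom_factor_bounded_iff:
  assumes cap: "capacity E = exp (ln D - V)" and x: "x \<in> extended_reals - Some ` E"
  shows "(\<exists>C. \<forall>n\<ge>1. widom_factor E n x \<le> C) \<longleftrightarrow> extremal_growth_at \<i>"
proof -
  \<comment> \<open>A real point far enough out for \<open>extremal_growth_infinity\<close> links
    infinity with the base point \<open>\<i>\<close>.\<close>
  have b: "cmod (of_real (2 * D)) \<ge> 2 * D" "complex_of_real (2 * D) \<notin> E"
    using D0 by (auto intro!: far_not_in_E)
  have inf: "extremal_growth_at_infinity \<longleftrightarrow> extremal_growth_at \<i>"
    using extremal_growth_infinity[OF b(1)] extremal_growth_real[OF b(2)] by blast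
  show ?thesis
  proof (cases x)
    case None
    then show ?thesis using widom_factor_bounded_iff_growth_at_infinity[OF cap] inf by simp
  next
    case (Some a)
    then obtain r where r: "a = of_real r" "a \<notin> E" using x by (auto simp: extended_reals_def Reals_def)
    then show ?thesis using widom_factor_bounded_iff_growth_at[of a] extremal_growth_real[of r] Some by simp
  qed
qed

end

lemma SUP_ereal_finite_iff:
  "(SUP n\<in>{1::nat..}. ereal (f n)) < \<infinity> \<longleftrightarrow> (\<exists>C. \<forall>n\<ge>1. f n \<le> C)"
proof
  assume "(SUP n\<in>{1::nat..}. ereal (f n)) < \<infinity>"
  then obtain m :: nat where m: "(SUP n\<in>{1::nat..}. ereal (f n)) < ereal (real m)"
    using less_PInf_Ex_of_nat by auto
  have "f n \<le> real m" if "n \<ge> 1" for n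
  proof -
    have "ereal (f n) \<le> (SUP n\<in>{1::nat..}. ereal (f n))" using that by (intro SUP_upper) simp
    then have "ereal (f n) < ereal (real m)" using m by (rule le_less_trans)
    then show ?thesis by simp
  qed
  then show "\<exists>C. \<forall>n\<ge>1. f n \<le> C" by blast
next
  assume "\<exists>C. \<forall>n\<ge>1. f n \<le> C"
  then obtain C where "\<And>n. n \<ge> 1 \<Longrightarrow> f n \<le> C" by blast
  then have "(SUP n\<in>{1::nat..}. ereal (f n)) \<le> ereal C" by (intro SUP_least) simp
  then show "(SUP n\<in>{1::nat..}. ereal (f n)) < \<infinity>" by (rule le_less_trans) simp
qed

theorem theorem2p3:
  fixes E :: "complex set" and x1 x2 :: "complex option"
  assumes "compact E" and "E \<subseteq> \<real>" and "capacity E > 0"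
    and "x1 \<in> extended_reals - Some ` E" and "x2 \<in> extended_reals - Some ` E"
  shows "(SUP n\<in>{1..}. ereal (widom_factor E n x1)) < \<infinity> \<longleftrightarrow>
         (SUP n\<in>{1..}. ereal (widom_factor E n x2)) < \<infinity>"
proof -
  define A where "A = Re ` E"
  have EA: "E = complex_of_real ` A" using assms(2) unfolding A_def by (force simp: image_iff elim: Reals_cases)
  have A: "compact A" unfolding A_def using assms(1) by (intro compact_continuous_image continuous_intros)
  obtain B where B: "\<And>x. x \<in> A \<Longrightarrow> \<bar>x\<bar> \<le> B"
    using compact_imp_bounded[OF A] by (auto simp: bounded_iff)
  \<comment> \<open>One \<open>D\<close> serves the radius \<open>D / 2\<close> of the energy lemmas
    and the \<open>D / 4\<close> of the locale; \<open>D >= 1\<close> makes \<open>ln D\<close>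
    nonnegative.\<close>
  define D where "D = max 1 (4 * B)"
  have D: "D \<ge> 1" "\<And>x. x \<in> A \<Longrightarrow> \<bar>x\<bar> \<le> D / 4" "\<And>x. x \<in> A \<Longrightarrow> \<bar>x\<bar> \<le> D / 2"
    using B by (fastforce simp: D_def)+
  have fin: "\<exists>N\<in>prob_on A. energy D N < \<infinity>"
    using assms(3) unfolding EA by (intro capacity_pos_finite_energy[OF _ A D(1,3)])
  then have "A \<noteq> {}" by (auto simp: prob_on_def)
  then obtain M V where M: "M \<in> prob_on A" "V \<ge> 0"
    "\<And>N. N \<in> prob_on A \<Longrightarrow> ennreal V \<le> energy D N"
    "energy D M = ennreal V"
    "\<And>x. potential D M x \<le> ennreal V"
    "capacity (complex_of_real ` {x\<in>A. (potential D M x) < ennreal V}) = 0"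
    using equilibrium_measure[OF A _ D(1,3) fin] by blast
  interpret eq: equilibrium A D V M
    by unfold_locales (use A D M in auto)
  have cap: "capacity (complex_of_real ` A) = exp (ln D - V)"
    by (rule capacity_eq_exp[OF A D(1,3) M(1,4,2,3)])
  show ?thesis
    unfolding SUP_ereal_finite_iff
    using eq.widom_factor_bounded_iff[OF cap assms(4)[unfolded EA]] eq.widom_factor_bounded_iff[OF cap assms(5)[unfolded EA]]
    unfolding EA by simp
qed

end
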